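(* Let $N\ge3$, let $w\in\mathcal W$ and let $u=\mathcal K(w)$ be given by the Kelvin transform $u(x)=|y|^{N-2}w(y)$, $y=x/|x|^2$. Then for $0<\varepsilon<1$, $$I_\varepsilon[u]=I_{1/\varepsilon}[w]+2\Lambda_{1/\varepsilon}(w),\qquad\text{where}\quad \Lambda_{1/\varepsilon}(w)=\frac{N-2}{2}\,\varepsilon\int_{\partial B_{1/\varepsilon}(0)}w^2\,dS .$$ Moreover, $$\Lambda_\varepsilon(u)=\Lambda_{1/\varepsilon}(w).$$
   Context: $B_r(0)$ is the ball in $\mathbb{R}^N$ of radius $r$ centered at $0$. $I_\varepsilon[u]$ and $I_{1/\varepsilon}[w]$ denote the Hardy functionals on annuli: $$I_\varepsilon[u]=\int_{B_1(0)\setminus B_\varepsilon(0)}|\nabla u|^2dx-\Big(\frac{N-2}{2}\Big)^2\int_{B_1(0)\setminus B_\varepsilon(0)}\frac{u^2}{|x|^2}dx,$$ $$I_{1/\varepsilon}[w]=\int_{B_{1/\varepsilon}(0)\setminus B_1(0)}|\nabla w|^2dy-\Big(\frac{N-2}{2}\Big)^2\int_{B_{1/\varepsilon}(0)\setminus B_1(0)}\frac{w^2}{|y|^2}dy .$$ Also $\Lambda_\varepsilon(u)=\frac{N-2}{2}\,\varepsilon^{-1}\int_{\partial B_\varepsilon(0)}u^2\,dS$. $H=H(B_1(0))$ is the completion of $C_0^\infty(B_1(0))$ under $\|\phi\|_H^2=\int_{B_1}|\nabla\phi|^2dx-\big(\frac{N-2}{2}\big)^2\int_{B_1}\frac{\phi^2}{|x|^2}dx$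 (a space of functions on $B_1(0)$). $\mathcal W$ is the space of functions $w$ on $\{|y|\ge1\}$ that is the isometric image of $H$ under the Kelvin transformation, i.e. $w\in\mathcal W$ iff $u=\mathcal K(w)\in H$, with $\|w\|_{\mathcal W}=\|u\|_H$; in particular such functions vanish on $|y|=1$. *)

theory Defs
  imports "HOL-Analysis.Analysis"
begin

section \<open>Smooth functions and test functions\<close>

primrec Ck_on :: "nat \<Rightarrow> 'a::euclidean_space set \<Rightarrow> ('a \<Rightarrow> real) \<Rightarrow> bool" where
  "Ck_on 0 S f \<longleftrightarrow> continuous_on S f"
| "Ck_on (Suc k) S f \<longleftrightarrow> (\<forall>x\<in>S. f differentiable at x) \<and>
     (\<forall>b\<in>Basis. Ck_on k S (\<lambda>x. frechet_derivative f (at x) b))"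

(* Only used for open S. *)
definition smooth_on :: "'a::euclidean_space set \<Rightarrow> ('a \<Rightarrow> real) \<Rightarrow> bool" where
  "smooth_on S f \<longleftrightarrow> (\<forall>k. Ck_on k S f)"

definition grad :: "('a::euclidean_space \<Rightarrow> real) \<Rightarrow> 'a \<Rightarrow> 'a" where
  "grad f x = (\<Sum>b\<in>Basis. frechet_derivative f (at x) b *\<^sub>R b)"

(* C_0^\<infinity>(\<Omega>), each function being extended by zero to the whole space. *)
definition test_functions :: "'a::euclidean_space set \<Rightarrow> ('a \<Rightarrow> real) set" where
  "test_functions \<Omega> = {\<phi>. smooth_on UNIV \<phi> \<and>
     compact (closure {x. \<phi> x \<noteq> 0}) \<and> closure {x. \<phi> x \<noteq> 0} \<subseteq> \<Omega>}"

section \<open>Square integrable functions and weak gradients\<close>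

definition L2_space :: "'a measure \<Rightarrow> ('a \<Rightarrow> 'b::euclidean_space) set" where
  "L2_space M = {f \<in> borel_measurable M. integrable M (\<lambda>x. (norm (f x))\<^sup>2)}"

definition L2_tendsto ::
    "'a measure \<Rightarrow> (nat \<Rightarrow> 'a \<Rightarrow> 'b::euclidean_space) \<Rightarrow> ('a \<Rightarrow> 'b) \<Rightarrow> bool" where
  "L2_tendsto M f g \<longleftrightarrow> (\<forall>n. f n \<in> L2_space M) \<and> g \<in> L2_space M \<and>
     (\<lambda>n. LINT x|M. (norm (f n x - g x))\<^sup>2) \<longlonglongrightarrow> 0"

definition has_weak_grad ::
    "'a::euclidean_space set \<Rightarrow> ('a \<Rightarrow> real) \<Rightarrow> ('a \<Rightarrow> 'a) \<Rightarrow> bool" where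
  "has_weak_grad \<Omega> u G \<longleftrightarrow>
     (\<forall>K. compact K \<and> K \<subseteq> \<Omega> \<longrightarrow>
        u absolutely_integrable_on K \<and> G absolutely_integrable_on K) \<and>
     (\<forall>\<phi>\<in>test_functions \<Omega>.
        (LINT x|lebesgue_on \<Omega>. u x *\<^sub>R grad \<phi> x) = - (LINT x|lebesgue_on \<Omega>. \<phi> x *\<^sub>R G x))"

(* Well defined up to null sets whenever a weak gradient exists. *)
definition weak_grad :: "'a::euclidean_space set \<Rightarrow> ('a \<Rightarrow> real) \<Rightarrow> 'a \<Rightarrow> 'a" where
  "weak_grad \<Omega> u = (SOME G. has_weak_grad \<Omega> u G)"

section \<open>Surface measure and traces on spheres\<close>

(* Surface measure dS on the sphere of radius r > 0 about 0: a cone over a set A in the sphere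
   with apex 0 has volume (r / N) * dS(A). *)
definition sphere_measure :: "real \<Rightarrow> 'a::euclidean_space measure" where
  "sphere_measure r = scale_measure (ennreal (real DIM('a) / r))
     (distr (restrict_space lborel (ball 0 r - {0})) (restrict_space borel (sphere 0 r))
        (\<lambda>x. (r / norm x) *\<^sub>R x))"

definition shell :: "real \<Rightarrow> real \<Rightarrow> 'a::euclidean_space set" where
  "shell a b = {x. a < norm x \<and> norm x < b}"

(* g is the Sobolev trace on the sphere of radius r of u, which is H^1 near that sphere: the limit
   in L^2(dS) of the restrictions of smooth functions converging to u in H^1 of a neighbourhood.
   By the trace inequality g is unique up to dS-null sets, and does not depend on the
   neighbourhood or on the approximating sequence. *)
definition has_trace :: "real \<Rightarrow> ('a::euclidean_space \<Rightarrow> real) \<Rightarrow> ('a \<Rightarrow> real) \<Rightarrow> bool" where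
  "has_trace r u g \<longleftrightarrow> (\<exists>\<delta>>0. \<exists>G f.
     has_weak_grad (shell (r - \<delta>) (r + \<delta>)) u G \<and>
     (\<forall>n. smooth_on (shell (r - \<delta>) (r + \<delta>)) (f n)) \<and>
     L2_tendsto (lebesgue_on (shell (r - \<delta>) (r + \<delta>))) f u \<and>
     L2_tendsto (lebesgue_on (shell (r - \<delta>) (r + \<delta>))) (\<lambda>n. grad (f n)) G \<and>
     L2_tendsto (sphere_measure r) f g)"

definition sphere_trace :: "real \<Rightarrow> ('a::euclidean_space \<Rightarrow> real) \<Rightarrow> 'a \<Rightarrow> real" where
  "sphere_trace r u = (SOME g. has_trace r u g)"

section \<open>The Hardy functionals and the boundary term\<close>

definition hardy_const :: "'a::euclidean_space itself \<Rightarrow> real" where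
  "hardy_const _ = ((real DIM('a) - 2) / 2)\<^sup>2"

(* hardy_I \<epsilon> 1 u is I_\<epsilon>[u], and hardy_I 1 (1/\<epsilon>) w is I_{1/\<epsilon>}[w].
   The weak gradient is taken on the interior of the annulus, which differs from the domain of
   integration by a null set. *)
definition hardy_I :: "real \<Rightarrow> real \<Rightarrow> ('a::euclidean_space \<Rightarrow> real) \<Rightarrow> real" where
  "hardy_I a b u =
     (LINT x|lebesgue_on (ball 0 b - ball 0 a). (norm (weak_grad (shell a b) u x))\<^sup>2)
     - hardy_const TYPE('a) * (LINT x|lebesgue_on (ball 0 b - ball 0 a). (u x)\<^sup>2 / (norm x)\<^sup>2)"

definition hardy_Lambda :: "real \<Rightarrow> ('a::euclidean_space \<Rightarrow> real) \<Rightarrow> real" where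
  "hardy_Lambda r u = (real DIM('a) - 2) / 2 * inverse r *
     (LINT x|sphere_measure r. (sphere_trace r u x)\<^sup>2)"

section \<open>The spaces H and W\<close>

definition hardy_norm :: "('a::euclidean_space \<Rightarrow> real) \<Rightarrow> real" where
  "hardy_norm \<phi> = sqrt ((LINT x|lebesgue_on (ball 0 1). (norm (grad \<phi> x))\<^sup>2)
     - hardy_const TYPE('a) * (LINT x|lebesgue_on (ball 0 1). (\<phi> x)\<^sup>2 / (norm x)\<^sup>2))"

(* The completion of C_0^\<infinity>(B_1) under hardy_norm, realised as a space of functions. By the
   improved Hardy inequality (Brezis-Vazquez) hardy_norm dominates the L^2 norm, and it is
   closable in L^2, so that the completion embeds into L^2(B_1): a Cauchy sequence is identified
   with its L^2 limit. Elements are functions on the whole space of which only the values in B_1,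
   up to null sets, matter. *)
definition H_space :: "('a::euclidean_space \<Rightarrow> real) set" where
  "H_space = {u. \<exists>\<phi>. (\<forall>n::nat. \<phi> n \<in> test_functions (ball 0 1)) \<and>
     (\<forall>e>0. \<exists>M. \<forall>m\<ge>M. \<forall>n\<ge>M. hardy_norm (\<lambda>x. \<phi> m x - \<phi> n x) < e) \<and>
     L2_tendsto (lebesgue_on (ball 0 1)) \<phi> u}"

definition kelvin :: "('a::euclidean_space \<Rightarrow> real) \<Rightarrow> 'a \<Rightarrow> real" where
  "kelvin w x = (let y = inverse ((norm x)\<^sup>2) *\<^sub>R x in norm y ^ (DIM('a) - 2) * w y)"

(* Functions on {|y| \<ge> 1}: membership only depends on the values there, since the Kelvin transform
   maps B_1 - {0} onto {|y| > 1}. The Dirichlet condition on |y| = 1 is understood in the trace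
   sense, and is inherited from H_space. *)
definition W_space :: "('a::euclidean_space \<Rightarrow> real) set" where
  "W_space = {w. kelvin w \<in> H_space}"

end

theory Submission
  imports Defs
begin

text \<open>
  Write N for the dimension and x = y / |y|^2. The Kelvin transform u(x) = |y|^(N-2) w(y) has a
  simple gradient, because the inversion has an orthogonal derivative up to the factor |x|^(-2):
  comparing norms gives, pointwise,
  |y|^(2N) |\<nabla>w(y)|^2 = |\<nabla>u(x) + (N-2) u(x) x / |x|^2|^2.
  The inversion carries the measure dy into |x|^(-2N) dx, so that integration over the annulus yields
  I_{1/\<epsilon>}[w] = I_\<epsilon>[u] + (N-2) \<integral> (2 u \<nabla>u \<bullet> x + (N-2) u^2) / |x|^2 dx, the Hardy terms being equal.
  The integrand of the last integral is the divergence of u^2 x / |x|^2, or equivalently the radial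
  derivative of |x|^(N-2) u^2 divided by |x|^(N-1). Integrating along rays leaves only the boundary
  values: u vanishes on |x| = 1, and the sphere |x| = \<epsilon> contributes - (1/\<epsilon>) \<integral> u^2 dS. After
  multiplication by N-2 this is - 2 \<Lambda>_\<epsilon>(u), and \<Lambda>_\<epsilon>(u) = \<Lambda>_{1/\<epsilon>}(w) by scaling of the surface measure.

  This computation is valid for test functions. A general u in the space H is a limit of test
  functions \<phi>_n that is Cauchy only in the Hardy norm. The ground state substitution explains why
  this suffices: with \<alpha> = (N-2)/2,
  |\<nabla>\<phi>|^2 - \<alpha>^2 \<phi>^2 / |x|^2 = |\<nabla>\<phi> + \<alpha> \<phi> x / |x|^2|^2 - \<alpha> div (\<phi>^2 x / |x|^2),
  so that the Hardy norm controls \<nabla>\<phi> in L^2 away from the origin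
  (\<open>hardy_norm_shell_bound\<close>, \<open>H_space_approximation\<close>). Therefore \<nabla>\<phi>_n converges in L^2 of each
  annulus, its limit is the weak gradient of u, and the transformed functions converge to w in the
  same way on the reflected annulus (\<open>L2_tendsto_kelvin\<close>, \<open>L2_tendsto_kelvin_grad\<close>). Both sides
  of the identity are continuous for this convergence: weak gradients are unique almost everywhere
  (\<open>has_weak_grad_unique\<close>), and traces exist, are unique and depend continuously on the function by a
  trace inequality (\<open>has_trace_exists\<close>, \<open>has_trace_unique\<close>). The identity for test functions is
  \<open>boundary_flux_test_function\<close>, its limit is \<open>boundary_flux_limit\<close>, and the transformation of the
  energies is \<open>hardy_energy_kelvin\<close>.

  The integration along rays and the transformation of the measure under inversion both come from
  polar coordinates (\<open>polar_decomposition\<close>), that is, the statement that Lebesgue measure is the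
  product of s^(N-1) ds with the cone definition of surface measure.
\<close>

section \<open>Calculus of $C^k$ functions\<close>

lemma Ck_on_cong:
  fixes S :: "'a::euclidean_space set"
  assumes "open S"
  shows "(\<And>x. x \<in> S \<Longrightarrow> f x = g x) \<Longrightarrow> Ck_on k S f \<Longrightarrow> Ck_on k S g"
proof (induction k arbitrary: f g)
  case 0
  then show ?case by (metis Ck_on.simps(1) continuous_on_cong)
next
  case (Suc k)
  have d: "(g has_derivative frechet_derivative f (at x)) (at x)" if "x \<in> S" for x
    using Suc.prems that assms
    by (intro has_derivative_transform_within_open[of f _ x UNIV S g])
       (auto simp: frechet_derivative_works)
  have e: "frechet_derivative f (at x) = frechet_derivative g (at x)" if "x \<in> S" for x
    using frechet_derivative_at[OF d[OF that]] .
  show ?case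
    using Suc.prems Suc.IH[of "\<lambda>x. frechet_derivative f (at x) b" "\<lambda>x. frechet_derivative g (at x) b" for b] e
      differentiableI[OF d]
    by auto
qed

text \<open>
  The recursive definition of \<open>Ck_on\<close> refers to the chosen Frechet derivative. This rule
  lets any explicit formula for the derivative take its place, and carries all the closure properties below.
\<close>

lemma Ck_on_SucI:
  fixes S :: "'a::euclidean_space set"
  assumes "open S" and D: "\<And>x. x \<in> S \<Longrightarrow> (f has_derivative D x) (at x)"
    and "\<And>b. b \<in> Basis \<Longrightarrow> Ck_on k S (\<lambda>x. D x b)"
  shows "Ck_on (Suc k) S f"
proof -
  have "Ck_on k S (\<lambda>x. frechet_derivative f (at x) b)" if "b \<in> Basis" for b
    by (rule Ck_on_cong[OF assms(1) _ assms(3)[OF that]])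
       (simp add: frechet_derivative_at[OF D])
  moreover have "f differentiable (at x)" if "x \<in> S" for x
    using D[OF that] by (auto simp: differentiable_def)
  ultimately show ?thesis by simp
qed

lemma Ck_on_Suc_imp_continuous: "Ck_on (Suc k) S f \<Longrightarrow> continuous_on S f"
  by (auto intro!: continuous_at_imp_continuous_on differentiable_imp_continuous_within)

lemma Ck_on_Suc_imp: "Ck_on (Suc k) S f \<Longrightarrow> Ck_on k S f"
proof (induction k arbitrary: f)
  case 0
  then show ?case using Ck_on_Suc_imp_continuous[of 0] by auto
next
  case (Suc k)
  then show ?case by auto
qed

lemma Ck_on_imp_continuous: "Ck_on k S f \<Longrightarrow> continuous_on S f"
  by (cases k) (auto intro: Ck_on_Suc_imp_continuous simp del: Ck_on.simps(2))

lemma Ck_on_subset: "Ck_on k S f \<Longrightarrow> T \<subseteq> S \<Longrightarrow> Ck_on k T f"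
  by (induction k arbitrary: f) (auto intro: continuous_on_subset)

lemma Ck_on_SucD:
  assumes "Ck_on (Suc k) S f" "x \<in> S"
  shows "(f has_derivative frechet_derivative f (at x)) (at x)"
  using assms by (auto simp: frechet_derivative_works)

lemma Ck_on_const: "open S \<Longrightarrow> Ck_on k S (\<lambda>x. c)"
proof (induction k arbitrary: c)
  case (Suc k)
  show ?case
    by (rule Ck_on_SucI[where D = "\<lambda>x h. 0"]) (use Suc in auto)
qed simp

lemma Ck_on_inner: "open S \<Longrightarrow> Ck_on k S (\<lambda>x. x \<bullet> v)"
proof (cases k)
  case (Suc n)
  assume "open S"
  then show ?thesis unfolding Suc
    by (intro Ck_on_SucI[where D = "\<lambda>x h. h \<bullet> v"] Ck_on_const) (auto intro!: derivative_eq_intros)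
qed (auto intro!: continuous_intros)

lemma Ck_on_add:
  assumes "open S"
  shows "Ck_on k S f \<Longrightarrow> Ck_on k S g \<Longrightarrow> Ck_on k S (\<lambda>x. f x + g x)"
proof (induction k arbitrary: f g)
  case 0
  then show ?case by (auto intro!: continuous_intros)
next
  case (Suc k)
  show ?case
    by (rule Ck_on_SucI[OF assms has_derivative_add[OF Ck_on_SucD[OF Suc.prems(1)] Ck_on_SucD[OF Suc.prems(2)]]])
       (use Suc in auto)
qed

lemma Ck_on_mult:
  assumes "open S"
  shows "Ck_on k S f \<Longrightarrow> Ck_on k S g \<Longrightarrow> Ck_on k S (\<lambda>x. f x * g x)"
proof (induction k arbitrary: f g)
  case 0
  then show ?case by (auto intro!: continuous_intros)
next
  case (Suc k)
  show ?case
    by (rule Ck_on_SucI[OF assms has_derivative_mult[OF Ck_on_SucD[OF Suc.prems(1)] Ck_on_SucD[OF Suc.prems(2)]]])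
       (use Suc Ck_on_Suc_imp[OF Suc.prems(1)] Ck_on_Suc_imp[OF Suc.prems(2)] in \<open>auto intro!: Ck_on_add[OF assms]\<close>)
qed

lemma Ck_on_sum:
  assumes "open S" "finite A" "\<And>i. i \<in> A \<Longrightarrow> Ck_on k S (f i)"
  shows "Ck_on k S (\<lambda>x. \<Sum>i\<in>A. f i x)"
  using assms(2,3) by (induction A rule: finite_induct) (auto intro!: Ck_on_add Ck_on_const assms(1))

lemma Ck_on_prod:
  assumes "open S" "finite A" "\<And>i. i \<in> A \<Longrightarrow> Ck_on k S (f i)"
  shows "Ck_on k S (\<lambda>x. \<Prod>i\<in>A. f i x)"
  using assms(2,3) by (induction A rule: finite_induct) (auto intro!: Ck_on_mult Ck_on_const assms(1))

lemma Ck_on_power: "open S \<Longrightarrow> Ck_on k S f \<Longrightarrow> Ck_on k S (\<lambda>x. f x ^ n)"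
  by (induction n) (auto intro!: Ck_on_mult Ck_on_const)

lemma Ck_on_inverse:
  assumes "open S" and nz: "\<And>x. x \<in> S \<Longrightarrow> f x \<noteq> 0"
  shows "Ck_on k S f \<Longrightarrow> Ck_on k S (\<lambda>x. inverse (f x))"
proof (induction k)
  case 0
  then show ?case using nz by (auto intro!: continuous_intros)
next
  case (Suc k)
  note i = Suc.IH[OF Ck_on_Suc_imp[OF Suc.prems]]
  show ?case
  proof (rule Ck_on_SucI[OF assms(1)])
    show "((\<lambda>x. inverse (f x)) has_derivative
        (\<lambda>h. (- 1) * (inverse (f x) * frechet_derivative f (at x) h * inverse (f x)))) (at x)" if "x \<in> S" for x
      using Deriv.has_derivative_inverse[OF nz[OF that] Ck_on_SucD[OF Suc.prems that]] by simp
    show "Ck_on k S (\<lambda>x. (- 1) * (inverse (f x) * frechet_derivative f (at x) b * inverse (f x)))"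
      if "b \<in> Basis" for b
      using Suc.prems that by (intro Ck_on_mult[OF assms(1)] Ck_on_const[OF assms(1)] i) simp
  qed
qed

text \<open>
  The gradient of the norm is x / |x|, which is again built from the norm: this closes the induction.
\<close>

lemma Ck_on_norm:
  fixes S :: "'a::euclidean_space set"
  assumes "open S" and nz: "0 \<notin> S"
  shows "Ck_on k S norm"
proof (induction k)
  case 0
  then show ?case by (auto intro!: continuous_intros)
next
  case (Suc k)
  have d: "(norm has_derivative (\<lambda>h. inverse (norm x) * (x \<bullet> h))) (at x)" if "x \<in> S" for x
  proof -
    have "(norm has_derivative (\<lambda>h. h \<bullet> sgn x)) (at x)"
      by (rule has_derivative_norm) (use that nz in auto)
    then show ?thesis by (simp add: sgn_div_norm inner_commute)
  qed
  show ?case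
  proof (rule Ck_on_SucI[OF assms(1) d])
    fix b :: 'a
    show "Ck_on k S (\<lambda>x. inverse (norm x) * (x \<bullet> b))"
      by (rule Ck_on_mult[OF assms(1) Ck_on_inverse[OF assms(1) _ Suc] Ck_on_inner[OF assms(1)]])
         (use nz in auto)
  qed
qed

text \<open>
  By the chain rule a partial derivative of the composition is a sum of products of
  partial derivatives of \<phi>, composed with F, and partial derivatives of the components of F. The
  former are covered by the induction hypothesis for the derivatives of \<phi>.
\<close>

lemma Ck_on_compose:
  fixes S :: "'a::euclidean_space set" and T :: "'b::euclidean_space set"
  assumes S: "open S" and T: "open T" and F: "\<And>x. x \<in> S \<Longrightarrow> F x \<in> T"
  shows "Ck_on k T \<phi> \<Longrightarrow> (\<And>b. b \<in> Basis \<Longrightarrow> Ck_on k S (\<lambda>x. F x \<bullet> b)) \<Longrightarrow> Ck_on k S (\<lambda>x. \<phi> (F x))"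
proof (induction k arbitrary: \<phi>)
  case 0
  have "continuous_on S F" using 0(2) by (intro continuous_on_componentwise[THEN iffD2]) auto
  then show ?case using 0(1) F by (auto intro: continuous_on_compose2)
next
  case (Suc k)
  define DF where "DF x h = (\<Sum>b\<in>Basis. frechet_derivative (\<lambda>x. F x \<bullet> b) (at x) h *\<^sub>R b)" for x h
  have dF: "(F has_derivative DF x) (at x)" if "x \<in> S" for x
    unfolding DF_def
    by (rule has_derivative_componentwise_within[THEN iffD2])
       (use Ck_on_SucD[OF Suc.prems(2) that] in simp)
  have d: "((\<lambda>x. \<phi> (F x)) has_derivative (\<lambda>h. frechet_derivative \<phi> (at (F x)) (DF x h))) (at x)"
    if "x \<in> S" for x
    using has_derivative_compose[OF dF[OF that] Ck_on_SucD[OF Suc.prems(1) F[OF that]]] .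
  have lin: "frechet_derivative \<phi> (at (F x)) (DF x h) =
     (\<Sum>b\<in>Basis. frechet_derivative (\<lambda>x. F x \<bullet> b) (at x) h * frechet_derivative \<phi> (at (F x)) b)"
    if "x \<in> S" for x h
  proof -
    interpret linear "frechet_derivative \<phi> (at (F x))"
      using Ck_on_SucD[OF Suc.prems(1) F[OF that]] by (rule has_derivative_linear)
    show ?thesis by (simp add: DF_def sum scale)
  qed
  have k: "Ck_on k S (\<lambda>x. F x \<bullet> b)" if "b \<in> Basis" for b
    using Ck_on_Suc_imp[OF Suc.prems(2)[OF that]] .
  show ?case
  proof (rule Ck_on_SucI[OF S])
    show "((\<lambda>x. \<phi> (F x)) has_derivative (\<lambda>h. \<Sum>b\<in>Basis. frechet_derivative (\<lambda>x. F x \<bullet> b) (at x) h * frechet_derivative \<phi> (at (F x)) b)) (at x)"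
      if "x \<in> S" for x
      using d[OF that] lin[OF that] by simp
    show "Ck_on k S (\<lambda>x. \<Sum>b\<in>Basis. frechet_derivative (\<lambda>x. F x \<bullet> b) (at x) c * frechet_derivative \<phi> (at (F x)) b)"
      if "c \<in> Basis" for c
    proof (rule Ck_on_sum[OF S finite_Basis], rule Ck_on_mult[OF S])
      fix b :: 'b assume b: "b \<in> Basis"
      show "Ck_on k S (\<lambda>x. frechet_derivative (\<lambda>x. F x \<bullet> b) (at x) c)"
        using Suc.prems(2)[OF b] that by simp
      show "Ck_on k S (\<lambda>x. frechet_derivative \<phi> (at (F x)) b)"
        by (rule Suc.IH[OF _ k]) (use Suc.prems(1) b in simp_all)
    qed
  qed
qed

lemma has_derivative_grad:
  fixes f :: "'a::euclidean_space \<Rightarrow> real"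
  assumes "f differentiable (at x)"
  shows "(f has_derivative (\<lambda>h. grad f x \<bullet> h)) (at x)"
proof -
  have D: "(f has_derivative frechet_derivative f (at x)) (at x)"
    using assms by (simp add: frechet_derivative_works)
  interpret linear "frechet_derivative f (at x)" using D by (rule has_derivative_linear)
  have "frechet_derivative f (at x) h = grad f x \<bullet> h" for h
  proof -
    have "frechet_derivative f (at x) h = frechet_derivative f (at x) (\<Sum>b\<in>Basis. (h \<bullet> b) *\<^sub>R b)"
      by (simp add: euclidean_representation)
    then show ?thesis
      by (simp add: sum scale grad_def inner_sum_left inner_commute[of h] mult.commute)
  qed
  then have "frechet_derivative f (at x) = (\<lambda>h. grad f x \<bullet> h)" by (rule ext)
  with D show ?thesis by simp
qed

lemma grad_eqI:
  fixes f :: "'a::euclidean_space \<Rightarrow> real"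
  assumes "(f has_derivative (\<lambda>h. v \<bullet> h)) (at x)"
  shows "grad f x = v"
  unfolding grad_def frechet_derivative_at[OF assms, symmetric]
  by (simp add: euclidean_representation)

lemma smooth_on_differentiable: "smooth_on S f \<Longrightarrow> x \<in> S \<Longrightarrow> f differentiable (at x)"
  unfolding smooth_on_def by (metis Ck_on.simps(2))

lemma smooth_on_has_derivative:
  "smooth_on S f \<Longrightarrow> x \<in> S \<Longrightarrow> (f has_derivative (\<lambda>h. grad f x \<bullet> h)) (at x)"
  by (intro has_derivative_grad smooth_on_differentiable)

lemma smooth_on_continuous: "smooth_on S f \<Longrightarrow> continuous_on S f"
  by (meson Ck_on_imp_continuous smooth_on_def)

lemma smooth_on_continuous_grad:
  fixes f :: "'a::euclidean_space \<Rightarrow> real"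
  assumes "smooth_on S f"
  shows "continuous_on S (grad f)"
proof -
  have "Ck_on (Suc 0) S f" using assms by (simp only: smooth_on_def)
  then show ?thesis unfolding grad_def[abs_def] by (auto intro!: continuous_intros)
qed

lemma smooth_on_subset: "smooth_on S f \<Longrightarrow> T \<subseteq> S \<Longrightarrow> smooth_on T f"
  by (auto simp: smooth_on_def intro: Ck_on_subset)

section \<open>Smooth bump functions\<close>

text \<open>
  The classical flat function exp (-1/t), multiplied by a power of 1/t. The powers are
  included because each derivative of exp (-1/t) is a combination of such functions.
\<close>

definition flat_exp :: "nat \<Rightarrow> real \<Rightarrow> real" where
  "flat_exp n t = (if t > 0 then inverse t ^ n * exp (- inverse t) else 0)"

lemma flat_exp_tendsto_0: "(flat_exp n \<longlongrightarrow> 0) (at 0)"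
proof -
  have "((\<lambda>t::real. inverse t ^ n / exp (inverse t)) \<longlongrightarrow> 0) (at_right 0)"
    by (rule filterlim_compose[OF tendsto_power_div_exp_0 filterlim_inverse_at_top_right])
  then have "(flat_exp n \<longlongrightarrow> 0) (at_right 0)"
    by (rule Lim_transform_eventually)
       (auto simp: flat_exp_def eventually_at_right_less divide_inverse exp_minus
         intro!: eventually_mono[OF eventually_at_right_less])
  moreover have "(flat_exp n \<longlongrightarrow> 0) (at_left 0)"
    by (rule tendsto_eventually)
       (auto simp: flat_exp_def eventually_at_filter)
  ultimately show ?thesis by (simp add: filterlim_at_split)
qed

lemma flat_exp_DERIV:
  "(flat_exp n has_real_derivative flat_exp (n + 2) t - real n * flat_exp (Suc n) t) (at t)"
proof -
  consider "t > 0" | "t < 0" | "t = 0" by linarith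
  then show ?thesis
  proof cases
    case 1
    have "((\<lambda>t. inverse t ^ n * exp (- inverse t)) has_real_derivative
        real n * inverse t ^ (n - 1) * (- (inverse t * inverse t)) * exp (- inverse t)
          + inverse t ^ n * (exp (- inverse t) * (inverse t * inverse t))) (at t)"
      using 1 by (auto intro!: derivative_eq_intros simp: power2_eq_square)
    also have "real n * inverse t ^ (n - 1) * (- (inverse t * inverse t)) * exp (- inverse t)
          + inverse t ^ n * (exp (- inverse t) * (inverse t * inverse t))
        = flat_exp (n + 2) t - real n * flat_exp (Suc n) t"
      using 1 by (cases n) (auto simp: flat_exp_def algebra_simps)
    finally have "((\<lambda>t. inverse t ^ n * exp (- inverse t)) has_real_derivative
        flat_exp (n + 2) t - real n * flat_exp (Suc n) t) (at t)" .
    then show ?thesis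
      by (rule has_field_derivative_transform_within_open[of _ _ _ "{0<..}"])
         (use 1 in \<open>auto simp: flat_exp_def\<close>)
  next
    case 2
    have "((\<lambda>t. 0) has_real_derivative flat_exp (n + 2) t - real n * flat_exp (Suc n) t) (at t)"
      using 2 by (auto simp: flat_exp_def)
    then show ?thesis
      by (rule has_field_derivative_transform_within_open[of _ _ _ "{..<0}"])
         (use 2 in \<open>auto simp: flat_exp_def\<close>)
  next
    case 3
    have "((\<lambda>y. (flat_exp n y - flat_exp n 0) / (y - 0)) \<longlongrightarrow> 0) (at 0)"
      by (rule Lim_transform_eventually[OF flat_exp_tendsto_0[of "Suc n"]])
         (auto simp: flat_exp_def divide_inverse eventually_at_filter)
    then show ?thesis using 3 by (simp add: has_field_derivative_iff flat_exp_def)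
  qed
qed

lemma Ck_on_flat_exp: "Ck_on k UNIV (flat_exp n)"
proof (induction k arbitrary: n)
  case 0
  then show ?case
    using flat_exp_DERIV by (auto intro!: continuous_at_imp_continuous_on DERIV_isCont)
next
  case (Suc k)
  show ?case
  proof (rule Ck_on_SucI[OF open_UNIV])
    show "(flat_exp n has_derivative (\<lambda>h. (flat_exp (n + 2) t + (- real n) * flat_exp (Suc n) t) * h)) (at t)" for t
      using flat_exp_DERIV[of n t] by (simp add: has_field_derivative_def)
    show "Ck_on k UNIV (\<lambda>t. (flat_exp (n + 2) t + (- real n) * flat_exp (Suc n) t) * b)" for b
      by (intro Ck_on_add Ck_on_mult Ck_on_const Suc open_UNIV)
  qed
qed

text \<open>
  For increasing \<open>k\<close> these functions tend to the indicator of the open box, from below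
  and with support in the closed box. They serve as test functions without any mollification.
\<close>

definition box_bump :: "nat \<Rightarrow> 'a::euclidean_space \<Rightarrow> 'a \<Rightarrow> 'a \<Rightarrow> real" where
  "box_bump k c d x =
     (\<Prod>b\<in>Basis. flat_exp 0 (real k * (x \<bullet> b - c \<bullet> b)) * flat_exp 0 (real k * (d \<bullet> b - x \<bullet> b)))"

lemma smooth_on_box_bump: "smooth_on UNIV (box_bump k c d)"
  unfolding smooth_on_def box_bump_def
proof (intro allI Ck_on_prod open_UNIV finite_Basis Ck_on_mult)
  fix n and b :: 'a
  have 1: "Ck_on n UNIV (\<lambda>x. real k * (x \<bullet> b - c \<bullet> b))"
    using Ck_on_mult[OF open_UNIV Ck_on_const[of UNIV n "real k"] Ck_on_add[OF open_UNIV Ck_on_inner[of UNIV n b] Ck_on_const[of UNIV n "- (c \<bullet> b)"]]]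
    by simp
  have 2: "Ck_on n UNIV (\<lambda>x. real k * (d \<bullet> b - x \<bullet> b))"
    using Ck_on_mult[OF open_UNIV Ck_on_const[of UNIV n "real k"] Ck_on_add[OF open_UNIV Ck_on_const[of UNIV n "d \<bullet> b"] Ck_on_inner[of UNIV n "-b"]]]
    by simp
  show "Ck_on n UNIV (\<lambda>x. flat_exp 0 (real k * (x \<bullet> b - c \<bullet> b)))"
    by (rule Ck_on_compose[OF open_UNIV open_UNIV _ Ck_on_flat_exp]) (use 1 in auto)
  show "Ck_on n UNIV (\<lambda>x. flat_exp 0 (real k * (d \<bullet> b - x \<bullet> b)))"
    by (rule Ck_on_compose[OF open_UNIV open_UNIV _ Ck_on_flat_exp]) (use 2 in auto)
qed

lemma box_bump_eq_0: "x \<notin> box c d \<Longrightarrow> box_bump k c d x = 0"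
  by (auto simp: box_bump_def mem_box flat_exp_def zero_less_mult_iff)

lemma box_bump_bounds: "0 \<le> box_bump k c d x" "box_bump k c d x \<le> 1"
proof -
  have 1: "0 \<le> flat_exp 0 t" "flat_exp 0 t \<le> 1" for t by (auto simp: flat_exp_def)
  show "0 \<le> box_bump k c d x" "box_bump k c d x \<le> 1"
    unfolding box_bump_def by (auto intro!: prod_nonneg prod_le_1 mult_le_one mult_nonneg_nonneg 1)
qed

lemma box_bump_tendsto: "(\<lambda>k. box_bump k c d x) \<longlonglongrightarrow> indicator (box c d) x"
proof (cases "x \<in> box c d")
  case False
  then show ?thesis by (simp add: box_bump_eq_0)
next
  case True
  have "(\<lambda>k. flat_exp 0 (real k * t)) \<longlonglongrightarrow> 1" if "t > 0" for t
  proof -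
    have "(\<lambda>k. exp (- (inverse (real k) * inverse t))) \<longlonglongrightarrow> exp (- (0 * inverse t))"
      by (intro tendsto_intros lim_inverse_n)
    moreover have "\<forall>\<^sub>F k in sequentially. exp (- (inverse (real k) * inverse t)) = flat_exp 0 (real k * t)"
      using eventually_gt_at_top[of 0] by eventually_elim (use that in \<open>auto simp: flat_exp_def\<close>)
    ultimately show ?thesis using Lim_transform_eventually by fastforce
  qed
  note t = this
  have "(\<lambda>k. box_bump k c d x) \<longlonglongrightarrow> (\<Prod>b\<in>(Basis::'a set). 1 * 1)"
    unfolding box_bump_def
    by (intro tendsto_prod tendsto_mult t) (use True in \<open>auto simp: mem_box\<close>)
  then show ?thesis using True by simp
qed

lemma box_bump_test:
  assumes "cbox c d \<subseteq> \<Omega>"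
  shows "box_bump k c d \<in> test_functions \<Omega>"
proof -
  have "{x. box_bump k c d x \<noteq> 0} \<subseteq> cbox c d"
    using box_bump_eq_0 box_subset_cbox by blast
  then have "closure {x. box_bump k c d x \<noteq> 0} \<subseteq> cbox c d"
    by (rule closure_minimal[OF _ closed_cbox])
  then show ?thesis
    using assms smooth_on_box_bump
    by (auto simp: test_functions_def compact_eq_bounded_closed dest: bounded_subset[OF bounded_cbox])
qed

section \<open>Test functions and integration by parts\<close>

lemma test_functionsE:
  assumes "\<phi> \<in> test_functions \<Omega>"
  obtains K where "compact K" "K \<subseteq> \<Omega>" "\<And>x. x \<notin> K \<Longrightarrow> \<phi> x = 0" "\<And>x. x \<notin> K \<Longrightarrow> grad \<phi> x = 0"
proof
  let ?K = "closure {x. \<phi> x \<noteq> 0}"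
  show "compact ?K" "?K \<subseteq> \<Omega>" using assms by (auto simp: test_functions_def)
  show 0: "\<phi> x = 0" if "x \<notin> ?K" for x using that closure_subset[of "{x. \<phi> x \<noteq> 0}"] by auto
  show "grad \<phi> x = 0" if "x \<notin> ?K" for x
  proof (rule grad_eqI, rule has_derivative_transform_within_open[of "\<lambda>x. 0" _ _ UNIV "- ?K"])
    show "((\<lambda>x. 0) has_derivative (\<bullet>) 0) (at x)"
      by (simp add: inner_zero_left[abs_def])
    show "open (- ?K)" "x \<in> - ?K" using that by auto
    show "0 = \<phi> y" if "y \<in> - ?K" for y using 0[of y] that by simp
  qed
qed

lemma test_functions_smooth: "\<phi> \<in> test_functions \<Omega> \<Longrightarrow> smooth_on S \<phi>"
  by (auto simp: test_functions_def intro: smooth_on_subset)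

lemma test_functions_mono: "\<phi> \<in> test_functions \<Omega> \<Longrightarrow> \<Omega> \<subseteq> \<Omega>' \<Longrightarrow> \<phi> \<in> test_functions \<Omega>'"
  by (auto simp: test_functions_def)

lemma test_functions_continuous:
  assumes "\<phi> \<in> test_functions \<Omega>"
  shows "continuous_on S \<phi>" "continuous_on S (grad \<phi>)"
  using smooth_on_continuous smooth_on_continuous_grad test_functions_smooth[OF assms, of S] by auto

text \<open>
  The domain and the complement of the support are open and cover the whole
  space, and the extension is continuous on each of them.
\<close>

lemma continuous_zero_extension:
  fixes f :: "'a::euclidean_space \<Rightarrow> 'b::euclidean_space"
  assumes "open \<Omega>" "compact K" "K \<subseteq> \<Omega>" "continuous_on \<Omega> f" "\<And>x. x \<in> \<Omega> \<Longrightarrow> x \<notin> K \<Longrightarrow> f x = 0"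
  shows "continuous_on UNIV (\<lambda>x. if x \<in> \<Omega> then f x else 0)"
proof -
  let ?g = "\<lambda>x. if x \<in> \<Omega> then f x else 0"
  have "continuous_on \<Omega> ?g" using assms(4) by (rule continuous_on_eq) auto
  moreover have "continuous_on (- K) ?g"
    by (rule continuous_on_eq[of _ "\<lambda>x. 0"]) (use assms(5) in auto)
  ultimately have "continuous_on (\<Omega> \<union> - K) ?g"
    using assms(1,2) by (intro continuous_on_open_Un) (auto simp: compact_imp_closed open_Compl)
  moreover have "\<Omega> \<union> - K = UNIV" using assms(3) by auto
  ultimately show ?thesis by simp
qed

lemma continuous_compact_support_integrable:
  fixes f :: "'a::euclidean_space \<Rightarrow> 'b::euclidean_space"
  assumes "continuous_on UNIV f" "compact K" "\<And>x. x \<notin> K \<Longrightarrow> f x = 0"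
  shows "integrable lborel f"
proof -
  have "integrable lborel (\<lambda>x. indicator K x *\<^sub>R f x)"
    using borel_integrable_compact[OF assms(2) continuous_on_subset[OF assms(1)]] by auto
  also have "(\<lambda>x. indicator K x *\<^sub>R f x) = f"
    using assms(3) by (auto simp: indicator_def fun_eq_iff)
  finally show ?thesis .
qed

lemma absolutely_integrable_continuous_compact:
  fixes f :: "'a::euclidean_space \<Rightarrow> 'b::euclidean_space"
  assumes "compact K" "continuous_on K f"
  shows "f absolutely_integrable_on K"
proof -
  have "integrable lborel (\<lambda>x. indicator K x *\<^sub>R f x)"
    using borel_integrable_compact[OF assms] by simp
  then show ?thesis
    unfolding set_integrable_def by (subst integrable_completion) auto
qed

lemma lebesgue_on_eq_lborel_extension:
  fixes f :: "'a::euclidean_space \<Rightarrow> 'b::euclidean_space"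
  assumes "\<Omega> \<in> sets borel" "(\<lambda>x. if x \<in> \<Omega> then f x else 0) \<in> borel_measurable borel"
  shows "integrable (lebesgue_on \<Omega>) f \<longleftrightarrow> integrable lborel (\<lambda>x. if x \<in> \<Omega> then f x else 0)"
    and "(LINT x|lebesgue_on \<Omega>. f x) = (LINT x|lborel. (if x \<in> \<Omega> then f x else 0))"
proof -
  have m: "\<Omega> \<in> sets lebesgue" using assms(1) by simp
  show "integrable (lebesgue_on \<Omega>) f \<longleftrightarrow> integrable lborel (\<lambda>x. if x \<in> \<Omega> then f x else 0)"
    using Lebesgue_Measure.integrable_restrict_UNIV[OF m, of f] integrable_completion[of "\<lambda>x. if x \<in> \<Omega> then f x else 0" lborel] assms(2)
    by simp
  show "(LINT x|lebesgue_on \<Omega>. f x) = (LINT x|lborel. (if x \<in> \<Omega> then f x else 0))"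
    using Lebesgue_Measure.integral_restrict_UNIV[OF m, of f] integral_completion[of "\<lambda>x. if x \<in> \<Omega> then f x else 0" lborel] assms(2)
    by simp
qed

lemma compact_support_lebesgue_on:
  fixes f :: "'a::euclidean_space \<Rightarrow> 'b::euclidean_space"
  assumes "open \<Omega>" "compact K" "K \<subseteq> \<Omega>" "continuous_on \<Omega> f" "\<And>x. x \<in> \<Omega> \<Longrightarrow> x \<notin> K \<Longrightarrow> f x = 0"
  shows "integrable (lebesgue_on \<Omega>) f"
    and "integrable lborel (\<lambda>x. if x \<in> \<Omega> then f x else 0)"
    and "(LINT x|lebesgue_on \<Omega>. f x) = (LINT x|lborel. (if x \<in> \<Omega> then f x else 0))"
proof -
  let ?g = "\<lambda>x. if x \<in> \<Omega> then f x else 0"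
  have c: "continuous_on UNIV ?g" using continuous_zero_extension[OF assms] .
  show i: "integrable lborel ?g"
    by (rule continuous_compact_support_integrable[OF c assms(2)]) (use assms(5) in auto)
  have "?g \<in> borel_measurable borel" using c by (rule borel_measurable_continuous_onI)
  note e = lebesgue_on_eq_lborel_extension[OF borel_open[OF assms(1)] this]
  show "integrable (lebesgue_on \<Omega>) f" using e(1) i by simp
  show "(LINT x|lebesgue_on \<Omega>. f x) = (LINT x|lborel. ?g x)" by (rule e(2))
qed

text \<open>
  The integral of a difference quotient of F vanishes by translation
  invariance. Difference quotients are bounded by the maximum of the gradient and supported in a
  fixed ball, hence dominated convergence applies.
\<close>

lemma integral_partial_derivative_eq_0:
  fixes F :: "'a::euclidean_space \<Rightarrow> real"
  assumes D: "\<And>x. (F has_derivative (\<lambda>h. D x \<bullet> h)) (at x)" and cont: "continuous_on UNIV D"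
    and K: "compact K" "\<And>x. x \<notin> K \<Longrightarrow> F x = 0"
  shows "(LINT x|lborel. D x \<bullet> b) = 0"
proof -
  have cF: "continuous_on UNIV F"
    using D by (auto intro!: continuous_at_imp_continuous_on has_derivative_continuous)
  have F: "integrable lborel F" by (rule continuous_compact_support_integrable[OF cF K])
  have D0: "D x = 0" if "x \<notin> K" for x
  proof -
    have "((\<lambda>x. 0) has_derivative (\<lambda>h. D x \<bullet> h)) (at x)"
      by (rule has_derivative_transform_within_open[OF D, of "- K"])
         (use K that in \<open>auto simp: compact_imp_closed open_Compl\<close>)
    then have "(\<lambda>h. D x \<bullet> h) = (\<lambda>h. 0)" using has_derivative_unique has_derivative_const by blast
    then show ?thesis by (metis inner_eq_zero_iff)
  qed
  obtain C where C: "C \<ge> 0" "\<And>x. norm (D x) \<le> C"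
  proof -
    have "bounded (D ` K)"
      by (rule compact_imp_bounded[OF compact_continuous_image[OF continuous_on_subset[OF cont] K(1)]]) simp
    then obtain C where "\<And>x. x \<in> K \<Longrightarrow> norm (D x) \<le> C" by (auto simp: bounded_iff)
    then have "norm (D x) \<le> max C 0" for x using D0[of x] by (cases "x \<in> K") force+
    then show thesis using that[of "max C 0"] by simp
  qed
  obtain R where R: "\<And>x. x \<in> K \<Longrightarrow> norm x \<le> R"
    using compact_imp_bounded[OF K(1)] by (auto simp: bounded_iff)
  define t where "t n = inverse (real (Suc n))" for n
  have t: "t n > 0" "t n \<le> 1" for n by (auto simp: t_def field_simps)
  have t0: "t \<longlonglongrightarrow> 0" unfolding t_def by (rule LIMSEQ_inverse_real_of_nat)
  define s where "s n x = (F (x + t n *\<^sub>R b) - F x) / t n" for n x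
  have lim: "(\<lambda>n. s n x) \<longlonglongrightarrow> D x \<bullet> b" for x
  proof -
    have "((\<lambda>r. F (x + r *\<^sub>R b)) has_derivative (\<lambda>r. D x \<bullet> (r *\<^sub>R b))) (at 0)"
      by (rule has_derivative_compose[of "\<lambda>r. x + r *\<^sub>R b" "\<lambda>r. r *\<^sub>R b" 0 UNIV F])
         (use D[of x] in \<open>auto intro!: derivative_eq_intros\<close>)
    then have "((\<lambda>r. F (x + r *\<^sub>R b)) has_real_derivative (D x \<bullet> b)) (at 0)"
      by (simp add: has_field_derivative_def mult_commute_abs)
    then have "((\<lambda>h. (F (x + h *\<^sub>R b) - F x) / h) \<longlongrightarrow> D x \<bullet> b) (at 0)"
      by (simp add: DERIV_def)
    moreover have "filterlim t (at 0) sequentially"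
      using t0 t(1) by (auto simp: filterlim_at intro!: always_eventually dest: less_imp_neq[symmetric])
    ultimately show ?thesis unfolding s_def by (rule filterlim_compose)
  qed
  \<comment> \<open>The shift by at most one unit in direction b enlarges the support by norm b.\<close>
  have bd: "norm (s n x) \<le> C * norm b * indicator (cball 0 (R + norm b)) x" for n x
  proof (cases "x \<in> cball 0 (R + norm b)")
    case True
    have "norm (F (x + t n *\<^sub>R b) - F x) \<le> C * norm (x + t n *\<^sub>R b - x)"
      by (rule differentiable_bound[of UNIV F "\<lambda>x h. D x \<bullet> h"])
         (use D C in \<open>auto intro!: onorm_le order_trans[OF Cauchy_Schwarz_ineq2] mult_right_mono\<close>)
    then have "norm (F (x + t n *\<^sub>R b) - F x) \<le> C * norm b * t n"
      using t[of n] by (simp add: mult_ac)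
    then show ?thesis using True t[of n] by (simp add: s_def divide_simps)
  next
    case False
    have "x \<notin> K" using R[of x] False norm_ge_zero[of b] by (auto simp del: norm_ge_zero)
    moreover have "x + t n *\<^sub>R b \<notin> K"
    proof
      assume "x + t n *\<^sub>R b \<in> K"
      then have "norm (x + t n *\<^sub>R b) \<le> R" by (rule R)
      moreover have "norm x \<le> norm (x + t n *\<^sub>R b) + norm (t n *\<^sub>R b)"
        using norm_triangle_ineq4[of "x + t n *\<^sub>R b" "t n *\<^sub>R b"] by simp
      moreover have "norm (t n *\<^sub>R b) \<le> norm b" using t[of n] by (simp add: mult_left_le_one_le)
      ultimately show False using False by auto
    qed
    ultimately show ?thesis using False K(2) by (simp add: s_def)
  qed
  have [measurable]: "F \<in> borel_measurable borel" "D \<in> borel_measurable borel"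
    using cF cont by (auto intro: borel_measurable_continuous_onI)
  have "(\<lambda>n. LINT x|lborel. s n x) \<longlonglongrightarrow> (LINT x|lborel. D x \<bullet> b)"
  proof (rule integral_dominated_convergence[where w = "\<lambda>x. C * norm b * indicator (cball 0 (R + norm b)) x"])
    show "integrable lborel (\<lambda>x. C * norm b * indicator (cball 0 (R + norm b)) (x::'a))"
      by (intro integrable_mult_right integrable_real_indicator) (use emeasure_lborel_cball_finite[of "0::'a" "R + norm b"] in \<open>auto simp: less_top\<close>)
    show "s n \<in> borel_measurable lborel" for n unfolding s_def by measurable
  qed (use lim bd in auto)
  moreover have "(LINT x|lborel. s n x) = 0" for n
  proof -
    have sh: "integrable lborel (\<lambda>x. F (x + c))" "(LINT x|lborel. F (x + c)) = (LINT x|lborel. F x)" for c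
    proof -
      have "integrable (distr lborel borel ((+) c)) F" using F by (simp add: lborel_distr_plus)
      then show "integrable lborel (\<lambda>x. F (x + c))"
        by (subst (asm) integrable_distr_eq) (auto simp: add.commute)
      have "(LINT x|lborel. F x) = (LINT x|distr lborel borel ((+) c). F x)" by (simp add: lborel_distr_plus)
      also have "\<dots> = (LINT x|lborel. F (c + x))" by (rule integral_distr) auto
      finally show "(LINT x|lborel. F (x + c)) = (LINT x|lborel. F x)" by (simp add: add.commute)
    qed
    show ?thesis unfolding s_def using sh F by simp
  qed
  ultimately show ?thesis by (simp add: LIMSEQ_const_iff)
qed

text \<open>
  The product of f with a test function, extended by zero, is continuously differentiable
  on the whole space and has compact support, so its partial derivatives have integral zero.
\<close>

lemma has_weak_grad_smooth:
  fixes f :: "'a::euclidean_space \<Rightarrow> real"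
  assumes \<Omega>: "open \<Omega>" and f: "smooth_on \<Omega> f"
  shows "has_weak_grad \<Omega> f (grad f)"
  unfolding has_weak_grad_def
proof (intro conjI allI impI ballI)
  note c = smooth_on_continuous[OF f] smooth_on_continuous_grad[OF f]
  show "f absolutely_integrable_on K" "grad f absolutely_integrable_on K" if "compact K \<and> K \<subseteq> \<Omega>" for K
    using c that by (auto intro!: absolutely_integrable_continuous_compact intro: continuous_on_subset)
  fix \<psi> assume \<psi>: "\<psi> \<in> test_functions \<Omega>"
  obtain K where K: "compact K" "K \<subseteq> \<Omega>" "\<And>x. x \<notin> K \<Longrightarrow> \<psi> x = 0" "\<And>x. x \<notin> K \<Longrightarrow> grad \<psi> x = 0"
    using test_functionsE[OF \<psi>] by metis
  note c\<psi> = test_functions_continuous[OF \<psi>]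
  let ?A = "\<lambda>x. f x *\<^sub>R grad \<psi> x" and ?B = "\<lambda>x. \<psi> x *\<^sub>R grad f x"
  let ?e = "\<lambda>A x. if x \<in> \<Omega> then A x else 0"
  have A: "integrable (lebesgue_on \<Omega>) ?A" "integrable lborel (?e ?A)" "(LINT x|lebesgue_on \<Omega>. ?A x) = (LINT x|lborel. ?e ?A x)"
    and B: "integrable (lebesgue_on \<Omega>) ?B" "integrable lborel (?e ?B)" "(LINT x|lebesgue_on \<Omega>. ?B x) = (LINT x|lborel. ?e ?B x)"
    by (rule compact_support_lebesgue_on[OF \<Omega> K(1,2)]; use K(3,4) in \<open>auto intro!: continuous_intros c c\<psi>\<close>)+
  have "(LINT x|lborel. ?e (\<lambda>x. ?A x + ?B x) x \<bullet> b) = 0" for b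
  proof (rule integral_partial_derivative_eq_0[where F = "?e (\<lambda>x. f x * \<psi> x)", OF _ _ K(1)])
    show "continuous_on UNIV (?e (\<lambda>x. ?A x + ?B x))"
      by (rule continuous_zero_extension[OF \<Omega> K(1,2)]) (use K(3,4) in \<open>auto intro!: continuous_intros c c\<psi>\<close>)
    show "(?e (\<lambda>x. f x * \<psi> x) has_derivative (\<lambda>h. ?e (\<lambda>x. ?A x + ?B x) x \<bullet> h)) (at x)" for x
    proof (cases "x \<in> \<Omega>")
      case True
      have "((\<lambda>x. f x * \<psi> x) has_derivative (\<lambda>h. (?A x + ?B x) \<bullet> h)) (at x)"
        using has_derivative_mult[OF smooth_on_has_derivative[OF f True] smooth_on_has_derivative[OF test_functions_smooth[OF \<psi>, of UNIV] UNIV_I]]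
        by (simp add: inner_add_left mult_ac)
      then have "(?e (\<lambda>x. f x * \<psi> x) has_derivative (\<lambda>h. (?A x + ?B x) \<bullet> h)) (at x)"
        by (rule has_derivative_transform_within_open[OF _ \<Omega> True]) auto
      then show ?thesis using True by simp
    next
      case False
      have "(?e (\<lambda>x. f x * \<psi> x) has_derivative (\<lambda>h. 0)) (at x)"
        by (rule has_derivative_transform_within_open[of "\<lambda>x. 0" _ _ UNIV "- K"])
           (use False K in \<open>auto simp: compact_imp_closed open_Compl\<close>)
      then show ?thesis using False by simp
    qed
  qed (use K(3) in auto)
  note z = this
  have "((LINT x|lborel. ?e ?A x) + (LINT x|lborel. ?e ?B x)) \<bullet> b = 0" for b
  proof -
    have "((LINT x|lborel. ?e ?A x) + (LINT x|lborel. ?e ?B x)) \<bullet> b = (LINT x|lborel. ?e ?A x + ?e ?B x) \<bullet> b"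
      using A(2) B(2) by simp
    also have "\<dots> = (LINT x|lborel. (?e ?A x + ?e ?B x) \<bullet> b)"
      by (rule integral_inner_left[symmetric]) (use A(2) B(2) in auto)
    also have "\<dots> = (LINT x|lborel. ?e (\<lambda>x. ?A x + ?B x) x \<bullet> b)"
      by (rule arg_cong[where f = "integral\<^sup>L lborel"]) auto
    also have "\<dots> = 0" by (rule z)
    finally show ?thesis .
  qed
  from this[of "(LINT x|lborel. ?e ?A x) + (LINT x|lborel. ?e ?B x)"]
  have "(LINT x|lborel. ?e ?A x) + (LINT x|lborel. ?e ?B x) = 0"
    by (simp only: inner_eq_zero_iff)
  then show "(LINT x|lebesgue_on \<Omega>. ?A x) = - (LINT x|lebesgue_on \<Omega>. ?B x)"
    unfolding A(3) B(3) by (simp only: eq_neg_iff_add_eq_0)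
qed

section \<open>Uniqueness of weak gradients\<close>

text \<open>
  The positive and the negative part of h define measures that agree on
  boxes. Boxes are closed under intersection and generate the Borel sets, so the measures coincide and
  their densities agree.
\<close>

lemma AE_eq_0_of_box_integrals:
  fixes h :: "'a::euclidean_space \<Rightarrow> real"
  assumes h: "integrable lborel h"
    and z: "\<And>l u. (LINT x|lborel. indicator (box l u) x * h x) = 0"
  shows "AE x in lborel. h x = 0"
proof -
  have [measurable]: "h \<in> borel_measurable borel" using h by auto
  let ?p = "\<lambda>x. ennreal (h x)" and ?n = "\<lambda>x. ennreal (- h x)"
  have fin: "(\<integral>\<^sup>+x. ?p x * indicator A x \<partial>lborel) < \<infinity>" "(\<integral>\<^sup>+x. ?n x * indicator A x \<partial>lborel) < \<infinity>" for A
  proof -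
    have "(\<integral>\<^sup>+x. ennreal (norm (h x)) \<partial>lborel) < \<infinity>" using h by (simp add: integrable_iff_bounded)
    moreover have "(\<integral>\<^sup>+x. ?p x * indicator A x \<partial>lborel) \<le> (\<integral>\<^sup>+x. ennreal (norm (h x)) \<partial>lborel)"
      "(\<integral>\<^sup>+x. ?n x * indicator A x \<partial>lborel) \<le> (\<integral>\<^sup>+x. ennreal (norm (h x)) \<partial>lborel)"
      by (auto intro!: nn_integral_mono split: split_indicator simp: ennreal_leI)
    ultimately show "(\<integral>\<^sup>+x. ?p x * indicator A x \<partial>lborel) < \<infinity>" "(\<integral>\<^sup>+x. ?n x * indicator A x \<partial>lborel) < \<infinity>"
      by (auto intro: order.strict_trans1)
  qed
  have box: "(\<integral>\<^sup>+x. ?p x * indicator (box l u) x \<partial>lborel) = (\<integral>\<^sup>+x. ?n x * indicator (box l u) x \<partial>lborel)" for l u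
  proof -
    have i: "integrable lborel (\<lambda>x. indicator (box l u) x * h x)"
      using integrable_mult_indicator[OF _ h, of "box l u"] by simp
    have "(LINT x|lborel. indicator (box l u) x * h x) =
        enn2real (\<integral>\<^sup>+x. ennreal (indicator (box l u) x * h x) \<partial>lborel)
        - enn2real (\<integral>\<^sup>+x. ennreal (- (indicator (box l u) x * h x)) \<partial>lborel)"
      by (rule real_lebesgue_integral_def[OF i])
    also have "(\<integral>\<^sup>+x. ennreal (indicator (box l u) x * h x) \<partial>lborel) = (\<integral>\<^sup>+x. ?p x * indicator (box l u) x \<partial>lborel)"
      by (auto intro!: nn_integral_cong split: split_indicator)
    also have "(\<integral>\<^sup>+x. ennreal (- (indicator (box l u) x * h x)) \<partial>lborel) = (\<integral>\<^sup>+x. ?n x * indicator (box l u) x \<partial>lborel)"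
      by (auto intro!: nn_integral_cong split: split_indicator)
    finally show ?thesis using z[of l u] fin[of "box l u"]
      by (metis ennreal_enn2real eq_iff_diff_eq_0 infinity_ennreal_def)
  qed
  have "density lborel ?p = density lborel ?n"
  proof (rule measure_eqI_generator_eq)
    let ?E = "range (\<lambda>(a, b). box a b::'a set)"
    show "Int_stable ?E" by (auto simp: Int_stable_def box_Int_box)
    show "?E \<subseteq> Pow UNIV" "sets (density lborel ?p) = sigma_sets UNIV ?E" "sets (density lborel ?n) = sigma_sets UNIV ?E"
      by (simp_all add: borel_eq_box)
    let ?A = "\<lambda>n::nat. box (- (real n *\<^sub>R One)) (real n *\<^sub>R One) :: 'a set"
    show "range ?A \<subseteq> ?E" "(\<Union>i. ?A i) = UNIV" unfolding UN_box_eq_UNIV by auto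
    show "emeasure (density lborel ?p) (?A i) \<noteq> \<infinity>" for i
      using fin(1)[of "?A i"] by (simp add: emeasure_density)
    show "emeasure (density lborel ?p) X = emeasure (density lborel ?n) X" if "X \<in> ?E" for X
      using that box by (auto simp: emeasure_density)
  qed
  then have "AE x in lborel. ?p x = ?n x"
    by (intro sigma_finite_measure.density_unique[OF sigma_finite_lborel]) auto
  then show ?thesis
    by eventually_elim (metis ennreal_eq_0_iff ennreal_neg linorder_le_cases neg_le_0_iff_le neg_equal_0_iff_equal order_antisym)
qed

lemma AE_lebesgue_on_iff:
  assumes "S \<in> sets lebesgue"
  shows "(AE x in lebesgue_on S. P x) \<longleftrightarrow> (AE x in lebesgue. x \<in> S \<longrightarrow> P x)"
  using assms by (simp add: AE_restrict_space_iff)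

lemma borel_measurable_lebesgue_on_AE:
  fixes f :: "'a::euclidean_space \<Rightarrow> 'b::euclidean_space"
  assumes S: "S \<in> sets lebesgue" and "f \<in> borel_measurable (lebesgue_on S)"
    and "AE x in lebesgue_on S. f x = g x"
  shows "g \<in> borel_measurable (lebesgue_on S)"
proof -
  have "(\<lambda>x. if x \<in> S then f x else 0) \<in> borel_measurable lebesgue"
    using assms borel_measurable_if by blast
  moreover have "AE x in lebesgue. (if x \<in> S then f x else 0) = (if x \<in> S then g x else 0)"
    using assms(3) unfolding AE_lebesgue_on_iff[OF S] by eventually_elim auto
  ultimately have "(\<lambda>x. if x \<in> S then g x else 0) \<in> borel_measurable lebesgue"
    by (rule borel_measurable_AE)
  then show ?thesis using borel_measurable_if[OF S] by blast
qed

lemma continuous_times_locally_integrable: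
  fixes G :: "'a::euclidean_space \<Rightarrow> 'b::euclidean_space"
  assumes \<Omega>: "open \<Omega>" and K: "compact K" "K \<subseteq> \<Omega>" "\<And>x. x \<notin> K \<Longrightarrow> \<phi> x = 0"
    and c: "continuous_on UNIV \<phi>" and G: "G absolutely_integrable_on K"
  shows "integrable (lebesgue_on \<Omega>) (\<lambda>x. \<phi> x *\<^sub>R G x)"
proof -
  have "bounded (\<phi> ` K)"
    by (rule compact_imp_bounded[OF compact_continuous_image[OF continuous_on_subset[OF c] K(1)]]) simp
  then obtain C where C: "\<And>x. x \<in> K \<Longrightarrow> norm (\<phi> x) \<le> C" by (auto simp: bounded_iff)
  have G': "integrable lebesgue (\<lambda>x. indicator K x *\<^sub>R G x)" using G by (simp add: set_integrable_def)
  have [measurable]: "\<phi> \<in> borel_measurable lebesgue"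
    by (rule measurable_completion) (use borel_measurable_continuous_onI[OF c] in simp)
  have "integrable lebesgue (\<lambda>x. \<phi> x *\<^sub>R (indicator K x *\<^sub>R G x))"
  proof (rule Bochner_Integration.integrable_bound[where f = "\<lambda>x. C *\<^sub>R (indicator K x *\<^sub>R G x)"])
    show "integrable lebesgue (\<lambda>x. C *\<^sub>R (indicator K x *\<^sub>R G x))" by (rule integrable_scaleR_right) (use G' in simp)
    show "(\<lambda>x. \<phi> x *\<^sub>R (indicator K x *\<^sub>R G x)) \<in> borel_measurable lebesgue"
      by (rule borel_measurable_scaleR) (use G' in auto)
    show "AE x in lebesgue. norm (\<phi> x *\<^sub>R (indicator K x *\<^sub>R G x)) \<le> norm (C *\<^sub>R (indicator K x *\<^sub>R G x))"
    proof (rule AE_I2)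
      fix x
      show "norm (\<phi> x *\<^sub>R (indicator K x *\<^sub>R G x)) \<le> norm (C *\<^sub>R (indicator K x *\<^sub>R G x))"
      proof (cases "x \<in> K")
        case True
        have "norm (\<phi> x) \<le> norm C" using C[OF True] by simp
        then show ?thesis using True by (simp add: mult_right_mono)
      qed simp
    qed
  qed
  moreover have "(\<lambda>x. \<phi> x *\<^sub>R (indicator K x *\<^sub>R G x)) = (\<lambda>x. if x \<in> \<Omega> then \<phi> x *\<^sub>R G x else 0)"
    using K(2,3) by (auto simp: indicator_def fun_eq_iff)
  ultimately show ?thesis
    using Lebesgue_Measure.integrable_restrict_UNIV[of \<Omega> "\<lambda>x. \<phi> x *\<^sub>R G x"] \<Omega> by simp
qed

text \<open>
  The fundamental lemma of the calculus of variations. The bump functions of a box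
  approximate its indicator boundedly, so the integral of g vanishes over each box whose closure lies in
  the domain; countably many such boxes cover the domain.
\<close>

lemma AE_eq_0_of_test_integrals:
  fixes g :: "'a::euclidean_space \<Rightarrow> real"
  assumes \<Omega>: "open \<Omega>" and li: "\<And>K. compact K \<Longrightarrow> K \<subseteq> \<Omega> \<Longrightarrow> g absolutely_integrable_on K"
    and z: "\<And>\<phi>. \<phi> \<in> test_functions \<Omega> \<Longrightarrow> (LINT x|lebesgue_on \<Omega>. \<phi> x * g x) = 0"
  shows "AE x in lebesgue_on \<Omega>. g x = 0"
proof -
  have *: "AE x in lebesgue. x \<in> box c d \<longrightarrow> g x = 0" if cd: "cbox c d \<subseteq> \<Omega>" for c d
  proof -
    define h where "h x = indicator (box c d) x * g x" for x
    have h: "integrable lebesgue h"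
    proof -
      have "set_integrable lebesgue (box c d) g"
        using li[OF compact_cbox cd] by (rule set_integrable_subset) (auto simp: box_subset_cbox)
      then show ?thesis by (simp add: set_integrable_def h_def[abs_def])
    qed
    then obtain h' where h': "h' \<in> borel_measurable lborel" "AE x in lborel. h x = h' x"
      using completion_ex_borel_measurable_real[OF borel_measurable_integrable[OF h]] by blast
    have ae: "AE x in lebesgue. h x = h' x" using h'(2) by (rule AE_completion)
    have h'_int: "integrable lborel h'"
    proof -
      have "integrable lebesgue h'"
        by (rule integrable_cong_AE_imp[OF h measurable_completion[OF h'(1)]])
           (use ae in eventually_elim, simp)
      then show ?thesis using integrable_completion[OF h'(1)] by simp
    qed
    have "AE x in lborel. h' x = 0"
    proof (rule AE_eq_0_of_box_integrals[OF h'_int])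
      fix l u :: 'a
      obtain l' u' where B: "box l u \<inter> box c d = box l' u'" and C: "cbox l u \<inter> cbox c d = cbox l' u'"
        unfolding box_Int_box Int_interval by blast
      have sub: "cbox l' u' \<subseteq> \<Omega>" using C cd by blast
      have sub': "box l' u' \<subseteq> box c d" using B by blast
      have "(\<lambda>k. LINT x|lebesgue. box_bump k l' u' x * h x) \<longlonglongrightarrow> (LINT x|lebesgue. indicator (box l' u') x * h x)"
      proof (rule integral_dominated_convergence[where w = "\<lambda>x. norm (h x)"])
        have m: "box_bump k l' u' \<in> borel_measurable lebesgue" for k
          using smooth_on_continuous[OF smooth_on_box_bump[of k l' u']]
          by (intro measurable_completion) (simp add: borel_measurable_continuous_onI)
        show "(\<lambda>x. box_bump k l' u' x * h x) \<in> borel_measurable lebesgue" for k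
          by (rule borel_measurable_times[OF m borel_measurable_integrable[OF h]])
        show "(\<lambda>x. indicator (box l' u') x * h x) \<in> borel_measurable lebesgue"
          by (rule borel_measurable_times[OF borel_measurable_indicator borel_measurable_integrable[OF h]]) auto
        show "AE x in lebesgue. (\<lambda>k. box_bump k l' u' x * h x) \<longlonglongrightarrow> indicator (box l' u') x * h x"
          by (intro AE_I2 tendsto_mult box_bump_tendsto tendsto_const)
        show "AE x in lebesgue. norm (box_bump k l' u' x * h x) \<le> norm (h x)" for k
          using box_bump_bounds[of k l' u'] by (intro AE_I2) (simp add: abs_mult mult_left_le_one_le)
      qed (use h in auto)
      moreover have "(LINT x|lebesgue. box_bump k l' u' x * h x) = 0" for k
      proof -
        have "(LINT x|lebesgue. box_bump k l' u' x * h x) =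
            (LINT x|lebesgue. (if x \<in> \<Omega> then box_bump k l' u' x * g x else 0))"
        proof (rule Bochner_Integration.integral_cong)
          fix x
          show "box_bump k l' u' x * h x = (if x \<in> \<Omega> then box_bump k l' u' x * g x else 0)"
            using box_bump_eq_0[of x l' u' k] sub' sub box_subset_cbox[of l' u']
            by (cases "x \<in> box l' u'") (auto simp: h_def)
        qed simp
        also have "\<dots> = (LINT x|lebesgue_on \<Omega>. box_bump k l' u' x * g x)"
          using Lebesgue_Measure.integral_restrict_UNIV[of \<Omega> "\<lambda>x. box_bump k l' u' x * g x"] \<Omega> by simp
        also have "\<dots> = 0" by (rule z[OF box_bump_test[OF sub]])
        finally show ?thesis .
      qed
      ultimately have "(LINT x|lebesgue. indicator (box l' u') x * h x) = 0"
        by (simp add: LIMSEQ_const_iff)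
      also have "(LINT x|lebesgue. indicator (box l' u') x * h x) = (LINT x|lebesgue. indicator (box l u) x * h' x)"
      proof (rule integral_cong_AE)
        show "AE x in lebesgue. indicator (box l' u') x * h x = indicator (box l u) x * h' x"
          using ae by eventually_elim (auto simp: B[symmetric] h_def indicator_def)
        show "(\<lambda>x. indicator (box l' u') x * h x) \<in> borel_measurable lebesgue"
          by (rule borel_measurable_times[OF borel_measurable_indicator borel_measurable_integrable[OF h]]) auto
        show "(\<lambda>x. indicator (box l u) x * h' x) \<in> borel_measurable lebesgue"
          by (rule measurable_completion) (use h'(1) in auto)
      qed
      also have "\<dots> = (LINT x|lborel. indicator (box l u) x * h' x)"
        by (rule integral_completion) (use h'(1) in auto)
      finally show "(LINT x|lborel. indicator (box l u) x * h' x) = 0" by simp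
    qed
    then have "AE x in lebesgue. h' x = 0" by (rule AE_completion)
    with ae show ?thesis by eventually_elim (auto simp: h_def)
  qed
  have c: "AE x in lebesgue. x \<in> cbox c d \<longrightarrow> g x = 0" if "cbox c d \<subseteq> \<Omega>" for c d
  proof -
    have "AE x in lebesgue. x \<notin> cbox c d - box c d"
      by (rule AE_not_in) (use negligible_frontier_interval[of c d] in \<open>simp add: negligible_iff_null_sets\<close>)
    with *[OF that] show ?thesis by eventually_elim auto
  qed
  obtain D where D: "countable D" "D \<subseteq> Pow \<Omega>" "\<And>X. X \<in> D \<Longrightarrow> \<exists>a b. X = cbox a b" "\<Union>D = \<Omega>"
    using open_countable_Union_open_cbox[OF \<Omega>] by metis
  have "AE x in lebesgue. \<forall>X\<in>D. x \<in> X \<longrightarrow> g x = 0"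
    using D c by (intro AE_ball_countable[THEN iffD2] ballI) (auto, blast)
  then have "AE x in lebesgue. x \<in> \<Omega> \<longrightarrow> g x = 0"
    by eventually_elim (use D(4) in blast)
  then show ?thesis using \<Omega> by (simp add: AE_lebesgue_on_iff)
qed

text \<open>
  By the fundamental lemma applied to each component of the difference. It allows the chosen
  \<open>weak_grad\<close> to be replaced by a weak gradient that is known explicitly.
\<close>

lemma has_weak_grad_unique:
  fixes u :: "'a::euclidean_space \<Rightarrow> real"
  assumes \<Omega>: "open \<Omega>" and "has_weak_grad \<Omega> u G" "has_weak_grad \<Omega> u G'"
  shows "AE x in lebesgue_on \<Omega>. G x = G' x"
proof -
  have li: "G absolutely_integrable_on K" "G' absolutely_integrable_on K" if "compact K" "K \<subseteq> \<Omega>" for K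
    using assms that by (auto simp: has_weak_grad_def)
  have "AE x in lebesgue_on \<Omega>. (G x - G' x) \<bullet> b = 0" for b
  proof (rule AE_eq_0_of_test_integrals[OF \<Omega>])
    show "(\<lambda>x. (G x - G' x) \<bullet> b) absolutely_integrable_on K" if "compact K" "K \<subseteq> \<Omega>" for K
      using set_integral_diff(1)[OF li[OF that]] integrable_inner_left[of b lebesgue "\<lambda>x. indicator K x *\<^sub>R (G x - G' x)"]
      by (auto simp: set_integrable_def)
    fix \<phi> assume \<phi>: "\<phi> \<in> test_functions \<Omega>"
    obtain K where K: "compact K" "K \<subseteq> \<Omega>" "\<And>x. x \<notin> K \<Longrightarrow> \<phi> x = 0" 
      using test_functionsE[OF \<phi>] by metis
    have i: "integrable (lebesgue_on \<Omega>) (\<lambda>x. \<phi> x *\<^sub>R H x)" if "H absolutely_integrable_on K" for H :: "'a \<Rightarrow> 'a"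
      by (rule continuous_times_locally_integrable[OF \<Omega> K(1,2) _ test_functions_continuous(1)[OF \<phi>] that])
         (use K(3) in auto)
    have "(LINT x|lebesgue_on \<Omega>. \<phi> x *\<^sub>R G x) = (LINT x|lebesgue_on \<Omega>. \<phi> x *\<^sub>R G' x)"
      using assms(2,3) \<phi> unfolding has_weak_grad_def by (metis neg_equal_iff_equal)
    then have "0 = (LINT x|lebesgue_on \<Omega>. \<phi> x *\<^sub>R G x - \<phi> x *\<^sub>R G' x) \<bullet> b"
      using i[OF li(1)[OF K(1,2)]] i[OF li(2)[OF K(1,2)]] by simp
    also have "\<dots> = (LINT x|lebesgue_on \<Omega>. (\<phi> x *\<^sub>R G x - \<phi> x *\<^sub>R G' x) \<bullet> b)"
      by (rule integral_inner_left[symmetric])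
         (use i[OF li(1)[OF K(1,2)]] i[OF li(2)[OF K(1,2)]] in auto)
    finally show "(LINT x|lebesgue_on \<Omega>. \<phi> x * ((G x - G' x) \<bullet> b)) = 0"
      by (simp add: inner_diff_left right_diff_distrib)
  qed
  then have "AE x in lebesgue_on \<Omega>. \<forall>b\<in>Basis. (G x - G' x) \<bullet> b = 0"
    by (intro AE_ball_countable[THEN iffD2]) (auto intro: countable_finite)
  then show ?thesis
    by eventually_elim (metis eq_iff_diff_eq_0 euclidean_all_zero_iff)
qed

lemma weak_grad_AE_eq:
  assumes "open \<Omega>" "has_weak_grad \<Omega> u G"
  shows "AE x in lebesgue_on \<Omega>. G x = weak_grad \<Omega> u x"
  using assms someI[of "has_weak_grad \<Omega> u" G]
  by (intro has_weak_grad_unique[of \<Omega> u]) (auto simp: weak_grad_def)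

lemma has_weak_grad_mono:
  fixes u :: "'a::euclidean_space \<Rightarrow> real"
  assumes "has_weak_grad \<Omega> u G" "open \<Omega>'" "\<Omega>' \<subseteq> \<Omega>" "open \<Omega>"
  shows "has_weak_grad \<Omega>' u G"
  unfolding has_weak_grad_def
proof (intro conjI allI impI ballI)
  show "u absolutely_integrable_on K" "G absolutely_integrable_on K" if "compact K \<and> K \<subseteq> \<Omega>'" for K
    using assms(1,3) that unfolding has_weak_grad_def by auto
  fix \<phi> assume \<phi>: "\<phi> \<in> test_functions \<Omega>'"
  obtain K where K: "compact K" "K \<subseteq> \<Omega>'" "\<And>x. x \<notin> K \<Longrightarrow> \<phi> x = 0" "\<And>x. x \<notin> K \<Longrightarrow> grad \<phi> x = 0"
    using test_functionsE[OF \<phi>] by metis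
  have e: "(LINT x|lebesgue_on \<Omega>'. f x) = (LINT x|lebesgue_on \<Omega>. f x)"
    if "\<And>x. x \<notin> K \<Longrightarrow> f x = 0" for f :: "'a \<Rightarrow> 'a"
  proof -
    have "(LINT x|lebesgue_on \<Omega>'. f x) = (LINT x|lebesgue. (if x \<in> \<Omega>' then f x else 0))"
      using assms(2) by (simp add: Lebesgue_Measure.integral_restrict_UNIV)
    also have "(\<lambda>x. if x \<in> \<Omega>' then f x else 0) = (\<lambda>x. if x \<in> \<Omega> then f x else 0)"
      using that K(2) assms(3) by (auto simp: fun_eq_iff)
    also have "(LINT x|lebesgue. (if x \<in> \<Omega> then f x else 0)) = (LINT x|lebesgue_on \<Omega>. f x)"
      using assms(4) by (simp add: Lebesgue_Measure.integral_restrict_UNIV)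
    finally show ?thesis .
  qed
  show "(LINT x|lebesgue_on \<Omega>'. u x *\<^sub>R grad \<phi> x) = - (LINT x|lebesgue_on \<Omega>'. \<phi> x *\<^sub>R G x)"
    using assms(1) test_functions_mono[OF \<phi> assms(3)] K
    by (subst (1 2) e) (auto simp: has_weak_grad_def)
qed

section \<open>Square integrable functions\<close>

lemmas integrable_dominated = Bochner_Integration.integrable_bound
lemmas LINT_cong = Bochner_Integration.integral_cong[OF refl]

abbreviation L2_dist2 :: "'a measure \<Rightarrow> ('a \<Rightarrow> 'b::euclidean_space) \<Rightarrow> ('a \<Rightarrow> 'b) \<Rightarrow> real" where
  "L2_dist2 M f g \<equiv> LINT x|M. (norm (f x - g x))^2"

lemma L2_spaceI: "f \<in> borel_measurable M \<Longrightarrow> integrable M (\<lambda>x. (norm (f x))^2) \<Longrightarrow> f \<in> L2_space M"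
  by (simp add: L2_space_def)

lemma L2_spaceD: "f \<in> L2_space M \<Longrightarrow> f \<in> borel_measurable M" "f \<in> L2_space M \<Longrightarrow> integrable M (\<lambda>x. (norm (f x))^2)"
  by (simp_all add: L2_space_def)

text \<open>
  The standard way to show square integrability below: compare with a function already known to
  be square integrable.
\<close>

lemma L2_space_bound:
  fixes f :: "'a \<Rightarrow> 'b::euclidean_space" and g :: "'a \<Rightarrow> 'c::euclidean_space"
  assumes "f \<in> L2_space M" "g \<in> borel_measurable M" "AE x in M. norm (g x) \<le> C * norm (f x)"
  shows "g \<in> L2_space M"
proof (rule L2_spaceI)
  show "integrable M (\<lambda>x. (norm (g x))^2)"
  proof (rule integrable_dominated)
    show "integrable M (\<lambda>x. C^2 * (norm (f x))^2)" using L2_spaceD(2)[OF assms(1)] by simp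
    show "AE x in M. norm ((norm (g x))^2) \<le> norm (C^2 * (norm (f x))^2)"
      using assms(3)
    proof eventually_elim
      case (elim x)
      then have "(norm (g x))^2 \<le> (C * norm (f x))^2" by (intro power_mono) auto
      then show ?case by (simp add: power_mult_distrib)
    qed
  qed (use assms in measurable)
qed fact

lemma norm_add_power2_le: "(norm (a + b :: 'b::real_normed_vector))^2 \<le> 2 * (norm a)^2 + 2 * (norm b)^2"
proof -
  have "(norm (a + b))^2 \<le> (norm a + norm b)^2" by (intro power_mono norm_triangle_ineq) auto
  also have "\<dots> \<le> 2 * (norm a)^2 + 2 * (norm b)^2"
    using zero_le_power2[of "norm a - norm b"] by (simp add: power2_eq_square algebra_simps)
  finally show ?thesis .
qed

lemma L2_space_add:
  fixes f g :: "'a \<Rightarrow> 'b::euclidean_space"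
  assumes "f \<in> L2_space M" "g \<in> L2_space M"
  shows "(\<lambda>x. f x + g x) \<in> L2_space M"
proof (rule L2_spaceI)
  note [measurable] = L2_spaceD(1)[OF assms(1)] L2_spaceD(1)[OF assms(2)]
  show "(\<lambda>x. f x + g x) \<in> borel_measurable M" by measurable
  show "integrable M (\<lambda>x. (norm (f x + g x))^2)"
  proof (rule integrable_dominated)
    show "integrable M (\<lambda>x. 2 * (norm (f x))^2 + 2 * (norm (g x))^2)"
      using L2_spaceD(2)[OF assms(1)] L2_spaceD(2)[OF assms(2)] by simp
  qed (use norm_add_power2_le in auto)
qed

lemma L2_space_minus:
  fixes f :: "'a \<Rightarrow> 'b::euclidean_space"
  shows "f \<in> L2_space M \<Longrightarrow> (\<lambda>x. - f x) \<in> L2_space M"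
  by (simp add: L2_space_def)

lemma L2_space_diff:
  fixes f g :: "'a \<Rightarrow> 'b::euclidean_space"
  shows "f \<in> L2_space M \<Longrightarrow> g \<in> L2_space M \<Longrightarrow> (\<lambda>x. f x - g x) \<in> L2_space M"
  using L2_space_add[OF _ L2_space_minus] by force

lemma L2_norm_mult_integrable:
  fixes f :: "'a \<Rightarrow> 'b::euclidean_space" and g :: "'a \<Rightarrow> 'c::euclidean_space"
  assumes f: "f \<in> L2_space M" and g: "g \<in> L2_space M"
  shows "integrable M (\<lambda>x. norm (f x) * norm (g x))"
proof (rule integrable_dominated)
  show "integrable M (\<lambda>x. (norm (f x))^2 + (norm (g x))^2)"
    using L2_spaceD(2)[OF f] L2_spaceD(2)[OF g] by simp
  have "norm a * norm b \<le> (norm a)^2 + (norm b)^2" for a :: 'b and b :: 'c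
    using sum_squares_bound[of "norm a" "norm b"] mult_nonneg_nonneg[OF norm_ge_zero[of a] norm_ge_zero[of b]]
    unfolding mult.assoc by linarith
  then show "AE x in M. norm (norm (f x) * norm (g x)) \<le> norm ((norm (f x))^2 + (norm (g x))^2)"
    by (intro AE_I2) simp
qed (use L2_spaceD(1)[OF f] L2_spaceD(1)[OF g] in measurable)

lemma L2_bilinear_integrable:
  fixes f :: "'a \<Rightarrow> 'b::euclidean_space" and g :: "'a \<Rightarrow> 'c::euclidean_space" and B :: "'b \<Rightarrow> 'c \<Rightarrow> 'd::euclidean_space"
  assumes B: "bounded_bilinear B" and f: "f \<in> L2_space M" and g: "g \<in> L2_space M"
  shows "integrable M (\<lambda>x. B (f x) (g x))"
proof -
  obtain K where K: "\<And>a b. norm (B a b) \<le> norm a * norm b * K" "K \<ge> 0"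
    using bounded_bilinear.nonneg_bounded[OF B] by blast
  show ?thesis
  proof (rule integrable_dominated[OF integrable_mult_left[OF L2_norm_mult_integrable[OF f g], of K]])
    show "(\<lambda>x. B (f x) (g x)) \<in> borel_measurable M"
      by (rule borel_measurable_continuous_Pair[OF L2_spaceD(1)[OF f] L2_spaceD(1)[OF g]])
         (intro bounded_bilinear.continuous_on[OF B] continuous_intros)
    show "AE x in M. norm (B (f x) (g x)) \<le> norm (norm (f x) * norm (g x) * K)"
      using K by (intro AE_I2) (simp add: abs_mult)
  qed
qed

lemmas L2_inner_integrable = L2_bilinear_integrable[OF bounded_bilinear_inner]

text \<open>
  The quadratic polynomial t \<mapsto> \<integral> (|f| - t |g|)^2 is nonnegative, and the bound
  follows from its value at the minimum.
\<close>

lemma L2_Cauchy_Schwarz: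
  fixes f :: "'a \<Rightarrow> 'b::euclidean_space" and g :: "'a \<Rightarrow> 'c::euclidean_space"
  assumes f: "f \<in> L2_space M" and g: "g \<in> L2_space M"
  shows "(LINT x|M. norm (f x) * norm (g x)) \<le> sqrt (LINT x|M. (norm (f x))^2) * sqrt (LINT x|M. (norm (g x))^2)"
proof -
  let ?A = "LINT x|M. (norm (f x))^2" and ?B = "LINT x|M. norm (f x) * norm (g x)" and ?C = "LINT x|M. (norm (g x))^2"
  note i = L2_spaceD(2)[OF f] L2_spaceD(2)[OF g] L2_norm_mult_integrable[OF f g]
  have q: "0 \<le> ?A - 2 * t * ?B + t^2 * ?C" for t
  proof -
    have "0 \<le> (LINT x|M. (norm (f x) - t * norm (g x))^2)" by simp
    also have "\<dots> = (LINT x|M. (norm (f x))^2 - 2 * t * (norm (f x) * norm (g x)) + t^2 * (norm (g x))^2)"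
      by (simp add: power2_eq_square algebra_simps)
    also have "\<dots> = ?A - 2 * t * ?B + t^2 * ?C" using i by simp
    finally show ?thesis .
  qed
  have "?B^2 \<le> ?A * ?C"
  proof (cases "?C = 0")
    case True
    have "?B = 0"
    proof (rule ccontr)
      assume "?B \<noteq> 0"
      then show False using q[of "(?A + 1) / (2 * ?B)"] True by (simp add: field_simps)
    qed
    then show ?thesis using True by simp
  next
    case False
    have "?C \<ge> 0" by simp
    with False have C: "?C > 0" by linarith
    have "0 \<le> (?A - 2 * (?B / ?C) * ?B + (?B / ?C)^2 * ?C) * ?C"
      using q[of "?B / ?C"] C by (intro mult_nonneg_nonneg) (simp_all only: less_imp_le)
    also have "\<dots> = ?A * ?C - ?B^2" using C by (simp add: field_simps power2_eq_square)
    finally show ?thesis by simp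
  qed
  then have "\<bar>?B\<bar> \<le> sqrt ?A * sqrt ?C" using real_sqrt_le_mono by (fastforce simp: real_sqrt_mult)
  then show ?thesis by linarith
qed

lemma L2_tendstoD:
  assumes "L2_tendsto M f g"
  shows "f n \<in> L2_space M" "g \<in> L2_space M" "(\<lambda>n. L2_dist2 M (f n) g) \<longlonglongrightarrow> 0"
  using assms by (auto simp: L2_tendsto_def)

lemma L2_tendsto_const: "g \<in> L2_space M \<Longrightarrow> L2_tendsto M (\<lambda>n. g) g"
  by (simp add: L2_tendsto_def)

text \<open>
  Convergence of all quadratic quantities below reduces to this statement: energies use
  the inner product, and the definition of weak gradients uses scalar multiplication.
\<close>

lemma L2_tendsto_bilinear:
  fixes f :: "nat \<Rightarrow> 'a \<Rightarrow> 'b::euclidean_space" and g :: "nat \<Rightarrow> 'a \<Rightarrow> 'c::euclidean_space"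
    and B :: "'b \<Rightarrow> 'c \<Rightarrow> 'd::euclidean_space"
  assumes B: "bounded_bilinear B" and f: "L2_tendsto M f f0" and g: "L2_tendsto M g g0"
  shows "(\<lambda>n. LINT x|M. B (f n x) (g n x)) \<longlonglongrightarrow> (LINT x|M. B (f0 x) (g0 x))"
proof -
  note F = L2_tendstoD[OF f] and G = L2_tendstoD[OF g] and BI = L2_bilinear_integrable[OF B]
  obtain K where K: "\<And>a b. norm (B a b) \<le> norm a * norm b * K" "K \<ge> 0"
    using bounded_bilinear.nonneg_bounded[OF B] by blast
  define N where "N h = sqrt (LINT x|M. (norm (h x))^2)" for h :: "'a \<Rightarrow> 'b"
  define N' where "N' h = sqrt (LINT x|M. (norm (h x))^2)" for h :: "'a \<Rightarrow> 'c"
  let ?f = "\<lambda>n x. f n x - f0 x" and ?g = "\<lambda>n x. g n x - g0 x"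
  have a: "(\<lambda>n. N (?f n)) \<longlonglongrightarrow> 0" and b: "(\<lambda>n. N' (?g n)) \<longlonglongrightarrow> 0"
    unfolding N_def N'_def using tendsto_real_sqrt[OF F(3)] tendsto_real_sqrt[OF G(3)] by simp_all
  have bd: "norm (LINT x|M. B (p x) (q x)) \<le> N p * N' q * K" if p: "p \<in> L2_space M" and q: "q \<in> L2_space M" for p q
  proof -
    have "norm (LINT x|M. B (p x) (q x)) \<le> (LINT x|M. norm (p x) * norm (q x) * K)"
      by (rule order_trans[OF integral_norm_bound integral_mono])
         (use K(1) BI[OF p q] L2_norm_mult_integrable[OF p q] in auto)
    also have "\<dots> \<le> N p * N' q * K"
      using mult_right_mono[OF L2_Cauchy_Schwarz[OF p q] K(2)] by (simp add: N_def N'_def)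
    finally show ?thesis .
  qed
  have "(\<lambda>n. (LINT x|M. B (f n x) (g n x)) - (LINT x|M. B (f0 x) (g0 x))) \<longlonglongrightarrow> 0"
  proof (rule Lim_null_comparison)
    show "\<forall>\<^sub>F n in sequentially. norm ((LINT x|M. B (f n x) (g n x)) - (LINT x|M. B (f0 x) (g0 x)))
        \<le> N (?f n) * N' (?g n) * K + N (?f n) * N' g0 * K + N f0 * N' (?g n) * K"
    proof (intro always_eventually allI)
      fix n
      have d: "?f n \<in> L2_space M" "?g n \<in> L2_space M" using F G by (auto intro: L2_space_diff)
      have "(LINT x|M. B (f n x) (g n x)) - (LINT x|M. B (f0 x) (g0 x)) = (LINT x|M. B (f n x) (g n x) - B (f0 x) (g0 x))"
        using BI[OF F(1) G(1)] BI[OF F(2) G(2)] by simp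
      also have "\<dots> = (LINT x|M. B (?f n x) (?g n x) + B (?f n x) (g0 x) + B (f0 x) (?g n x))"
        by (simp only: bounded_bilinear.prod_diff_prod[OF B])
      also have "\<dots> = (LINT x|M. B (?f n x) (?g n x)) + (LINT x|M. B (?f n x) (g0 x)) + (LINT x|M. B (f0 x) (?g n x))"
        using BI[OF d] BI[OF d(1) G(2)] BI[OF F(2) d(2)] by simp
      finally show "norm ((LINT x|M. B (f n x) (g n x)) - (LINT x|M. B (f0 x) (g0 x)))
          \<le> N (?f n) * N' (?g n) * K + N (?f n) * N' g0 * K + N f0 * N' (?g n) * K"
        using bd[OF d] bd[OF d(1) G(2)] bd[OF F(2) d(2)]
        by (simp only:) (intro norm_triangle_le add_mono)
    qed
    have "(\<lambda>n. N (?f n) * N' (?g n) * K + N (?f n) * N' g0 * K + N f0 * N' (?g n) * K) \<longlonglongrightarrow> 0 * 0 * K + 0 * N' g0 * K + N f0 * 0 * K"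
      by (intro tendsto_intros a b)
    then show "(\<lambda>n. N (?f n) * N' (?g n) * K + N (?f n) * N' g0 * K + N f0 * N' (?g n) * K) \<longlonglongrightarrow> 0" by simp
  qed
  then show ?thesis by (simp add: LIM_zero_iff)
qed

lemmas L2_tendsto_inner = L2_tendsto_bilinear[OF bounded_bilinear_inner]

lemma L2_tendsto_norm2:
  fixes f :: "nat \<Rightarrow> 'a \<Rightarrow> 'b::euclidean_space"
  assumes "L2_tendsto M f f0"
  shows "(\<lambda>n. LINT x|M. (norm (f n x))^2) \<longlonglongrightarrow> (LINT x|M. (norm (f0 x))^2)"
  using L2_tendsto_inner[OF assms assms] by (simp add: power2_norm_eq_inner)

lemma L2_tendsto_squeeze:
  fixes f :: "nat \<Rightarrow> 'a \<Rightarrow> 'b::euclidean_space"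
  assumes "\<And>n. f n \<in> L2_space M" "f0 \<in> L2_space M" "\<And>n. L2_dist2 M (f n) f0 \<le> e n" "e \<longlonglongrightarrow> 0"
  shows "L2_tendsto M f f0"
  unfolding L2_tendsto_def
  by (intro conjI allI assms(1,2) Lim_null_comparison[OF _ assms(4)] always_eventually)
     (use assms(3) in simp)

text \<open>
  Pointwise linear operations with bounded coefficients preserve convergence. The linearity
  enters only through the third bound.
\<close>

lemma L2_tendsto_bounded_map:
  fixes f :: "nat \<Rightarrow> 'a \<Rightarrow> 'b::euclidean_space" and h :: "nat \<Rightarrow> 'a \<Rightarrow> 'c::euclidean_space"
  assumes f: "L2_tendsto M f f0"
    and m: "\<And>n. h n \<in> borel_measurable M" "h0 \<in> borel_measurable M"
    and b: "\<And>n. AE x in M. norm (h n x) \<le> C * norm (f n x)" "AE x in M. norm (h0 x) \<le> C * norm (f0 x)"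
      "\<And>n. AE x in M. norm (h n x - h0 x) \<le> C * norm (f n x - f0 x)"
  shows "L2_tendsto M h h0"
proof (rule L2_tendsto_squeeze)
  note F = L2_tendstoD[OF f]
  show h: "h n \<in> L2_space M" for n by (rule L2_space_bound[OF F(1) m(1) b(1)])
  show h0: "h0 \<in> L2_space M" by (rule L2_space_bound[OF F(2) m(2) b(2)])
  show "(\<lambda>n. C^2 * L2_dist2 M (f n) f0) \<longlonglongrightarrow> 0"
    using tendsto_mult_left[OF F(3), of "C^2"] by simp
  show "L2_dist2 M (h n) h0 \<le> C^2 * L2_dist2 M (f n) f0" for n
  proof -
    have "L2_dist2 M (h n) h0 \<le> (LINT x|M. C^2 * (norm (f n x - f0 x))^2)"
    proof (rule integral_mono_AE)
      show "AE x in M. (norm (h n x - h0 x))^2 \<le> C^2 * (norm (f n x - f0 x))^2"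
        using b(3)[of n] by eventually_elim (metis norm_ge_zero power_mono power_mult_distrib)
    qed (use L2_spaceD(2)[OF L2_space_diff[OF h h0]] L2_spaceD(2)[OF L2_space_diff[OF F(1) F(2)]] in auto)
    then show ?thesis by simp
  qed
qed

lemma L2_tendsto_add:
  fixes f g :: "nat \<Rightarrow> 'a \<Rightarrow> 'b::euclidean_space"
  assumes f: "L2_tendsto M f f0" and g: "L2_tendsto M g g0"
  shows "L2_tendsto M (\<lambda>n x. f n x + g n x) (\<lambda>x. f0 x + g0 x)"
proof (rule L2_tendsto_squeeze)
  note F = L2_tendstoD[OF f] and G = L2_tendstoD[OF g]
  show "(\<lambda>x. f n x + g n x) \<in> L2_space M" for n by (rule L2_space_add[OF F(1) G(1)])
  show "(\<lambda>x. f0 x + g0 x) \<in> L2_space M" by (rule L2_space_add[OF F(2) G(2)])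
  let ?e = "\<lambda>n. 2 * L2_dist2 M (f n) f0 + 2 * L2_dist2 M (g n) g0"
  have "?e \<longlonglongrightarrow> 2 * 0 + 2 * 0" by (intro tendsto_intros F(3) G(3))
  then show "?e \<longlonglongrightarrow> 0" by simp
  show "(LINT x|M. (norm (f n x + g n x - (f0 x + g0 x)))^2) \<le> ?e n" for n
  proof -
    note i = L2_space_diff[OF F(1)[of n] F(2)] L2_space_diff[OF G(1)[of n] G(2)]
    have "(LINT x|M. (norm (f n x + g n x - (f0 x + g0 x)))^2) = (LINT x|M. (norm ((f n x - f0 x) + (g n x - g0 x)))^2)"
      by (simp add: algebra_simps)
    also have "\<dots> \<le> (LINT x|M. 2 * (norm (f n x - f0 x))^2 + 2 * (norm (g n x - g0 x))^2)"
      by (rule integral_mono)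
         (use L2_spaceD(2)[OF L2_space_add[OF i]] L2_spaceD(2)[OF i(1)] L2_spaceD(2)[OF i(2)] norm_add_power2_le in auto)
    also have "\<dots> = ?e n" using L2_spaceD(2)[OF i(1)] L2_spaceD(2)[OF i(2)] by simp
    finally show ?thesis .
  qed
qed

lemma L2_tendsto_minus:
  fixes f :: "nat \<Rightarrow> 'a \<Rightarrow> 'b::euclidean_space"
  assumes "L2_tendsto M f f0"
  shows "L2_tendsto M (\<lambda>n x. - f n x) (\<lambda>x. - f0 x)"
  using assms by (auto simp: L2_tendsto_def L2_space_minus norm_minus_commute algebra_simps)

lemma L2_tendsto_diff:
  fixes f g :: "nat \<Rightarrow> 'a \<Rightarrow> 'b::euclidean_space"
  assumes f: "L2_tendsto M f f0" and g: "L2_tendsto M g g0"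
  shows "L2_tendsto M (\<lambda>n x. f n x - g n x) (\<lambda>x. f0 x - g0 x)"
  using L2_tendsto_add[OF f L2_tendsto_minus[OF g]] by simp

lemma L2_space_lebesgue_on_subset:
  fixes f :: "'a::euclidean_space \<Rightarrow> 'b::euclidean_space"
  assumes "f \<in> L2_space (lebesgue_on A)" "B \<subseteq> A" "A \<in> sets lebesgue" "B \<in> sets lebesgue"
  shows "f \<in> L2_space (lebesgue_on B)"
proof (rule L2_spaceI)
  show "f \<in> borel_measurable (lebesgue_on B)"
    using measurable_restrict_mono[OF L2_spaceD(1)[OF assms(1)] assms(2)] .
  show "integrable (lebesgue_on B) (\<lambda>x. (norm (f x))^2)"
    using L2_spaceD(2)[OF assms(1)] assms(2-4)
      set_integrable_subset[of lebesgue A "\<lambda>x. (norm (f x))^2" B]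
    by (simp add: set_integrable_def integrable_restrict_space)
qed

lemma L2_tendsto_lebesgue_on_subset:
  fixes f :: "nat \<Rightarrow> 'a::euclidean_space \<Rightarrow> 'b::euclidean_space"
  assumes f: "L2_tendsto (lebesgue_on A) f f0" and s: "B \<subseteq> A" "A \<in> sets lebesgue" "B \<in> sets lebesgue"
  shows "L2_tendsto (lebesgue_on B) f f0"
proof (rule L2_tendsto_squeeze[OF _ _ _ L2_tendstoD(3)[OF f]])
  note F = L2_tendstoD[OF f]
  show "f n \<in> L2_space (lebesgue_on B)" for n by (rule L2_space_lebesgue_on_subset[OF F(1) s])
  show "f0 \<in> L2_space (lebesgue_on B)" by (rule L2_space_lebesgue_on_subset[OF F(2) s])
  show "L2_dist2 (lebesgue_on B) (f n) f0 \<le> L2_dist2 (lebesgue_on A) (f n) f0" for n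
    by (rule integral_mono_lebesgue_on_AE[OF L2_spaceD(2)[OF L2_space_diff[OF F(1) F(2)]]]) (use s in auto)
qed

definition L2_Cauchy :: "'a measure \<Rightarrow> (nat \<Rightarrow> 'a \<Rightarrow> 'b::euclidean_space) \<Rightarrow> bool" where
  "L2_Cauchy M f \<longleftrightarrow> (\<forall>n. f n \<in> L2_space M) \<and>
     (\<forall>e>0. \<exists>N. \<forall>m\<ge>N. \<forall>n\<ge>N. L2_dist2 M (f m) (f n) < e)"

lemma L2_tendsto_imp_Cauchy:
  fixes f :: "nat \<Rightarrow> 'a \<Rightarrow> 'b::euclidean_space"
  assumes f: "L2_tendsto M f g"
  shows "L2_Cauchy M f"
  unfolding L2_Cauchy_def
proof (intro conjI allI impI)
  note F = L2_tendstoD[OF f]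
  show "f n \<in> L2_space M" for n by (rule F)
  fix e :: real assume "e > 0"
  then have "\<forall>\<^sub>F n in sequentially. L2_dist2 M (f n) g < e / 4"
    using order_tendstoD(2)[OF F(3), of "e / 4"] by simp
  then obtain N where N: "\<And>n. n \<ge> N \<Longrightarrow> L2_dist2 M (f n) g < e / 4"
    by (auto simp: eventually_sequentially)
  have "L2_dist2 M (f m) (f n) < e" if "m \<ge> N" "n \<ge> N" for m n
  proof -
    note d = L2_space_diff[OF F(1)[of m] F(2)] L2_space_diff[OF F(2) F(1)[of n]]
    have "L2_dist2 M (f m) (f n) = (LINT x|M. (norm ((f m x - g x) + (g x - f n x)))^2)"
      by simp
    also have "\<dots> \<le> (LINT x|M. 2 * (norm (f m x - g x))^2 + 2 * (norm (g x - f n x))^2)"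
      by (rule integral_mono[OF L2_spaceD(2)[OF L2_space_add[OF d]] _ norm_add_power2_le])
         (use L2_spaceD(2)[OF d(1)] L2_spaceD(2)[OF d(2)] in auto)
    also have "\<dots> = 2 * L2_dist2 M (f m) g + 2 * L2_dist2 M g (f n)"
      using L2_spaceD(2)[OF d(1)] L2_spaceD(2)[OF d(2)] by simp
    also have "\<dots> < e" using N[OF that(1)] N[OF that(2)] by (simp add: norm_minus_commute)
    finally show ?thesis .
  qed
  then show "\<exists>N. \<forall>m\<ge>N. \<forall>n\<ge>N. L2_dist2 M (f m) (f n) < e" by blast
qed

text \<open>
  The Riesz-Fischer theorem. Along a subsequence with squared distances below 4^(-k) the
  increments satisfy \<Sum> 2^k d_k^2 < \<infinity> almost everywhere, and d_k \<le> 2^k d_k^2 + 2^(-k) makes them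
  summable. The pointwise limit is the limit in L^2 by Fatou's lemma.
\<close>

lemma L2_complete:
  fixes f :: "nat \<Rightarrow> 'a \<Rightarrow> 'b::euclidean_space"
  assumes "L2_Cauchy M f"
  obtains g where "L2_tendsto M f g"
proof -
  have f: "f n \<in> L2_space M" for n using assms by (simp add: L2_Cauchy_def)
  note [measurable] = L2_spaceD(1)[OF f]
  have i: "integrable M (\<lambda>x. (norm (f m x - f n x))^2)" for m n
    by (rule L2_spaceD(2)[OF L2_space_diff[OF f f]])
  have "\<exists>N. \<forall>m\<ge>N. \<forall>n\<ge>N. L2_dist2 M (f m) (f n) < (1/4) ^ k" for k :: nat
    using assms unfolding L2_Cauchy_def by simp
  then obtain N where N: "\<And>k m n. m \<ge> N k \<Longrightarrow> n \<ge> N k \<Longrightarrow> L2_dist2 M (f m) (f n) < (1/4) ^ k"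
    by metis
  \<comment> \<open>The sum makes r dominate each N k, and the summand k makes it tend to infinity.\<close>
  define r where "r k = (\<Sum>i\<le>k. N i) + k" for k
  have rN: "r k \<ge> N k" for k unfolding r_def by (simp add: member_le_sum trans_le_add1)
  have r1: "r (Suc k) \<ge> N k" for k using rN[of k] by (simp add: r_def)
  define d where "d k x = norm (f (r (Suc k)) x - f (r k) x)" for k x
  have [measurable]: "d k \<in> borel_measurable M" for k unfolding d_def by measurable
  have "AE x in M. convergent (\<lambda>k. f (r k) x)"
  proof -
    have "(\<integral>\<^sup>+x. (\<Sum>k. ennreal (2 ^ k * (d k x)^2)) \<partial>M) = (\<Sum>k. \<integral>\<^sup>+x. ennreal (2 ^ k * (d k x)^2) \<partial>M)"
      by (rule nn_integral_suminf) measurable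
    also have "\<dots> \<le> (\<Sum>k. ennreal ((1/2) ^ k))"
    proof (rule suminf_le)
      fix k
      have "(\<integral>\<^sup>+x. ennreal (2 ^ k * (d k x)^2) \<partial>M) = ennreal (LINT x|M. 2 ^ k * (d k x)^2)"
        by (rule nn_integral_eq_integral) (use i[of "r (Suc k)" "r k"] in \<open>auto simp: d_def\<close>)
      also have "(LINT x|M. 2 ^ k * (d k x)^2) = 2 ^ k * L2_dist2 M (f (r (Suc k))) (f (r k))"
        by (simp add: d_def)
      also have "ennreal \<dots> \<le> ennreal (2 ^ k * (1/4) ^ k)"
        using N[OF r1 rN, of k] by (intro ennreal_leI mult_left_mono) auto
      also have "(2::real) ^ k * (1/4) ^ k = (1/2) ^ k" by (simp add: power_mult_distrib[symmetric])
      finally show "(\<integral>\<^sup>+x. ennreal (2 ^ k * (d k x)^2) \<partial>M) \<le> ennreal ((1/2) ^ k)" .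
    qed auto
    also have "\<dots> = ennreal (\<Sum>k. (1/2) ^ k)"
      by (rule suminf_ennreal2) (auto intro: summable_geometric)
    also have "\<dots> < \<infinity>" by simp
    finally have "(\<integral>\<^sup>+x. (\<Sum>k. ennreal (2 ^ k * (d k x)^2)) \<partial>M) \<noteq> \<infinity>" by simp
    then have "AE x in M. (\<Sum>k. ennreal (2 ^ k * (d k x)^2)) \<noteq> \<infinity>"
      by (rule nn_integral_PInf_AE[rotated]) measurable
    then show ?thesis
    proof eventually_elim
      case (elim x)
      have s: "summable (\<lambda>k. 2 ^ k * (d k x)^2)"
        by (rule summable_suminf_not_top) (use elim in auto)
      have "summable (\<lambda>k. 2 ^ k * (d k x)^2 + (1/2) ^ k)"
        by (intro summable_add s summable_geometric) auto
      then have "summable (\<lambda>k. d k x)"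
      proof (rule summable_comparison_test'[of _ 0])
        fix k
        have "0 \<le> (d k x * 2 ^ k - 1)^2" by simp
        then have "2 * (d k x * 2 ^ k) \<le> (d k x)^2 * (2 ^ k * 2 ^ k) + 1"
          by (simp add: power2_eq_square algebra_simps)
        then have "2 * (d k x * 2 ^ k) * (1/2) ^ k \<le> ((d k x)^2 * (2 ^ k * 2 ^ k) + 1) * (1/2) ^ k"
          by (rule mult_right_mono) simp
        then have "2 * d k x \<le> 2 ^ k * (d k x)^2 + (1/2) ^ k"
          by (simp add: field_simps)
        moreover have "0 \<le> d k x" by (simp add: d_def)
        ultimately show "norm (d k x) \<le> 2 ^ k * (d k x)^2 + (1/2) ^ k" by simp
      qed
      then have "summable (\<lambda>k. f (r (Suc k)) x - f (r k) x)"
        unfolding d_def by (rule summable_norm_cancel)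
      then have "convergent (\<lambda>n. \<Sum>k<n. f (r (Suc k)) x - f (r k) x)"
        by (simp add: summable_iff_convergent)
      then have "convergent (\<lambda>n. f (r n) x - f (r 0) x)"
        by (subst (asm) sum_lessThan_telescope)
      then have "convergent (\<lambda>n. (f (r n) x - f (r 0) x) + f (r 0) x)"
        by (intro convergent_add convergent_const)
      then show ?case by simp
    qed
  qed
  then have lim: "AE x in M. (\<lambda>k. f (r k) x) \<longlonglongrightarrow> lim (\<lambda>k. f (r k) x)"
    by (simp add: convergent_LIMSEQ_iff)
  define g where "g x = lim (\<lambda>k. f (r k) x)" for x
  have [measurable]: "g \<in> borel_measurable M" unfolding g_def by (rule borel_measurable_lim_metric) measurable
  have rk: "r k \<ge> k" for k by (simp add: r_def)
  have bd: "(\<integral>\<^sup>+x. ennreal ((norm (f n x - g x))^2) \<partial>M) \<le> ennreal e"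
    if "\<And>m. m \<ge> K \<Longrightarrow> L2_dist2 M (f n) (f m) \<le> e" for n K e
  proof -
    have "(\<integral>\<^sup>+x. ennreal ((norm (f n x - g x))^2) \<partial>M)
        = (\<integral>\<^sup>+x. liminf (\<lambda>k. ennreal ((norm (f n x - f (r k) x))^2)) \<partial>M)"
    proof (rule nn_integral_cong_AE)
      show "AE x in M. ennreal ((norm (f n x - g x))^2) = liminf (\<lambda>k. ennreal ((norm (f n x - f (r k) x))^2))"
        using lim
      proof eventually_elim
        case (elim x)
        have "(\<lambda>k. ennreal ((norm (f n x - f (r k) x))^2)) \<longlonglongrightarrow> ennreal ((norm (f n x - g x))^2)"
          unfolding g_def by (intro tendsto_intros elim)
        then show ?case by (rule lim_imp_Liminf[OF sequentially_bot, symmetric])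
      qed
    qed
    also have "\<dots> \<le> liminf (\<lambda>k. \<integral>\<^sup>+x. ennreal ((norm (f n x - f (r k) x))^2) \<partial>M)"
      by (rule nn_integral_liminf) measurable
    also have "\<dots> \<le> limsup (\<lambda>k. \<integral>\<^sup>+x. ennreal ((norm (f n x - f (r k) x))^2) \<partial>M)"
      by (rule Liminf_le_Limsup) simp
    also have "\<dots> \<le> ennreal e"
    proof (rule Limsup_bounded)
      show "\<forall>\<^sub>F k in sequentially. (\<integral>\<^sup>+x. ennreal ((norm (f n x - f (r k) x))^2) \<partial>M) \<le> ennreal e"
        using eventually_ge_at_top[of K]
      proof eventually_elim
        case (elim k)
        have "(\<integral>\<^sup>+x. ennreal ((norm (f n x - f (r k) x))^2) \<partial>M) = ennreal (L2_dist2 M (f n) (f (r k)))"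
          by (rule nn_integral_eq_integral) (use i in auto)
        then show ?case using that[of "r k"] rk[of k] elim by (auto intro!: ennreal_leI)
      qed
    qed
    finally show ?thesis .
  qed
  have ev: "\<exists>K. \<forall>n\<ge>K. (\<integral>\<^sup>+x. ennreal ((norm (f n x - g x))^2) \<partial>M) \<le> ennreal e" if "e > 0" for e
  proof -
    obtain K where K: "\<forall>m\<ge>K. \<forall>n\<ge>K. L2_dist2 M (f m) (f n) < e"
      using assms \<open>e > 0\<close> unfolding L2_Cauchy_def by blast
    have "(\<integral>\<^sup>+x. ennreal ((norm (f n x - g x))^2) \<partial>M) \<le> ennreal e" if "n \<ge> K" for n
      by (rule bd[of K]) (use K that in \<open>simp add: less_imp_le\<close>)
    then show ?thesis by blast
  qed
  have dL2: "(\<lambda>x. f n x - g x) \<in> L2_space M" if "(\<integral>\<^sup>+x. ennreal ((norm (f n x - g x))^2) \<partial>M) \<le> ennreal e" for n e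
  proof (rule L2_spaceI)
    show "integrable M (\<lambda>x. (norm (f n x - g x))^2)"
    proof (rule integrableI_bounded)
      show "(\<integral>\<^sup>+x. ennreal (norm ((norm (f n x - g x))^2)) \<partial>M) < \<infinity>"
        using order.strict_trans1[OF that ennreal_less_top] by simp
    qed measurable
  qed measurable
  obtain K1 where K1: "\<And>n. n \<ge> K1 \<Longrightarrow> (\<integral>\<^sup>+x. ennreal ((norm (f n x - g x))^2) \<partial>M) \<le> ennreal 1" using ev[of 1] by auto
  have gL2: "g \<in> L2_space M"
    using L2_space_diff[OF f[of K1] dL2[OF K1[of K1]]] by simp
  have "(\<lambda>n. L2_dist2 M (f n) g) \<longlonglongrightarrow> 0"
  proof (rule LIMSEQ_I)
    fix e :: real assume "e > 0"
    then obtain K where K: "\<And>n. n \<ge> K \<Longrightarrow> (\<integral>\<^sup>+x. ennreal ((norm (f n x - g x))^2) \<partial>M) \<le> ennreal (e/2)"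
      using ev[of "e/2"] by auto
    have "norm (L2_dist2 M (f n) g - 0) < e" if "n \<ge> K" for n
    proof -
      have "ennreal (L2_dist2 M (f n) g) = (\<integral>\<^sup>+x. ennreal ((norm (f n x - g x))^2) \<partial>M)"
        by (rule nn_integral_eq_integral[symmetric]) (use L2_spaceD(2)[OF L2_space_diff[OF f gL2]] in auto)
      also have "\<dots> \<le> ennreal (e/2)" by (rule K[OF that])
      finally have "L2_dist2 M (f n) g \<le> e/2" using \<open>e > 0\<close> by (simp add: ennreal_le_iff)
      then show ?thesis using \<open>e > 0\<close> by simp
    qed
    then show "\<exists>no. \<forall>n\<ge>no. norm (L2_dist2 M (f n) g - 0) < e" by blast
  qed
  then have "L2_tendsto M f g" unfolding L2_tendsto_def using f gL2 by blast
  then show thesis by (rule that)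
qed

lemma L2_absolutely_integrable_on_compact:
  fixes f :: "'a::euclidean_space \<Rightarrow> 'b::euclidean_space"
  assumes "f \<in> L2_space (lebesgue_on \<Omega>)" "\<Omega> \<in> sets lebesgue" "compact K" "K \<subseteq> \<Omega>"
  shows "f absolutely_integrable_on K"
proof -
  have Ks: "K \<in> sets lebesgue" using assms(3) by (simp add: borel_compact)
  have f: "f \<in> L2_space (lebesgue_on K)" by (rule L2_space_lebesgue_on_subset[OF assms(1,4,2) Ks])
  have "finite_measure (lebesgue_on K)"
    by (rule finite_measure_lebesgue_on) (use assms(3) in \<open>rule lmeasurable_compact\<close>)
  then have "integrable (lebesgue_on K) (\<lambda>x. 1 :: real)" by (rule finite_measure.integrable_const)
  then have "integrable (lebesgue_on K) (\<lambda>x. 1 + (norm (f x))^2)" using L2_spaceD(2)[OF f] by simp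
  then have "integrable (lebesgue_on K) f"
  proof (rule integrable_dominated)
    have "t \<le> 1 + t^2" if "t \<ge> 0" for t :: real using zero_le_power2[of "t - 1"] that by (simp add: power2_eq_square algebra_simps)
    then show "AE x in lebesgue_on K. norm (f x) \<le> norm (1 + (norm (f x))^2)"
      by (intro AE_I2) (simp add: abs_of_nonneg)
  qed (use L2_spaceD(1)[OF f] in auto)
  then show ?thesis
    using Ks by (simp add: set_integrable_def integrable_restrict_space)
qed

text \<open>
  Both sides of the defining identity are bilinear and hence continuous in L^2.
\<close>

lemma has_weak_grad_L2_limit:
  fixes u :: "'a::euclidean_space \<Rightarrow> real"
  assumes \<Omega>: "open \<Omega>" and f: "\<And>n. smooth_on \<Omega> (f n)"
    and u: "L2_tendsto (lebesgue_on \<Omega>) f u" and G: "L2_tendsto (lebesgue_on \<Omega>) (\<lambda>n. grad (f n)) G"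
  shows "has_weak_grad \<Omega> u G"
  unfolding has_weak_grad_def
proof (intro conjI allI impI ballI)
  have \<Omega>': "\<Omega> \<in> sets lebesgue" using \<Omega> by simp
  show "u absolutely_integrable_on K" "G absolutely_integrable_on K" if "compact K \<and> K \<subseteq> \<Omega>" for K
    using L2_absolutely_integrable_on_compact[OF _ \<Omega>'] L2_tendstoD(2)[OF u] L2_tendstoD(2)[OF G] that by blast+
  fix \<phi> assume \<phi>: "\<phi> \<in> test_functions \<Omega>"
  obtain K where K: "compact K" "K \<subseteq> \<Omega>" "\<And>x. x \<notin> K \<Longrightarrow> \<phi> x = 0" "\<And>x. x \<notin> K \<Longrightarrow> grad \<phi> x = 0"
    using test_functionsE[OF \<phi>] by metis
  note c = test_functions_continuous[OF \<phi>]
  have L2: "h \<in> L2_space (lebesgue_on \<Omega>)" if "continuous_on \<Omega> h" "\<And>x. x \<notin> K \<Longrightarrow> h x = 0" for h :: "'a \<Rightarrow> 'c::euclidean_space"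
  proof (rule L2_spaceI)
    show "h \<in> borel_measurable (lebesgue_on \<Omega>)"
      by (rule continuous_imp_measurable_on_sets_lebesgue[OF that(1) \<Omega>'])
    show "integrable (lebesgue_on \<Omega>) (\<lambda>x. (norm (h x))^2)"
      by (rule compact_support_lebesgue_on(1)[OF \<Omega> K(1,2)]) (use that in \<open>auto intro!: continuous_intros\<close>)
  qed
  let ?I = "\<lambda>v H. (LINT x|lebesgue_on \<Omega>. v x *\<^sub>R grad \<phi> x) + (LINT x|lebesgue_on \<Omega>. \<phi> x *\<^sub>R H x)"
  have "(\<lambda>n. ?I (f n) (grad (f n))) \<longlonglongrightarrow> ?I u G"
    by (intro tendsto_add L2_tendsto_bilinear[OF bounded_bilinear_scaleR] u G L2_tendsto_const L2 c) (use K(3,4) in auto)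
  moreover have "?I (f n) (grad (f n)) = 0" for n
    using has_weak_grad_smooth[OF \<Omega> f[of n]] \<phi> unfolding has_weak_grad_def by simp
  ultimately have "?I u G = 0" by (simp add: LIMSEQ_const_iff)
  then show "(LINT x|lebesgue_on \<Omega>. u x *\<^sub>R grad \<phi> x) = - (LINT x|lebesgue_on \<Omega>. \<phi> x *\<^sub>R G x)"
    by (simp only: eq_neg_iff_add_eq_0)
qed

section \<open>Surface measure and polar coordinates\<close>

lemma scale_measure_eq_density: "scale_measure c M = density M (\<lambda>_. c)"
  by (rule measure_eqI) (auto simp: emeasure_density_const)

lemma nn_integral_lborel_scaleR:
  fixes f :: "'a::euclidean_space \<Rightarrow> ennreal"
  assumes [measurable]: "f \<in> borel_measurable borel" and c: "c > 0"
  shows "(\<integral>\<^sup>+x. f x \<partial>lborel) = ennreal (c ^ DIM('a)) * (\<integral>\<^sup>+x. f (c *\<^sub>R x) \<partial>lborel)"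
  using c by (subst lborel_affine[of c 0]) (simp_all add: nn_integral_density nn_integral_distr nn_integral_cmult)

lemma sets_sphere_measure [simp]: "sets (sphere_measure r) = sets (restrict_space borel (sphere 0 r))"
  by (simp add: sphere_measure_def)

lemma space_sphere_measure [simp]: "space (sphere_measure r) = sphere 0 r"
  by (simp add: sphere_measure_def space_scale_measure space_restrict_space)

lemma sphere_measure_measurable_borel:
  "f \<in> borel_measurable borel \<Longrightarrow> f \<in> borel_measurable (sphere_measure r)"
  by (subst measurable_cong_sets[OF sets_sphere_measure refl]) (rule measurable_restrict_space1)

lemma radial_projection_measurable:
  assumes "r > 0"
  shows "(\<lambda>x::'a::euclidean_space. (r / norm x) *\<^sub>R x) \<in> restrict_space lborel (ball 0 r - {0}) \<rightarrow>\<^sub>M restrict_space borel (sphere 0 r)"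
proof (rule measurable_restrict_space2)
  show "(\<lambda>x::'a. (r / norm x) *\<^sub>R x) \<in> space (restrict_space lborel (ball 0 r - {0})) \<rightarrow> sphere 0 r"
    using assms by (auto simp: space_restrict_space)
  show "(\<lambda>x::'a. (r / norm x) *\<^sub>R x) \<in> restrict_space lborel (ball 0 r - {0}) \<rightarrow>\<^sub>M borel"
    by (rule measurable_restrict_space1) measurable
qed

lemma nn_integral_sphere_measure:
  fixes h :: "'a::euclidean_space \<Rightarrow> ennreal"
  assumes r: "r > 0" and h: "h \<in> borel_measurable (restrict_space borel (sphere 0 r))"
  shows "(\<integral>\<^sup>+x. h x \<partial>sphere_measure r) =
     ennreal (real DIM('a) / r) * (\<integral>\<^sup>+x. h ((r / norm x) *\<^sub>R x) * indicator (ball 0 r - {0}) x \<partial>lborel)"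
  unfolding sphere_measure_def
  using radial_projection_measurable[OF r, where 'a = 'a] h
  by (simp add: nn_integral_scale_measure nn_integral_distr nn_integral_restrict_space)

lemma scaleR_sphere_measurable:
  assumes "r > 0"
  shows "(\<lambda>x::'a::euclidean_space. r *\<^sub>R x) \<in> sphere_measure 1 \<rightarrow>\<^sub>M restrict_space borel (sphere 0 r)"
  by (rule measurable_restrict_space2) (use assms in \<open>auto intro!: sphere_measure_measurable_borel\<close>)

text \<open>
  Surface measure on the sphere of radius r is defined by the cone over
  the sphere inside the ball of radius r. Dilating this ball to the unit ball gives the factor r^N,
  and the normalisation of the measure replaces it by r^(N-1).
\<close>

lemma nn_integral_sphere_measure_scale:
  fixes h :: "'a::euclidean_space \<Rightarrow> ennreal"
  assumes r: "r > 0" and h: "h \<in> borel_measurable borel"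
  shows "(\<integral>\<^sup>+x. h x \<partial>sphere_measure r) = ennreal (r ^ (DIM('a) - 1)) * (\<integral>\<^sup>+x. h (r *\<^sub>R x) \<partial>sphere_measure 1)"
proof -
  obtain n where n: "DIM('a) = Suc n" using DIM_positive[where 'a = 'a] by (metis gr0_implies_Suc)
  have [measurable]: "h \<in> borel_measurable borel" "ball (0::'a) r \<in> sets borel" "{0::'a} \<in> sets borel" using h by auto
  have hr: "(\<lambda>x. h (r *\<^sub>R x)) \<in> borel_measurable borel" by measurable
  let ?J = "\<integral>\<^sup>+x. h ((r / norm x) *\<^sub>R x) * indicator (ball 0 1 - {0}) x \<partial>lborel"
  have "(\<integral>\<^sup>+x. h x \<partial>sphere_measure r) = ennreal (real DIM('a) / r) * (\<integral>\<^sup>+x. h ((r / norm x) *\<^sub>R x) * indicator (ball 0 r - {0}) x \<partial>lborel)"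
    by (rule nn_integral_sphere_measure[OF r measurable_restrict_space1[OF h]])
  also have "(\<integral>\<^sup>+x. h ((r / norm x) *\<^sub>R x) * indicator (ball 0 r - {0}) x \<partial>lborel) = ennreal (r ^ DIM('a)) *
      (\<integral>\<^sup>+x. h ((r / norm (r *\<^sub>R x)) *\<^sub>R (r *\<^sub>R x)) * indicator (ball 0 r - {0}) (r *\<^sub>R x) \<partial>lborel)"
    by (rule nn_integral_lborel_scaleR[OF _ r]) measurable
  also have "(\<integral>\<^sup>+x. h ((r / norm (r *\<^sub>R x)) *\<^sub>R (r *\<^sub>R x)) * indicator (ball 0 r - {0}) (r *\<^sub>R x) \<partial>lborel) = ?J"
    by (intro nn_integral_cong) (use r in \<open>auto simp: indicator_def\<close>)
  also have "ennreal (real DIM('a) / r) * (ennreal (r ^ DIM('a)) * ?J) = ennreal (r ^ (DIM('a) - 1)) * (ennreal (real DIM('a) / 1) * ?J)"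
  proof -
    have "real DIM('a) / r * r ^ DIM('a) = r ^ (DIM('a) - 1) * (real DIM('a) / 1)" unfolding n using r by (simp add: field_simps)
    then show ?thesis using r by (simp add: mult.assoc[symmetric] ennreal_mult'[symmetric])
  qed
  also have "ennreal (real DIM('a) / 1) * ?J = (\<integral>\<^sup>+x. h (r *\<^sub>R x) \<partial>sphere_measure 1)"
    using nn_integral_sphere_measure[OF zero_less_one measurable_restrict_space1[OF hr]] by simp
  finally show ?thesis .
qed

lemma sphere_measure_scale:
  assumes r: "r > 0"
  shows "sphere_measure r = scale_measure (ennreal (r ^ (DIM('a) - 1)))
    (distr (sphere_measure 1) (restrict_space borel (sphere 0 r)) (\<lambda>x::'a::euclidean_space. r *\<^sub>R x))" (is "_ = ?D")
proof (rule measure_eqI)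
  fix A :: "'a set" assume A: "A \<in> sets (sphere_measure r)"
  then have A': "A \<in> sets (restrict_space borel (sphere 0 r))" and "A \<in> sets borel" by (auto simp: sets_restrict_space_iff)
  have "emeasure (sphere_measure r) A = (\<integral>\<^sup>+x. indicator A x \<partial>sphere_measure r)" using A by simp
  also have "\<dots> = ennreal (r ^ (DIM('a) - 1)) * (\<integral>\<^sup>+x. indicator A (r *\<^sub>R x) \<partial>sphere_measure 1)"
    by (rule nn_integral_sphere_measure_scale[OF r]) (use \<open>A \<in> sets borel\<close> in simp)
  also have "(\<integral>\<^sup>+x. indicator A (r *\<^sub>R x) \<partial>sphere_measure 1)
      = (\<integral>\<^sup>+x. indicator A x \<partial>distr (sphere_measure 1) (restrict_space borel (sphere 0 r)) (\<lambda>x. r *\<^sub>R x))"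
    by (rule nn_integral_distr[symmetric, OF scaleR_sphere_measurable[OF r]]) (use A' in simp)
  finally show "emeasure (sphere_measure r) A = emeasure ?D A" using A' by simp
qed simp

lemma sphere_measure_integral:
  fixes h :: "'a::euclidean_space \<Rightarrow> real"
  assumes r: "r > 0" and h: "h \<in> borel_measurable (sphere_measure r)"
  shows "integrable (sphere_measure r) h \<longleftrightarrow> integrable (sphere_measure 1) (\<lambda>x. h (r *\<^sub>R x))"
    and "(LINT x|sphere_measure r. h x) = r ^ (DIM('a) - 1) * (LINT x|sphere_measure 1. h (r *\<^sub>R x))"
proof -
  let ?R = "restrict_space borel (sphere 0 r) :: 'a measure"
  have h': "h \<in> borel_measurable ?R" using h by (subst (asm) measurable_cong_sets[OF sets_sphere_measure refl])
  note s = scaleR_sphere_measurable[OF r, where 'a = 'a]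
  have rp: "r ^ (DIM('a) - 1) > 0" using r by simp
  have hd: "h \<in> borel_measurable (distr (sphere_measure 1) ?R (\<lambda>x. r *\<^sub>R x))" using h' by simp
  have e: "sphere_measure r = density (distr (sphere_measure 1) ?R (\<lambda>x. r *\<^sub>R x)) (\<lambda>_. ennreal (r ^ (DIM('a) - 1)))"
    by (subst sphere_measure_scale[OF r]) (rule scale_measure_eq_density)
  show "integrable (sphere_measure r) h \<longleftrightarrow> integrable (sphere_measure 1) (\<lambda>x. h (r *\<^sub>R x))"
    unfolding e using r integrable_distr_eq[OF s h']
    by (subst integrable_density[OF hd]) auto
  show "(LINT x|sphere_measure r. h x) = r ^ (DIM('a) - 1) * (LINT x|sphere_measure 1. h (r *\<^sub>R x))"
    unfolding e using r integral_distr[OF s h']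
    by (subst integral_density[OF hd]) auto
qed

lemma finite_measure_sphere_measure_1: "finite_measure (sphere_measure 1 :: 'a::euclidean_space measure)"
proof (rule finite_measureI)
  have "emeasure (sphere_measure 1) (space (sphere_measure 1 :: 'a measure)) = (\<integral>\<^sup>+x. 1 \<partial>(sphere_measure 1 :: 'a measure))"
    by simp
  also have "\<dots> = ennreal (real DIM('a) / 1) * (\<integral>\<^sup>+x. 1 * indicator (ball 0 1 - {0}) x \<partial>(lborel :: 'a measure))"
    by (rule nn_integral_sphere_measure) auto
  also have "\<dots> \<le> ennreal (real DIM('a)) * emeasure lborel (ball (0::'a) 1)"
    by (auto intro!: mult_left_mono emeasure_mono)
  also have "\<dots> < \<infinity>" using emeasure_lborel_ball_finite[of "0::'a" 1] by (simp add: ennreal_mult_less_top)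
  finally show "emeasure (sphere_measure 1) (space (sphere_measure 1 :: 'a measure)) \<noteq> \<infinity>" by simp
qed

definition radial_measure :: "nat \<Rightarrow> real measure" where
  "radial_measure d = density lborel (\<lambda>s. ennreal (s ^ (d - 1)) * indicator {0<..} s)"

lemma sets_radial_measure [simp, measurable_cong]: "sets (radial_measure d) = sets borel"
  by (simp add: radial_measure_def)

lemma sigma_finite_radial_measure: "sigma_finite_measure (radial_measure d)"
  unfolding radial_measure_def
  by (subst sigma_finite_measure.sigma_finite_iff_density_finite[OF sigma_finite_lborel]) (auto simp: ennreal_mult_eq_top_iff split: split_indicator)

lemma emeasure_radial_measure_lessThan:
  assumes d: "d > 0" and t: "t \<ge> 0"
  shows "emeasure (radial_measure d) {..<t} = ennreal (t ^ d / d)"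
proof -
  have "emeasure (radial_measure d) {..<t} = (\<integral>\<^sup>+s. ennreal (s ^ (d - 1)) * indicator {0<..} s * indicator {..<t} s \<partial>lborel)"
    unfolding radial_measure_def by (subst emeasure_density) auto
  also have "\<dots> = (\<integral>\<^sup>+s. ennreal (s ^ (d - 1)) * indicator {0..t} s \<partial>lborel)"
  proof (rule nn_integral_cong_AE)
    show "AE s in lborel. ennreal (s ^ (d - 1)) * indicator {0<..} s * indicator {..<t} s = ennreal (s ^ (d - 1)) * indicator {0..t} s"
      using AE_lborel_singleton[of 0] AE_lborel_singleton[of t]
      by eventually_elim (auto split: split_indicator)
  qed
  also have "\<dots> = ennreal (t ^ d / d - 0 ^ d / d)"
  proof (rule nn_integral_FTC_Icc)
    show "((\<lambda>s. s ^ d / d) has_real_derivative s ^ (d - 1)) (at s)" for s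
      using d by (auto intro!: derivative_eq_intros)
  qed (use t in auto)
  finally show ?thesis using d by (simp add: zero_power)
qed

definition polar_map :: "'a::euclidean_space \<Rightarrow> real \<times> 'a" where
  "polar_map x = (norm x, (1 / norm x) *\<^sub>R x)"

definition punctured :: "'a::euclidean_space measure" where
  "punctured = restrict_space lborel (- {0})"

lemma polar_map_measurable:
  "polar_map \<in> punctured \<rightarrow>\<^sub>M (borel \<Otimes>\<^sub>M (sphere_measure 1 :: 'a::euclidean_space measure))"
  unfolding polar_map_def[abs_def]
proof (rule measurable_Pair)
  show "norm \<in> borel_measurable (punctured :: 'a measure)"
    unfolding punctured_def by (rule measurable_restrict_space1) simp
  show "(\<lambda>x. (1 / norm x) *\<^sub>R x) \<in> punctured \<rightarrow>\<^sub>M (sphere_measure 1 :: 'a measure)"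
    unfolding punctured_def
    by (subst measurable_cong_sets[OF refl sets_sphere_measure], rule measurable_restrict_space2)
       (auto simp: space_restrict_space intro!: measurable_restrict_space1)
qed

text \<open>
  Polar coordinates. For a fixed set B of directions, both sides are measures
  in the radius alone, and it is enough to compare them on initial segments of the half line. There
  the claim is that the part of the cone over B in the ball of radius t has t^N times the volume of
  its part in the unit ball, which is the scaling of Lebesgue measure.
\<close>

lemma polar_decomposition:
  "radial_measure DIM('a) \<Otimes>\<^sub>M (sphere_measure 1 :: 'a::euclidean_space measure)
    = distr punctured (borel \<Otimes>\<^sub>M sphere_measure 1) polar_map"
proof (rule pair_measure_eqI)
  show "sigma_finite_measure (radial_measure DIM('a))" by (rule sigma_finite_radial_measure)
  show "sigma_finite_measure (sphere_measure 1 :: 'a measure)"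
    using finite_measure_sphere_measure_1 by (rule finite_measure.axioms(1))
  show "sets (radial_measure DIM('a) \<Otimes>\<^sub>M (sphere_measure 1 :: 'a measure))
      = sets (distr punctured (borel \<Otimes>\<^sub>M sphere_measure 1) polar_map)"
    by (simp cong: sets_pair_measure_cong)
  fix A B assume "A \<in> sets (radial_measure DIM('a))" and B': "B \<in> sets (sphere_measure 1 :: 'a measure)"
  then have A[measurable]: "A \<in> sets borel" by simp
  from B' have B[measurable]: "B \<in> sets borel" by (auto simp: sets_restrict_space_iff)
  define C where "C = {x::'a. x \<noteq> 0 \<and> (1 / norm x) *\<^sub>R x \<in> B}"
  have C[measurable]: "C \<in> sets borel" unfolding C_def by measurable
  define v where "v = (\<integral>\<^sup>+x. indicator C x * indicator (ball 0 1) x \<partial>(lborel :: 'a measure))"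
  have \<sigma>B: "emeasure (sphere_measure 1) B = ennreal (real DIM('a)) * v"
  proof -
    have "emeasure (sphere_measure 1) B = (\<integral>\<^sup>+x. indicator B x \<partial>sphere_measure 1)" using B' by simp
    also have "\<dots> = ennreal (real DIM('a) / 1) * (\<integral>\<^sup>+x. indicator B ((1 / norm x) *\<^sub>R x) * indicator (ball 0 1 - {0}) x \<partial>lborel)"
      by (rule nn_integral_sphere_measure) (use B' in auto)
    also have "(\<integral>\<^sup>+x. indicator B ((1 / norm x) *\<^sub>R x) * indicator (ball 0 1 - {0}) x \<partial>lborel) = v"
      unfolding v_def by (intro nn_integral_cong) (auto simp: C_def split: split_indicator)
    finally show ?thesis by simp
  qed
  have v_fin: "v < \<infinity>"
  proof -
    have "v \<le> (\<integral>\<^sup>+x. indicator (ball 0 1) x \<partial>(lborel :: 'a measure))"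
      unfolding v_def by (intro nn_integral_mono) (auto split: split_indicator)
    also have "\<dots> < \<infinity>" using emeasure_lborel_ball_finite[of "0::'a" 1] by simp
    finally show ?thesis .
  qed
  \<comment> \<open>The sign turns balls into upper half lines; these have finite measure and determine a measure.\<close>
  let ?M = "distr (density lborel (indicator C)) borel (\<lambda>x::'a. - norm x)"
  let ?N = "scale_measure (emeasure (sphere_measure 1) B) (distr (radial_measure DIM('a)) borel uminus)"
  have M: "emeasure ?M X = (\<integral>\<^sup>+x. indicator C x * indicator X (- norm x) \<partial>lborel)" if [measurable]: "X \<in> sets borel" for X
  proof -
    have "(\<lambda>x::'a. - norm x) -` X \<inter> space borel \<in> sets borel" by measurable
    then have [measurable]: "(\<lambda>x::'a. - norm x) -` X \<in> sets borel" by simp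
    have "emeasure ?M X = emeasure (density lborel (indicator C)) ((\<lambda>x::'a. - norm x) -` X)"
      by (subst emeasure_distr) auto
    also have "\<dots> = (\<integral>\<^sup>+x. indicator C x * indicator ((\<lambda>x::'a. - norm x) -` X) x \<partial>lborel)"
      by (rule emeasure_density) auto
    finally show ?thesis by (simp add: indicator_def)
  qed
  have N: "emeasure ?N X = emeasure (sphere_measure 1) B * emeasure (radial_measure DIM('a)) (uminus -` X)" if [measurable]: "X \<in> sets borel" for X
    by (simp add: emeasure_distr) (simp add: radial_measure_def)
  have Mi: "emeasure ?M {t<..} = (if t < 0 then ennreal ((- t) ^ DIM('a)) * v else 0)" for t
  proof (cases "t < 0")
    case True
    have "emeasure ?M {t<..} = (\<integral>\<^sup>+x. indicator C x * indicator {t<..} (- norm x) \<partial>lborel)" by (rule M) simp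
    also have "\<dots> = ennreal ((- t) ^ DIM('a)) * (\<integral>\<^sup>+x. indicator C ((- t) *\<^sub>R x) * indicator {t<..} (- norm ((- t) *\<^sub>R x)) \<partial>(lborel :: 'a measure))"
      by (rule nn_integral_lborel_scaleR) (use True in auto)
    also have "(\<integral>\<^sup>+x. indicator C ((- t) *\<^sub>R x) * indicator {t<..} (- norm ((- t) *\<^sub>R x)) \<partial>(lborel :: 'a measure)) = v"
      unfolding v_def
    proof (rule nn_integral_cong)
      fix x :: 'a
      have "(1 / norm ((- t) *\<^sub>R x)) *\<^sub>R ((- t) *\<^sub>R x) = (1 / norm x) *\<^sub>R x"
        using True by (simp add: field_simps)
      then have "(- t) *\<^sub>R x \<in> C \<longleftrightarrow> x \<in> C" using True by (simp add: C_def)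
      moreover have "- norm ((- t) *\<^sub>R x) \<in> {t<..} \<longleftrightarrow> x \<in> ball 0 1"
      proof -
        have "- norm ((- t) *\<^sub>R x) = t * norm x" using True by simp
        moreover have "t < t * norm x \<longleftrightarrow> norm x < 1" using True
          by (metis mult.right_neutral mult_less_cancel_left_neg)
        ultimately show ?thesis by simp
      qed
      ultimately show "(indicator C ((- t) *\<^sub>R x) * indicator {t<..} (- norm ((- t) *\<^sub>R x)) :: ennreal) = indicator C x * indicator (ball 0 1) x"
        by (simp add: indicator_def)
    qed
    finally show ?thesis using True by simp
  next
    case False
    have "emeasure ?M {t<..} = (\<integral>\<^sup>+x. indicator C x * indicator {t<..} (- norm x) \<partial>lborel)" by (rule M) simp
    also have "\<dots> = (\<integral>\<^sup>+x. 0 \<partial>(lborel :: 'a measure))"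
    proof (rule nn_integral_cong)
      fix x :: 'a
      have "- norm x \<notin> {t<..}" using False norm_ge_zero[of x] by (simp del: norm_ge_zero)
      then show "(indicator C x * indicator {t<..} (- norm x) :: ennreal) = 0" by simp
    qed
    finally show ?thesis using False by simp
  qed
  have eq: "?M = ?N"
  proof (rule measure_eqI_lessThan)
    show "emeasure ?M {t<..} < \<infinity>" for t unfolding Mi using v_fin by (simp add: ennreal_mult_less_top)
    show "emeasure ?M {t<..} = emeasure ?N {t<..}" for t
    proof (cases "t < 0")
      case True
      have "uminus -` {t<..} = {..< - t}" by auto
      then have "emeasure ?N {t<..} = ennreal (real DIM('a)) * v * ennreal ((- t) ^ DIM('a) / DIM('a))"
        using True by (subst N) (auto simp: \<sigma>B emeasure_radial_measure_lessThan)
      also have "\<dots> = ennreal (real DIM('a)) * ennreal ((- t) ^ DIM('a) / DIM('a)) * v" by (simp add: mult_ac)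
      also have "ennreal (real DIM('a)) * ennreal ((- t) ^ DIM('a) / DIM('a)) = ennreal ((- t) ^ DIM('a))"
        using True by (subst ennreal_mult[symmetric]) auto
      finally show ?thesis using True by (simp add: Mi)
    next
      case False
      have "emeasure (radial_measure DIM('a)) (uminus -` {t<..}) \<le> emeasure (radial_measure DIM('a)) {..<0}"
        using False by (intro emeasure_mono) auto
      also have "\<dots> = 0" by (subst emeasure_radial_measure_lessThan) (auto simp: zero_power)
      finally have "emeasure ?N {t<..} = 0" by (subst N) auto
      then show ?thesis using False Mi[of t] by (simp only: if_False)
    qed
  qed auto
  have uA: "uminus -` A \<in> sets borel"
  proof -
    have "uminus -` A \<inter> space borel \<in> sets borel" by measurable
    then show ?thesis by simp
  qed
  have "emeasure (radial_measure DIM('a)) A * emeasure (sphere_measure 1) B = emeasure ?N (uminus -` A)"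
    using N[OF uA] by (simp add: vimage_def mult.commute)
  also have "\<dots> = emeasure ?M (uminus -` A)" by (simp add: eq)
  also have "\<dots> = (\<integral>\<^sup>+x. indicator C x * indicator A (norm x) \<partial>lborel)"
    using M[OF uA] by (simp add: indicator_def)
  also have "\<dots> = (\<integral>\<^sup>+x. indicator (A \<times> B) (polar_map x) * indicator (- {0}) x \<partial>lborel)"
    by (intro nn_integral_cong) (auto simp: C_def polar_map_def split: split_indicator)
  also have "\<dots> = (\<integral>\<^sup>+x. indicator (A \<times> B) (polar_map x) \<partial>punctured)"
    unfolding punctured_def by (simp add: nn_integral_restrict_space)
  also have "\<dots> = (\<integral>\<^sup>+y. indicator (A \<times> B) y \<partial>distr punctured (borel \<Otimes>\<^sub>M sphere_measure 1) polar_map)"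
    by (rule nn_integral_distr[symmetric, OF polar_map_measurable], rule borel_measurable_indicator, unfold sets_distr, rule pair_measureI)
       (use A B' in auto)
  also have "\<dots> = emeasure (distr punctured (borel \<Otimes>\<^sub>M sphere_measure 1) polar_map) (A \<times> B)"
    using A B' by (intro nn_integral_indicator) auto
  finally show "emeasure (radial_measure DIM('a)) A * emeasure (sphere_measure 1) B
    = emeasure (distr punctured (borel \<Otimes>\<^sub>M sphere_measure 1) polar_map) (A \<times> B)" .
qed

lemma pair_sigma_finite_polar: "pair_sigma_finite (radial_measure d) (sphere_measure 1 :: 'a::euclidean_space measure)"
  using sigma_finite_radial_measure finite_measure_sphere_measure_1
  by (auto simp: pair_sigma_finite_def dest: finite_measure.axioms(1))

lemma polar_pair_measurable:
  fixes f :: "'a::euclidean_space \<Rightarrow> 'b::topological_space"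
  assumes "f \<in> borel_measurable borel"
  shows "(\<lambda>(s, \<omega>). f (s *\<^sub>R \<omega>)) \<in> borel_measurable (borel \<Otimes>\<^sub>M (sphere_measure 1 :: 'a measure))"
proof -
  have [measurable]: "(\<lambda>x::'a. x) \<in> sphere_measure 1 \<rightarrow>\<^sub>M borel" by (rule sphere_measure_measurable_borel) simp
  have "(\<lambda>p. fst p *\<^sub>R snd p) \<in> borel_measurable (borel \<Otimes>\<^sub>M (sphere_measure 1 :: 'a measure))" by measurable
  from measurable_compose[OF this assms] show ?thesis by (simp add: case_prod_unfold)
qed

lemma nn_integral_polar:
  fixes f :: "'a::euclidean_space \<Rightarrow> ennreal"
  assumes f: "f \<in> borel_measurable borel"
  shows "(\<integral>\<^sup>+x. f x \<partial>lborel) = (\<integral>\<^sup>+\<omega>. (\<integral>\<^sup>+s. f (s *\<^sub>R \<omega>) \<partial>radial_measure DIM('a)) \<partial>sphere_measure 1)"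
proof -
  note m = polar_pair_measurable[OF f]
  have m': "(\<lambda>(s, \<omega>). f (s *\<^sub>R \<omega>)) \<in> borel_measurable (radial_measure DIM('a) \<Otimes>\<^sub>M sphere_measure 1)"
    using m by (simp cong: measurable_cong_sets sets_pair_measure_cong)
  have "(\<integral>\<^sup>+x. f x \<partial>lborel) = (\<integral>\<^sup>+x. f x * indicator (- {0}) x \<partial>lborel)"
    using AE_lborel_singleton[of "0::'a"] by (intro nn_integral_cong_AE) (auto elim!: eventually_mono)
  also have "\<dots> = (\<integral>\<^sup>+x. f x \<partial>punctured)"
    unfolding punctured_def by (simp add: nn_integral_restrict_space)
  also have "\<dots> = (\<integral>\<^sup>+x. (\<lambda>(s, \<omega>). f (s *\<^sub>R \<omega>)) (polar_map x) \<partial>punctured)"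
    by (intro nn_integral_cong) (auto simp: polar_map_def punctured_def space_restrict_space)
  also have "\<dots> = (\<integral>\<^sup>+p. (\<lambda>(s, \<omega>). f (s *\<^sub>R \<omega>)) p \<partial>(radial_measure DIM('a) \<Otimes>\<^sub>M sphere_measure 1))"
    unfolding polar_decomposition by (rule nn_integral_distr[symmetric, OF polar_map_measurable]) (use m in simp)
  also have "\<dots> = (\<integral>\<^sup>+\<omega>. (\<integral>\<^sup>+s. f (s *\<^sub>R \<omega>) \<partial>radial_measure DIM('a)) \<partial>sphere_measure 1)"
    using pair_sigma_finite.nn_integral_snd[OF pair_sigma_finite_polar m'] by simp
  finally show ?thesis .
qed

text \<open>
  The integral over the direction is the outer one, so that the fundamental theorem of
  calculus can be applied on each ray.
\<close>

lemma integral_polar: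
  fixes f :: "'a::euclidean_space \<Rightarrow> real"
  assumes f: "integrable lborel f"
  shows "(LINT x|lborel. f x) = (LINT \<omega>|sphere_measure 1. (LINT s|radial_measure DIM('a). f (s *\<^sub>R \<omega>)))"
proof -
  have fb: "f \<in> borel_measurable borel" using f by auto
  note m = polar_pair_measurable[OF fb]
  have r: "(LINT x|lborel. f x) = (LINT x|punctured. f x)" "integrable punctured f"
  proof -
    have "(LINT x|lborel. f x) = (LINT x|lborel. indicator (- {0}) x *\<^sub>R f x)"
      using AE_lborel_singleton[of "0::'a"] fb by (intro integral_cong_AE) (auto elim!: eventually_mono)
    then show "(LINT x|lborel. f x) = (LINT x|punctured. f x)"
      unfolding punctured_def by (subst integral_restrict_space) auto
    show "integrable punctured f"
      unfolding punctured_def using integrable_mult_indicator[OF _ f, of "- {0}"]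
      by (subst integrable_restrict_space) auto
  qed
  have c: "(\<lambda>(s, \<omega>). f (s *\<^sub>R \<omega>)) (polar_map x) = f x" if "x \<in> space punctured" for x
    using that by (auto simp: polar_map_def punctured_def space_restrict_space)
  have i: "integrable (radial_measure DIM('a) \<Otimes>\<^sub>M sphere_measure 1) (\<lambda>(s, \<omega>::'a). f (s *\<^sub>R \<omega>))"
    unfolding polar_decomposition integrable_distr_eq[OF polar_map_measurable m]
    using r(2) by (rule Bochner_Integration.integrable_cong[THEN iffD1, rotated 2]) (auto simp: c)
  have "(LINT x|lborel. f x) = (LINT x|punctured. (\<lambda>(s, \<omega>). f (s *\<^sub>R \<omega>)) (polar_map x))"
    unfolding r(1) by (intro LINT_cong c[symmetric])
  also have "\<dots> = integral\<^sup>L (radial_measure DIM('a) \<Otimes>\<^sub>M sphere_measure 1) (\<lambda>(s, \<omega>::'a). f (s *\<^sub>R \<omega>))"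
    unfolding polar_decomposition by (rule integral_distr[symmetric, OF polar_map_measurable m])
  also have "\<dots> = (LINT \<omega>|sphere_measure 1. (LINT s|radial_measure DIM('a). f (s *\<^sub>R \<omega>)))"
    using pair_sigma_finite.integral_snd[OF pair_sigma_finite_polar i] by simp
  finally show ?thesis .
qed

section \<open>Transformation of Lebesgue measure under inversion\<close>

text \<open>
  The substitution s \<mapsto> 1/s, as an equality of two measures on the real line.
  Both are reflected to the negative axis, where the half lines above t have finite measure and
  determine the measure.
\<close>

lemma nn_integral_half_line_inverse:
  fixes g :: "real \<Rightarrow> ennreal"
  assumes [measurable]: "g \<in> borel_measurable borel"
  shows "(\<integral>\<^sup>+s. g s * indicator {0<..} s \<partial>lborel)
    = (\<integral>\<^sup>+s. g (inverse s) * ennreal (inverse s ^ 2) * indicator {0<..} s \<partial>lborel)"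
proof -
  let ?M = "distr (density lborel (indicator {0<..})) borel (uminus :: real \<Rightarrow> real)"
  let ?N = "distr (density lborel (\<lambda>s. ennreal (inverse s ^ 2) * indicator {0<..} s)) borel (\<lambda>s::real. - inverse s)"
  have M: "(\<integral>\<^sup>+s. h s \<partial>?M) = (\<integral>\<^sup>+s. indicator {0<..} s * h (- s) \<partial>lborel)"
    if [measurable]: "h \<in> borel_measurable borel" for h
    by (simp add: nn_integral_distr nn_integral_density)
  have N: "(\<integral>\<^sup>+s. h s \<partial>?N) = (\<integral>\<^sup>+s. ennreal (inverse s ^ 2) * indicator {0<..} s * h (- inverse s) \<partial>lborel)"
    if [measurable]: "h \<in> borel_measurable borel" for h
    by (simp add: nn_integral_distr nn_integral_density)
  have Mt: "emeasure ?M {t<..} = ennreal (max 0 (- t))" for t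
  proof -
    have "emeasure ?M {t<..} = (\<integral>\<^sup>+s. indicator {t<..} s \<partial>?M)" by simp
    also have "\<dots> = (\<integral>\<^sup>+s. indicator {0<..<-t} s \<partial>lborel)"
    proof (subst M)
      show "(\<integral>\<^sup>+s. indicator {0<..} s * indicator {t<..} (- s) \<partial>lborel) = (\<integral>\<^sup>+s. indicator {0<..<-t} s \<partial>lborel)"
        by (rule nn_integral_cong) (auto split: split_indicator)
    qed simp
    also have "\<dots> = ennreal (max 0 (- t))" by (simp add: max_def)
    finally show ?thesis .
  qed
  have Nt: "emeasure ?N {t<..} = ennreal (max 0 (- t))" for t
  proof (cases "t < 0")
    case True
    have "emeasure ?N {t<..} = (\<integral>\<^sup>+s. indicator {t<..} s \<partial>?N)" by simp
    also have "\<dots> = (\<integral>\<^sup>+s. ennreal (inverse s ^ 2) * indicator {0<..} s * indicator {t<..} (- inverse s) \<partial>lborel)"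
      by (rule N) simp
    also have "\<dots> = (\<integral>\<^sup>+s. ennreal (inverse s ^ 2) * indicator {- inverse t..} s \<partial>lborel)"
    proof (rule nn_integral_cong_AE)
      show "AE s in lborel. ennreal (inverse s ^ 2) * indicator {0<..} s * indicator {t<..} (- inverse s)
          = ennreal (inverse s ^ 2) * indicator {- inverse t..} s"
        using AE_lborel_singleton[of "- inverse t"]
      proof eventually_elim
        case (elim s)
        have p: "- inverse t > 0" using True by simp
        have "(s > 0 \<and> t < - inverse s) \<longleftrightarrow> - inverse t < s"
        proof (cases "s > 0")
          case s: True
          have "t < - inverse s \<longleftrightarrow> inverse s < - t" by auto
          also have "\<dots> \<longleftrightarrow> inverse (- t) < s"
            using s True by (metis inverse_inverse_eq inverse_less_iff_less inverse_positive_iff_positive neg_0_less_iff_less)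
          finally show ?thesis using s by simp
        next
          case False
          then show ?thesis using p by linarith
        qed
        then show ?case using elim by (auto split: split_indicator)
      qed
    qed
    also have "\<dots> = ennreal (0 - (- inverse (- inverse t)))"
    proof (rule nn_integral_FTC_atLeast)
      show "((\<lambda>s. - inverse s) has_real_derivative inverse x ^ 2) (at x)" if "- inverse t \<le> x" for x
      proof -
        have "0 < - inverse t" using True by simp
        then have "x \<noteq> 0" using that by linarith
        then show ?thesis by (auto intro!: derivative_eq_intros simp: power2_eq_square)
      qed
      have "((\<lambda>s::real. - inverse s) \<longlongrightarrow> - 0) at_top" by (intro tendsto_minus tendsto_inverse_0_at_top filterlim_ident)
      then show "((\<lambda>s::real. - inverse s) \<longlongrightarrow> 0) at_top" by simp
    qed auto
    finally show ?thesis using True by simp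
  next
    case False
    have "emeasure ?N {t<..} = (\<integral>\<^sup>+s. indicator {t<..} s \<partial>?N)" by simp
    also have "\<dots> = (\<integral>\<^sup>+s. ennreal (inverse s ^ 2) * indicator {0<..} s * indicator {t<..} (- inverse s) \<partial>lborel)"
      by (rule N) simp
    also have "\<dots> = (\<integral>\<^sup>+s. 0 \<partial>(lborel :: real measure))"
    proof (rule nn_integral_cong)
      fix s :: real
      have "\<not> (0 < s \<and> t < - inverse s)" using False inverse_positive_iff_positive[of s] by linarith
      then show "ennreal (inverse s ^ 2) * indicator {0<..} s * indicator {t<..} (- inverse s) = 0" by (auto simp: indicator_def)
    qed
    finally show ?thesis using False by simp
  qed
  have eq: "?M = ?N"
    by (rule measure_eqI_lessThan) (auto simp del: emeasure_distr simp: Mt Nt)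
  have "(\<integral>\<^sup>+s. g s * indicator {0<..} s \<partial>lborel) = (\<integral>\<^sup>+s. g (- s) \<partial>?M)"
    by (subst M) (auto simp: mult.commute)
  also have "\<dots> = (\<integral>\<^sup>+s. g (- s) \<partial>?N)" by (simp only: eq)
  also have "\<dots> = (\<integral>\<^sup>+s. g (inverse s) * ennreal (inverse s ^ 2) * indicator {0<..} s \<partial>lborel)"
    by (subst N) (auto simp: mult_ac)
  finally show ?thesis .
qed

definition inversion :: "'a::euclidean_space \<Rightarrow> 'a" where
  "inversion x = inverse ((norm x)^2) *\<^sub>R x"

lemma inversion_measurable [measurable]: "inversion \<in> borel_measurable borel"
  unfolding inversion_def[abs_def] by measurable

text \<open>
  The Jacobian of the inversion without derivatives: in polar coordinates the
  inversion is s \<mapsto> 1/s on each ray, and s^(N-1) ds becomes s^(-N-1) ds = s^(-2N) s^(N-1) ds.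
\<close>

lemma nn_integral_inversion:
  fixes f :: "'a::euclidean_space \<Rightarrow> ennreal"
  assumes f[measurable]: "f \<in> borel_measurable borel"
  shows "(\<integral>\<^sup>+x. f x \<partial>lborel) = (\<integral>\<^sup>+x. f (inversion x) * ennreal (inverse (norm x) ^ (2 * DIM('a))) \<partial>lborel)"
proof -
  let ?N = "DIM('a)"
  have "(\<integral>\<^sup>+x. f x \<partial>lborel) = (\<integral>\<^sup>+\<omega>. (\<integral>\<^sup>+s. f (s *\<^sub>R \<omega>) \<partial>radial_measure ?N) \<partial>sphere_measure 1)"
    by (rule nn_integral_polar) simp
  also have "\<dots> = (\<integral>\<^sup>+\<omega>. (\<integral>\<^sup>+s. f (inversion (s *\<^sub>R \<omega>)) * ennreal (inverse (norm (s *\<^sub>R \<omega>)) ^ (2 * ?N)) \<partial>radial_measure ?N) \<partial>sphere_measure 1)"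
  proof (rule nn_integral_cong)
    fix \<omega> :: 'a assume "\<omega> \<in> space (sphere_measure 1)"
    then have w: "norm \<omega> = 1" by simp
    have [measurable]: "(\<lambda>s. f (s *\<^sub>R \<omega>)) \<in> borel_measurable borel"
      by (rule measurable_compose[OF _ f]) measurable
    have "(\<integral>\<^sup>+s. f (s *\<^sub>R \<omega>) \<partial>radial_measure ?N) = (\<integral>\<^sup>+s. (ennreal (s ^ (?N - 1)) * f (s *\<^sub>R \<omega>)) * indicator {0<..} s \<partial>lborel)"
      unfolding radial_measure_def by (subst nn_integral_density) (auto intro!: nn_integral_cong simp: mult_ac)
    also have "\<dots> = (\<integral>\<^sup>+s. (ennreal (inverse s ^ (?N - 1)) * f (inverse s *\<^sub>R \<omega>)) * ennreal (inverse s ^ 2) * indicator {0<..} s \<partial>lborel)"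
      by (rule nn_integral_half_line_inverse) measurable
    also have "\<dots> = (\<integral>\<^sup>+s. ennreal (s ^ (?N - 1)) * indicator {0<..} s * (f (inversion (s *\<^sub>R \<omega>)) * ennreal (inverse (norm (s *\<^sub>R \<omega>)) ^ (2 * ?N))) \<partial>lborel)"
    proof (rule nn_integral_cong)
      fix s :: real
      show "(ennreal (inverse s ^ (?N - 1)) * f (inverse s *\<^sub>R \<omega>)) * ennreal (inverse s ^ 2) * indicator {0<..} s
        = ennreal (s ^ (?N - 1)) * indicator {0<..} s * (f (inversion (s *\<^sub>R \<omega>)) * ennreal (inverse (norm (s *\<^sub>R \<omega>)) ^ (2 * ?N)))"
      proof (cases "s > 0")
        case True
        have i: "inversion (s *\<^sub>R \<omega>) = inverse s *\<^sub>R \<omega>" using True w by (simp add: inversion_def power2_eq_square)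
        obtain n where n: "?N = Suc n" using DIM_positive[where 'a = 'a] by (metis gr0_implies_Suc)
        have "inverse s ^ n * inverse s ^ 2 = s ^ n * inverse s ^ (2 * Suc n)"
        proof -
          have "s ^ n * inverse s ^ (2 * Suc n) = (s ^ n * inverse s ^ n) * (inverse s ^ n * inverse s ^ 2)"
            by (simp add: power_add[symmetric] mult_2 mult_2_right power2_eq_square mult_ac)
          also have "s ^ n * inverse s ^ n = 1" using True by (simp add: power_mult_distrib[symmetric])
          finally show ?thesis by simp
        qed
        then have e: "ennreal (inverse s ^ n) * ennreal (inverse s ^ 2) = ennreal (s ^ n) * ennreal (inverse s ^ (2 * Suc n))"
          using True by (simp add: ennreal_mult[symmetric] del: power_Suc mult_Suc_right)
        have "(ennreal (inverse s ^ n) * f (inverse s *\<^sub>R \<omega>)) * ennreal (inverse s ^ 2)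
          = f (inverse s *\<^sub>R \<omega>) * (ennreal (inverse s ^ n) * ennreal (inverse s ^ 2))" by (simp only: mult_ac)
        also have "\<dots> = ennreal (s ^ n) * (f (inverse s *\<^sub>R \<omega>) * ennreal (inverse s ^ (2 * Suc n)))"
          unfolding e by (simp only: mult_ac)
        finally show ?thesis using True w i n by simp
      qed simp
    qed
    also have "\<dots> = (\<integral>\<^sup>+s. f (inversion (s *\<^sub>R \<omega>)) * ennreal (inverse (norm (s *\<^sub>R \<omega>)) ^ (2 * ?N)) \<partial>radial_measure ?N)"
      unfolding radial_measure_def by (subst nn_integral_density) auto
    finally show "(\<integral>\<^sup>+s. f (s *\<^sub>R \<omega>) \<partial>radial_measure ?N) =
      (\<integral>\<^sup>+s. f (inversion (s *\<^sub>R \<omega>)) * ennreal (inverse (norm (s *\<^sub>R \<omega>)) ^ (2 * ?N)) \<partial>radial_measure ?N)" .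
  qed
  also have "\<dots> = (\<integral>\<^sup>+x. f (inversion x) * ennreal (inverse (norm x) ^ (2 * DIM('a))) \<partial>lborel)"
    by (rule nn_integral_polar[symmetric]) measurable
  finally show ?thesis .
qed

lemma norm_inversion: "norm (inversion x) = inverse (norm x)"
  by (cases "x = 0") (auto simp: inversion_def power2_eq_square field_simps)

lemma inversion_inversion [simp]: "inversion (inversion x) = x"
  by (cases "x = 0") (auto simp: inversion_def power2_eq_square field_simps)

lemma inversion_eq_0_iff [simp]: "inversion x = 0 \<longleftrightarrow> x = 0"
  by (auto simp: inversion_def)

abbreviation inversion_density :: "'a::euclidean_space \<Rightarrow> real" where
  "inversion_density x \<equiv> inverse (norm x) ^ (2 * DIM('a))"

lemma lborel_eq_distr_inversion:
  "(lborel :: 'a::euclidean_space measure) = distr (density lborel inversion_density) lborel inversion"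
proof (rule measure_eqI)
  fix A :: "'a set" assume "A \<in> sets lborel"
  then have [measurable]: "A \<in> sets borel" by simp
  have "inversion -` A \<inter> space borel \<in> sets borel" by measurable
  then have [measurable]: "inversion -` A \<in> sets borel" by simp
  have "emeasure lborel A = (\<integral>\<^sup>+x. indicator A x \<partial>lborel)" by simp
  also have "\<dots> = (\<integral>\<^sup>+x. indicator A (inversion x) * ennreal (inversion_density x) \<partial>lborel)"
    by (rule nn_integral_inversion) simp
  also have "\<dots> = emeasure (density lborel inversion_density) (inversion -` A)"
    by (subst emeasure_density) (auto intro!: nn_integral_cong simp: indicator_def)
  also have "\<dots> = emeasure (distr (density lborel inversion_density) lborel inversion) A"
    by (subst emeasure_distr) auto
  finally show "emeasure lborel A = emeasure (distr (density lborel inversion_density) lborel inversion) A" .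
qed simp

text \<open>
  The Borel statement passes to the completion, because the density is positive
  almost everywhere and the null sets are therefore preserved.
\<close>

lemma lebesgue_eq_distr_inversion:
  "inversion \<in> lebesgue \<rightarrow>\<^sub>M (lebesgue :: 'a::euclidean_space measure)"
  "(lebesgue :: 'a measure) = distr (density lebesgue inversion_density) lebesgue inversion"
proof -
  let ?M = "density lborel (inversion_density :: 'a \<Rightarrow> real)"
  have D: "density lebesgue inversion_density = completion ?M"
    by (rule completion_density_eq[symmetric]) (use AE_lborel_singleton[of "0::'a"] in \<open>auto elim!: eventually_mono\<close>)
  have d: "distr (completion ?M) lborel inversion = (lborel :: 'a measure)"
    using distr_completion[of inversion ?M lborel] lborel_eq_distr_inversion[where 'a = 'a] by simp
  have m: "inversion \<in> completion ?M \<rightarrow>\<^sub>M (lborel :: 'a measure)" by (rule measurable_completion) simp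
  have "inversion \<in> completion ?M \<rightarrow>\<^sub>M (lebesgue :: 'a measure)"
    by (rule completion.measurable_completion2[OF m]) (simp add: d)
  moreover have "sets (completion ?M) = sets (lebesgue :: 'a measure)" by (simp add: D[symmetric])
  ultimately show "inversion \<in> lebesgue \<rightarrow>\<^sub>M (lebesgue :: 'a measure)" by (simp cong: measurable_cong_sets)
  show "(lebesgue :: 'a measure) = distr (density lebesgue inversion_density) lebesgue inversion"
    using completion.completion_distr_eq[OF m] by (simp add: d D)
qed

lemma integral_inversion_lebesgue:
  fixes f :: "'a::euclidean_space \<Rightarrow> real"
  assumes f: "f \<in> borel_measurable lebesgue"
  shows "integrable lebesgue f \<longleftrightarrow> integrable lebesgue (\<lambda>x. inversion_density x * f (inversion x))"
    and "(LINT x|lebesgue. f x) = (LINT x|lebesgue. inversion_density x * f (inversion x))"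
proof -
  have m: "inversion \<in> density lebesgue inversion_density \<rightarrow>\<^sub>M (lebesgue :: 'a measure)"
    using lebesgue_eq_distr_inversion(1) by (simp cong: measurable_cong_sets)
  have [measurable]: "(inversion_density :: 'a \<Rightarrow> real) \<in> borel_measurable lebesgue" by (rule measurable_completion) measurable
  have fi: "(\<lambda>x. f (inversion x)) \<in> borel_measurable lebesgue"
    by (rule measurable_compose[OF lebesgue_eq_distr_inversion(1) f])
  show "integrable lebesgue f \<longleftrightarrow> integrable lebesgue (\<lambda>x. inversion_density x * f (inversion x))"
    by (subst lebesgue_eq_distr_inversion(2), subst integrable_distr_eq[OF m f], subst integrable_density[OF fi]) auto
  show "(LINT x|lebesgue. f x) = (LINT x|lebesgue. inversion_density x * f (inversion x))"
    by (subst lebesgue_eq_distr_inversion(2), subst integral_distr[OF m f], subst integral_density[OF fi]) auto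
qed

lemma shell_sets [simp]: "shell a b \<in> sets borel" "open (shell a b)"
proof -
  show "open (shell a b)" unfolding shell_def by (intro open_Collect_conj open_Collect_less continuous_intros)
  then show "shell a b \<in> sets borel" by (rule borel_open)
qed

lemma inversion_shell_iff:
  assumes "0 < e" "e < 1"
  shows "inversion x \<in> shell e 1 \<longleftrightarrow> x \<in> shell 1 (1 / e)"
proof (cases "x = 0")
  case False
  then have "norm x > 0" by simp
  then show ?thesis using assms by (auto simp: shell_def norm_inversion field_simps)
qed (use assms in \<open>auto simp: shell_def norm_inversion\<close>)

lemma borel_measurable_inversion_shell:
  fixes f :: "'a::euclidean_space \<Rightarrow> 'b::euclidean_space"
  assumes e: "0 < e" "e < 1" and f: "f \<in> borel_measurable (lebesgue_on (shell e 1))"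
  shows "(\<lambda>x. f (inversion x)) \<in> borel_measurable (lebesgue_on (shell 1 (1 / e)))"
proof -
  have "(\<lambda>x. if x \<in> shell e 1 then f x else 0) \<in> borel_measurable lebesgue"
    using f by (subst borel_measurable_if) auto
  from measurable_compose[OF lebesgue_eq_distr_inversion(1) this] show ?thesis
    unfolding inversion_shell_iff[OF e] by (subst (asm) borel_measurable_if) auto
qed

lemma integral_inversion_shell:
  fixes f :: "'a::euclidean_space \<Rightarrow> real"
  assumes e: "0 < e" "e < 1" and f: "f \<in> borel_measurable (lebesgue_on (shell e 1))"
  shows "integrable (lebesgue_on (shell e 1)) f \<longleftrightarrow>
      integrable (lebesgue_on (shell 1 (1 / e))) (\<lambda>x. inversion_density x * f (inversion x))"
    and "(LINT x|lebesgue_on (shell e 1). f x) =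
      (LINT x|lebesgue_on (shell 1 (1 / e)). inversion_density x * f (inversion x))"
proof -
  let ?f = "\<lambda>x. if x \<in> shell e 1 then f x else 0"
  let ?J = "\<lambda>x. inversion_density x * f (inversion x)"
  have m: "?f \<in> borel_measurable lebesgue" using f by (subst borel_measurable_if) auto
  have eq: "(\<lambda>x. inversion_density x * ?f (inversion x)) = (\<lambda>x. if x \<in> shell 1 (1 / e) then ?J x else 0)"
    unfolding inversion_shell_iff[OF e] by auto
  note r = Lebesgue_Measure.integrable_restrict_UNIV Lebesgue_Measure.integral_restrict_UNIV
  show "integrable (lebesgue_on (shell e 1)) f \<longleftrightarrow> integrable (lebesgue_on (shell 1 (1 / e))) ?J"
    using integral_inversion_lebesgue(1)[OF m] unfolding eq by (simp add: r)
  show "(LINT x|lebesgue_on (shell e 1). f x) = (LINT x|lebesgue_on (shell 1 (1 / e)). ?J x)"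
    using integral_inversion_lebesgue(2)[OF m] unfolding eq by (simp add: r)
qed

section \<open>Integration along rays\<close>

lemma AE_not_norm_eq: "AE x in lborel. norm (x::'a::euclidean_space) \<noteq> r"
proof -
  have "sphere (0::'a) r \<in> null_sets lebesgue" using negligible_sphere[of "0::'a" r] by (simp add: negligible_iff_null_sets)
  then have "AE x in lebesgue. x \<notin> sphere (0::'a) r" by (rule AE_not_in)
  then show ?thesis by (simp add: AE_completion_iff)
qed

text \<open>
  The divergence theorem for the radial field on an annulus. On the ray in direction
  \<omega> the weight |x|^(-N) cancels the factor s^(N-1) of polar coordinates and the length of x = s \<omega>, so
  the integrand is the derivative of s \<mapsto> F (s \<omega>).
\<close>

lemma integral_annulus_radial_derivative:
  fixes F :: "'a::euclidean_space \<Rightarrow> real"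
  assumes ab: "0 < a" "a < b"
    and F: "\<And>x. a \<le> norm x \<Longrightarrow> norm x \<le> b \<Longrightarrow> (F has_derivative (\<lambda>h. D x \<bullet> h)) (at x)"
    and D: "continuous_on {x. a \<le> norm x \<and> norm x \<le> b} D"
  shows "integrable (lebesgue_on (shell a b)) (\<lambda>x. (D x \<bullet> x) / norm x ^ DIM('a))"
    and "(LINT x|lebesgue_on (shell a b). (D x \<bullet> x) / norm x ^ DIM('a))
      = (LINT \<omega>|sphere_measure 1. F (b *\<^sub>R \<omega>) - F (a *\<^sub>R \<omega>))"
proof -
  let ?C = "{x::'a. a \<le> norm x \<and> norm x \<le> b}"
  let ?g = "\<lambda>x. (D x \<bullet> x) / norm x ^ DIM('a)"
  have C: "compact ?C"
  proof -
    have "?C = cball 0 b - ball 0 a" by auto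
    then show ?thesis by (simp add: compact_diff)
  qed
  have Cs: "?C \<in> sets borel" using C by (simp add: borel_compact)
  have g: "continuous_on ?C ?g" by (intro continuous_intros D) (use ab in auto)
  define h where "h x = indicator ?C x *\<^sub>R ?g x" for x
  define k where "k x = indicator (shell a b) x *\<^sub>R ?g x" for x
  have h: "integrable lborel h" unfolding h_def[abs_def] using borel_integrable_compact[OF C g] by simp
  have km: "k \<in> borel_measurable borel" unfolding k_def[abs_def]
    by (rule borel_measurable_continuous_on_indicator[OF shell_sets(1)])
       (rule continuous_on_subset[OF g], auto simp: shell_def)
  have hk: "AE x in lborel. h x = k x"
    using AE_not_norm_eq[of a] AE_not_norm_eq[of b]
    by eventually_elim (auto simp: h_def k_def shell_def indicator_def)
  have k: "integrable lborel k"
    by (rule integrable_cong_AE_imp[OF h]) (use km hk in \<open>auto elim: eventually_mono\<close>)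
  have ke: "k = (\<lambda>x. if x \<in> shell a b then ?g x else 0)" by (auto simp: k_def)
  note e = lebesgue_on_eq_lborel_extension[OF shell_sets(1), of a b ?g, folded ke, OF km]
  show "integrable (lebesgue_on (shell a b)) ?g" using e(1) k by simp
  have "(LINT x|lebesgue_on (shell a b). ?g x) = (LINT x|lborel. k x)" by (rule e(2))
  also have "\<dots> = (LINT x|lborel. h x)" by (rule integral_cong_AE) (use km h hk in \<open>auto elim: eventually_mono\<close>)
  also have "\<dots> = (LINT \<omega>|sphere_measure 1. (LINT s|radial_measure DIM('a). h (s *\<^sub>R \<omega>)))" by (rule integral_polar[OF h])
  also have "\<dots> = (LINT \<omega>|sphere_measure 1. F (b *\<^sub>R \<omega>) - F (a *\<^sub>R \<omega>))"
  proof (intro LINT_cong)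
    fix \<omega> :: 'a assume "\<omega> \<in> space (sphere_measure 1)"
    then have w: "norm \<omega> = 1" by simp
    have hb: "h \<in> borel_measurable borel" using h by auto
    have [measurable]: "(\<lambda>s. h (s *\<^sub>R \<omega>)) \<in> borel_measurable borel"
      by (rule measurable_compose[OF _ hb]) measurable
    have rm: "radial_measure DIM('a) = density lborel (\<lambda>s. ennreal (s ^ (DIM('a) - 1) * indicator {0<..} s))"
      unfolding radial_measure_def by (rule density_cong) (auto split: split_indicator)
    have "(LINT s|radial_measure DIM('a). h (s *\<^sub>R \<omega>)) = (LINT s|lborel. (s ^ (DIM('a) - 1) * indicator {0<..} s) *\<^sub>R h (s *\<^sub>R \<omega>))"
      unfolding rm by (rule integral_density) (auto split: split_indicator)
    also have "\<dots> = (LINT s|lborel. indicator {a..b} s *\<^sub>R (D (s *\<^sub>R \<omega>) \<bullet> \<omega>))"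
    proof (intro LINT_cong)
      fix s :: real
      show "(s ^ (DIM('a) - 1) * indicator {0<..} s) *\<^sub>R h (s *\<^sub>R \<omega>) = indicator {a..b} s *\<^sub>R (D (s *\<^sub>R \<omega>) \<bullet> \<omega>)"
      proof (cases "s > 0")
        case True
        obtain n where n: "DIM('a) = Suc n" using DIM_positive[where 'a = 'a] by (metis gr0_implies_Suc)
        show ?thesis using True w by (auto simp: h_def indicator_def n)
      next
        case False
        then show ?thesis using ab by (auto simp: indicator_def)
      qed
    qed
    also have "\<dots> = F (b *\<^sub>R \<omega>) - F (a *\<^sub>R \<omega>)"
    proof (rule has_bochner_integral_integral_eq, rule has_bochner_integral_FTC_Icc)
      show "a \<le> b" using ab by simp
      fix s assume s: "a \<le> s" "s \<le> b"
      have "((\<lambda>s. F (s *\<^sub>R \<omega>)) has_derivative (\<lambda>t. D (s *\<^sub>R \<omega>) \<bullet> (t *\<^sub>R \<omega>))) (at s)"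
        by (rule has_derivative_compose[of "\<lambda>s. s *\<^sub>R \<omega>" "\<lambda>t. t *\<^sub>R \<omega>" s UNIV F])
           (use F[of "s *\<^sub>R \<omega>"] s w ab in \<open>auto intro!: derivative_eq_intros\<close>)
      then have "((\<lambda>s. F (s *\<^sub>R \<omega>)) has_vector_derivative (D (s *\<^sub>R \<omega>) \<bullet> \<omega>)) (at s)"
        by (simp add: has_vector_derivative_def)
      then show "((\<lambda>s. F (s *\<^sub>R \<omega>)) has_vector_derivative (D (s *\<^sub>R \<omega>) \<bullet> \<omega>)) (at s within {a..b})"
        by (rule has_vector_derivative_at_within)
    next
      show "continuous_on {a..b} (\<lambda>s. D (s *\<^sub>R \<omega>) \<bullet> \<omega>)"
        by (intro continuous_intros continuous_on_compose2[OF D]) (use w ab in auto)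
    qed
    finally show "(LINT s|radial_measure DIM('a). h (s *\<^sub>R \<omega>)) = F (b *\<^sub>R \<omega>) - F (a *\<^sub>R \<omega>)" .
  qed
  finally show "(LINT x|lebesgue_on (shell a b). ?g x) = (LINT \<omega>|sphere_measure 1. F (b *\<^sub>R \<omega>) - F (a *\<^sub>R \<omega>))" .
qed

section \<open>Traces on spheres\<close>

text \<open>
  Multiply f^2 by a cut-off \<eta> that is linear in |x|, vanishes on the inner
  sphere and is 1 on the outer sphere. The radial derivative of \<eta> f^2 is bounded by a multiple of f^2 + |\<nabla>f|^2, and its
  integral along rays is f^2 on the outer sphere.
\<close>

lemma trace_inequality_inner:
  fixes f :: "'a::euclidean_space \<Rightarrow> real"
  assumes ar: "0 < a" "a < r" and f: "smooth_on \<Omega> f" and sub: "{x. a \<le> norm x \<and> norm x \<le> r} \<subseteq> \<Omega>"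
    and i: "integrable (lebesgue_on (shell a r)) (\<lambda>x. (f x)^2 + (norm (grad f x))^2)"
  shows "(LINT x|sphere_measure 1. (f (r *\<^sub>R x))^2) \<le>
    inverse a ^ (DIM('a) - 1) * (1 / (r - a) + 1) * (LINT x|lebesgue_on (shell a r). (f x)^2 + (norm (grad f x))^2)"
proof -
  let ?C = "{x::'a. a \<le> norm x \<and> norm x \<le> r}"
  define \<eta> where "\<eta> x = (norm x - a) / (r - a)" for x :: 'a
  define F where "F x = \<eta> x * (f x)^2" for x
  define D where "D x = ((f x)^2 / (r - a)) *\<^sub>R sgn x + (2 * \<eta> x * f x) *\<^sub>R grad f x" for x
  have C0: "x \<noteq> 0" if "x \<in> ?C" for x using that ar by auto
  have F: "(F has_derivative (\<lambda>h. D x \<bullet> h)) (at x)" if "a \<le> norm x" "norm x \<le> r" for x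
  proof -
    have x: "x \<in> \<Omega>" "x \<noteq> 0" using that sub ar by auto
    have n: "(norm has_derivative (\<lambda>h. h \<bullet> sgn x)) (at x)" by (rule has_derivative_norm[OF x(2)])
    have \<eta>: "(\<eta> has_derivative (\<lambda>h. (h \<bullet> sgn x) / (r - a))) (at x)"
      unfolding \<eta>_def[abs_def] using ar by (auto intro!: derivative_eq_intros n)
    have "(F has_derivative (\<lambda>h. \<eta> x * (2 * f x * (grad f x \<bullet> h)) + (h \<bullet> sgn x) / (r - a) * (f x)^2)) (at x)"
      unfolding F_def[abs_def]
      by (rule has_derivative_mult[OF \<eta>])
         (use has_derivative_power[OF smooth_on_has_derivative[OF f x(1)], of 2] in \<open>simp add: mult_ac\<close>)
    then show ?thesis
      by (rule has_derivative_eq_rhs) (auto simp: D_def inner_add_left inner_commute[of _ "sgn x"] mult_ac)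
  qed
  have cD: "continuous_on ?C D"
    unfolding D_def \<eta>_def sgn_div_norm
    by (intro continuous_intros continuous_on_subset[OF smooth_on_continuous[OF f] sub]
          continuous_on_subset[OF smooth_on_continuous_grad[OF f] sub])
       (use ar in auto)
  note div = integral_annulus_radial_derivative[OF ar F cD]
  let ?K = "inverse a ^ (DIM('a) - 1) * (1 / (r - a) + 1)"
  have "(LINT x|sphere_measure 1. (f (r *\<^sub>R x))^2) = (LINT x|sphere_measure 1. F (r *\<^sub>R x) - F (a *\<^sub>R x))"
    by (intro LINT_cong) (use ar in \<open>auto simp: F_def \<eta>_def\<close>)
  also have "\<dots> = (LINT x|lebesgue_on (shell a r). (D x \<bullet> x) / norm x ^ DIM('a))" by (rule div(2)[symmetric])
  also have "\<dots> \<le> (LINT x|lebesgue_on (shell a r). ?K * ((f x)^2 + (norm (grad f x))^2))"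
  proof (rule integral_mono[OF div(1)])
    show "integrable (lebesgue_on (shell a r)) (\<lambda>x. ?K * ((f x)^2 + (norm (grad f x))^2))" using i by simp
    fix x :: 'a assume "x \<in> space (lebesgue_on (shell a r))"
    then have x: "a < norm x" "norm x < r" by (auto simp: shell_def)
    have \<eta>: "0 \<le> \<eta> x" "\<eta> x \<le> 1" using x ar by (auto simp: \<eta>_def)
    have x0: "norm x > 0" using x ar by linarith
    obtain n where n: "DIM('a) = Suc n" using DIM_positive[where 'a = 'a] by (metis gr0_implies_Suc)
    let ?S = "(f x)^2 + (norm (grad f x))^2"
    have 1: "2 * f x * (grad f x \<bullet> x) \<le> ?S * norm x"
    proof -
      have "2 * f x * (grad f x \<bullet> x) \<le> 2 * \<bar>f x\<bar> * \<bar>grad f x \<bullet> x\<bar>"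
        by (metis abs_ge_self abs_mult abs_numeral)
      also have "\<dots> \<le> 2 * \<bar>f x\<bar> * (norm (grad f x) * norm x)"
        by (intro mult_left_mono Cauchy_Schwarz_ineq2) auto
      also have "\<dots> = (2 * \<bar>f x\<bar> * norm (grad f x)) * norm x" by simp
      also have "\<dots> \<le> ?S * norm x"
        using sum_squares_bound[of "\<bar>f x\<bar>" "norm (grad f x)"] by (intro mult_right_mono) auto
      finally show ?thesis .
    qed
    have "D x \<bullet> x = (f x)^2 / (r - a) * norm x + \<eta> x * (2 * f x * (grad f x \<bullet> x))"
      using x0 by (simp add: D_def inner_add_left sgn_div_norm dot_square_norm power2_eq_square mult_ac)
    also have "\<dots> \<le> ?S / (r - a) * norm x + 1 * (?S * norm x)"
    proof (rule add_mono)
      show "(f x)^2 / (r - a) * norm x \<le> ?S / (r - a) * norm x"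
        using ar by (intro mult_right_mono divide_right_mono) auto
      have "\<eta> x * (2 * f x * (grad f x \<bullet> x)) \<le> \<eta> x * (?S * norm x)" by (rule mult_left_mono[OF 1 \<eta>(1)])
      also have "\<dots> \<le> 1 * (?S * norm x)" by (rule mult_right_mono[OF \<eta>(2)]) simp
      finally show "\<eta> x * (2 * f x * (grad f x \<bullet> x)) \<le> 1 * (?S * norm x)" .
    qed
    also have "\<dots> = (1 / (r - a) + 1) * ?S * norm x" by (simp add: distrib_right)
    finally have "(D x \<bullet> x) / norm x ^ DIM('a) \<le> (1 / (r - a) + 1) * ?S * norm x / norm x ^ DIM('a)"
      by (rule divide_right_mono) simp
    also have "\<dots> = inverse (norm x) ^ n * ((1 / (r - a) + 1) * ?S)" using x0 by (simp add: n field_simps)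
    also have "\<dots> \<le> inverse a ^ n * ((1 / (r - a) + 1) * ?S)"
    proof (rule mult_right_mono)
      show "inverse (norm x) ^ n \<le> inverse a ^ n" using x ar by (intro power_mono le_imp_inverse_le) auto
      show "0 \<le> (1 / (r - a) + 1) * ?S" using ar by (intro mult_nonneg_nonneg add_nonneg_nonneg) auto
    qed
    finally show "(D x \<bullet> x) / norm x ^ DIM('a) \<le> ?K * ?S" by (simp add: n mult_ac)
  qed
  also have "\<dots> = ?K * (LINT x|lebesgue_on (shell a r). (f x)^2 + (norm (grad f x))^2)" by simp
  finally show ?thesis .
qed

lemma continuous_sphere_L2:
  fixes f :: "'a::euclidean_space \<Rightarrow> real"
  assumes r: "r > 0" and f: "continuous_on (sphere 0 r) f"
  shows "f \<in> L2_space (sphere_measure r)"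
proof (rule L2_spaceI)
  have m: "g \<in> borel_measurable (sphere_measure r)" if "continuous_on (sphere 0 r) g" for g :: "'a \<Rightarrow> real"
    by (subst measurable_cong_sets[OF sets_sphere_measure refl]) (rule borel_measurable_continuous_on_restrict[OF that])
  show "f \<in> borel_measurable (sphere_measure r)" by (rule m[OF f])
  have f2: "continuous_on (sphere 0 r) (\<lambda>x. (norm (f x))^2)" by (intro continuous_intros f)
  have "bounded ((\<lambda>x. (norm (f x))^2) ` sphere 0 r)"
    by (rule compact_imp_bounded[OF compact_continuous_image[OF f2]]) simp
  then obtain B where B: "\<And>x. x \<in> sphere 0 r \<Longrightarrow> norm ((norm (f x))^2) \<le> B" unfolding bounded_iff by blast
  show "integrable (sphere_measure r) (\<lambda>x. (norm (f x))^2)"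
    unfolding sphere_measure_integral(1)[OF r m[OF f2]]
  proof (rule finite_measure.integrable_const_bound[OF finite_measure_sphere_measure_1])
    show "(\<lambda>x. (norm (f (r *\<^sub>R x)))^2) \<in> borel_measurable (sphere_measure 1)"
      by (rule measurable_compose[OF scaleR_sphere_measurable[OF r] borel_measurable_continuous_on_restrict[OF f2]])
    show "AE x in sphere_measure 1. norm ((norm (f (r *\<^sub>R x)))^2) \<le> B"
      by (rule AE_I2, rule B) (use r in auto)
  qed
qed

definition smooth_H1 :: "'a::euclidean_space set \<Rightarrow> ('a \<Rightarrow> real) \<Rightarrow> bool" where
  "smooth_H1 S f \<longleftrightarrow> smooth_on S f \<and> f \<in> L2_space (lebesgue_on S) \<and> grad f \<in> L2_space (lebesgue_on S)"

lemma trace_inequality: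
  assumes r: "r > 0" and \<delta>: "\<delta> > 0"
  shows "\<exists>K\<ge>0. \<forall>g :: 'a::euclidean_space \<Rightarrow> real. smooth_H1 (shell (r - \<delta>) (r + \<delta>)) g \<longrightarrow>
       (LINT x|sphere_measure r. (norm (g x))^2) \<le>
       K * ((LINT x|lebesgue_on (shell (r - \<delta>) (r + \<delta>)). (norm (g x))^2)
          + (LINT x|lebesgue_on (shell (r - \<delta>) (r + \<delta>)). (norm (grad g x))^2))"
proof -
  \<comment> \<open>The maximum keeps the inner radius positive also when the neighbourhood contains the origin.\<close>
  define a where "a = max (r / 2) (r - \<delta> / 2)"
  have a: "0 < a" "a < r" "r - \<delta> < a" using r \<delta> by (auto simp: a_def)
  let ?S = "shell (r - \<delta>) (r + \<delta>) :: 'a set"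
  have sub: "shell a r \<subseteq> ?S" "{x. a \<le> norm x \<and> norm x \<le> r} \<subseteq> ?S" using a \<delta> by (auto simp: shell_def)
  define K where "K = r ^ (DIM('a) - 1) * (inverse a ^ (DIM('a) - 1) * (1 / (r - a) + 1))"
  have K: "K \<ge> 0" using a r by (auto simp: K_def intro!: mult_nonneg_nonneg add_nonneg_nonneg)
  show ?thesis
  proof (intro exI[of _ K] conjI allI impI K)
    fix g :: "'a \<Rightarrow> real" assume "smooth_H1 ?S g"
    then have g: "smooth_on ?S g" "g \<in> L2_space (lebesgue_on ?S)" "grad g \<in> L2_space (lebesgue_on ?S)"
      by (auto simp: smooth_H1_def)
    have i: "integrable (lebesgue_on (shell a r)) (\<lambda>x. (norm (g x))^2)" "integrable (lebesgue_on (shell a r)) (\<lambda>x. (norm (grad g x))^2)"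
      using L2_spaceD(2)[OF L2_space_lebesgue_on_subset[OF g(2) sub(1)]] L2_spaceD(2)[OF L2_space_lebesgue_on_subset[OF g(3) sub(1)]] by auto
    have gs: "continuous_on (sphere 0 r) g"
      by (rule continuous_on_subset[OF smooth_on_continuous[OF g(1)]]) (use \<delta> in \<open>auto simp: shell_def\<close>)
    have m: "(\<lambda>x. (norm (g x))^2) \<in> borel_measurable (sphere_measure r)"
      using L2_spaceD(2)[OF continuous_sphere_L2[OF r gs]] by auto
    have "(LINT x|sphere_measure r. (norm (g x))^2) = r ^ (DIM('a) - 1) * (LINT x|sphere_measure 1. (g (r *\<^sub>R x))^2)"
      using sphere_measure_integral(2)[OF r m] by simp
    also have "\<dots> \<le> r ^ (DIM('a) - 1) * (inverse a ^ (DIM('a) - 1) * (1 / (r - a) + 1) *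
        (LINT x|lebesgue_on (shell a r). (g x)^2 + (norm (grad g x))^2))"
      by (intro mult_left_mono trace_inequality_inner[OF a(1,2) g(1) sub(2)]) (use i r in auto)
    also have "\<dots> = K * ((LINT x|lebesgue_on (shell a r). (norm (g x))^2) + (LINT x|lebesgue_on (shell a r). (norm (grad g x))^2))"
      using i by (simp add: K_def)
    also have "\<dots> \<le> K * ((LINT x|lebesgue_on ?S. (norm (g x))^2) + (LINT x|lebesgue_on ?S. (norm (grad g x))^2))"
      by (intro mult_left_mono add_mono K integral_mono_lebesgue_on_AE L2_spaceD(2) g(2,3)) (use sub in auto)
    finally show "(LINT x|sphere_measure r. (norm (g x))^2) \<le> K * ((LINT x|lebesgue_on ?S. (norm (g x))^2)
          + (LINT x|lebesgue_on ?S. (norm (grad g x))^2))" .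
  qed
qed

lemma smooth_on_diff:
  assumes "open S" "smooth_on S f" "smooth_on S g"
  shows "smooth_on S (\<lambda>x. f x - g x)"
proof -
  have "Ck_on k S (\<lambda>x. f x + (- 1) * g x)" for k
    using assms by (intro Ck_on_add Ck_on_mult Ck_on_const) (auto simp: smooth_on_def)
  then show ?thesis by (simp add: smooth_on_def)
qed

lemma grad_diff:
  fixes f g :: "'a::euclidean_space \<Rightarrow> real"
  assumes "smooth_on S f" "smooth_on S g" "x \<in> S"
  shows "grad (\<lambda>x. f x - g x) x = grad f x - grad g x"
  using has_derivative_diff[OF smooth_on_has_derivative[OF assms(1,3)] smooth_on_has_derivative[OF assms(2,3)]]
  by (intro grad_eqI) (simp add: inner_diff_left)

lemma L2_space_cong:
  assumes "\<And>x. x \<in> space M \<Longrightarrow> f x = g x" "f \<in> L2_space M"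
  shows "g \<in> L2_space M"
proof (rule L2_spaceI)
  show "g \<in> borel_measurable M" using measurable_cong[of M f g borel] assms L2_spaceD(1)[OF assms(2)] by auto
  show "integrable M (\<lambda>x. (norm (g x))^2)"
    using L2_spaceD(2)[OF assms(2)] Bochner_Integration.integrable_cong[OF refl, of M "\<lambda>x. (norm (f x))^2" "\<lambda>x. (norm (g x))^2"] assms(1)
    by auto
qed

lemma trace_diff_inequality:
  assumes r: "r > 0" and \<delta>: "\<delta> > 0"
  shows "\<exists>K\<ge>0. \<forall>f g :: 'a::euclidean_space \<Rightarrow> real.
       smooth_H1 (shell (r - \<delta>) (r + \<delta>)) f \<longrightarrow> smooth_H1 (shell (r - \<delta>) (r + \<delta>)) g \<longrightarrow>
       L2_dist2 (sphere_measure r) f g \<le>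
       K * (L2_dist2 (lebesgue_on (shell (r - \<delta>) (r + \<delta>))) f g
          + L2_dist2 (lebesgue_on (shell (r - \<delta>) (r + \<delta>))) (grad f) (grad g))"
proof -
  let ?S = "shell (r - \<delta>) (r + \<delta>) :: 'a set"
  obtain K where K: "K \<ge> 0" and tr: "\<forall>g :: 'a \<Rightarrow> real. smooth_H1 ?S g \<longrightarrow>
       (LINT x|sphere_measure r. (norm (g x))^2) \<le>
       K * ((LINT x|lebesgue_on ?S. (norm (g x))^2) + (LINT x|lebesgue_on ?S. (norm (grad g x))^2))"
    using trace_inequality[OF r \<delta>, where 'a = 'a] by blast
  show ?thesis
  proof (intro exI[of _ K] conjI allI impI K)
    fix f g :: "'a \<Rightarrow> real"
    assume "smooth_H1 ?S f" "smooth_H1 ?S g"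
    then have f: "smooth_on ?S f" and g: "smooth_on ?S g"
      and L: "f \<in> L2_space (lebesgue_on ?S)" "g \<in> L2_space (lebesgue_on ?S)"
        "grad f \<in> L2_space (lebesgue_on ?S)" "grad g \<in> L2_space (lebesgue_on ?S)"
      by (auto simp: smooth_H1_def)
    have gd: "grad f x - grad g x = grad (\<lambda>x. f x - g x) x" if "x \<in> ?S" for x
      by (rule grad_diff[OF f g that, symmetric])
    have "grad (\<lambda>x. f x - g x) \<in> L2_space (lebesgue_on ?S)"
      by (rule L2_space_cong[OF _ L2_space_diff[OF L(3,4)]]) (simp add: gd)
    then have "smooth_H1 ?S (\<lambda>x. f x - g x)"
      using smooth_on_diff[OF shell_sets(2) f g] L2_space_diff[OF L(1,2)] by (simp add: smooth_H1_def)
    then have "L2_dist2 (sphere_measure r) f g \<le> K * (L2_dist2 (lebesgue_on ?S) f g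
       + (LINT x|lebesgue_on ?S. (norm (grad (\<lambda>x. f x - g x) x))^2))" using tr by blast
    also have "(LINT x|lebesgue_on ?S. (norm (grad (\<lambda>x. f x - g x) x))^2) = L2_dist2 (lebesgue_on ?S) (grad f) (grad g)"
      by (rule Bochner_Integration.integral_cong) (auto simp: gd)
    finally show "L2_dist2 (sphere_measure r) f g \<le> K * (L2_dist2 (lebesgue_on ?S) f g
       + L2_dist2 (lebesgue_on ?S) (grad f) (grad g))" .
  qed
qed

text \<open>
  By the trace inequality the restrictions to the sphere form a Cauchy sequence.
\<close>

lemma has_trace_exists:
  fixes u :: "'a::euclidean_space \<Rightarrow> real"
  assumes r: "r > 0" and \<delta>: "\<delta> > 0"
    and f: "\<And>n. smooth_on (shell (r - \<delta>) (r + \<delta>)) (f n)"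
    and u: "L2_tendsto (lebesgue_on (shell (r - \<delta>) (r + \<delta>))) f u"
    and G: "L2_tendsto (lebesgue_on (shell (r - \<delta>) (r + \<delta>))) (\<lambda>n. grad (f n)) G"
  obtains g where "has_trace r u g" "L2_tendsto (sphere_measure r) f g"
proof -
  let ?S = "shell (r - \<delta>) (r + \<delta>) :: 'a set"
  obtain K where K: "K \<ge> 0" and tr: "\<forall>f g :: 'a \<Rightarrow> real. smooth_H1 ?S f \<longrightarrow> smooth_H1 ?S g \<longrightarrow>
       L2_dist2 (sphere_measure r) f g \<le>
       K * (L2_dist2 (lebesgue_on ?S) f g + L2_dist2 (lebesgue_on ?S) (grad f) (grad g))"
    using trace_diff_inequality[OF r \<delta>, where 'a = 'a] by blast
  have "L2_Cauchy (sphere_measure r) f"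
    unfolding L2_Cauchy_def
  proof (intro conjI allI impI)
    show "f n \<in> L2_space (sphere_measure r)" for n
      by (rule continuous_sphere_L2[OF r], rule continuous_on_subset[OF smooth_on_continuous[OF f]])
         (use \<delta> in \<open>auto simp: shell_def\<close>)
    fix e :: real assume e: "e > 0"
    define d where "d = e / 2 / (K + 1)"
    have d: "d > 0" using e K by (simp add: d_def)
    obtain N1 where N1: "\<forall>m\<ge>N1. \<forall>n\<ge>N1. L2_dist2 (lebesgue_on ?S) (f m) (f n) < d"
      using L2_tendsto_imp_Cauchy[OF u] d unfolding L2_Cauchy_def by blast
    obtain N2 where N2: "\<forall>m\<ge>N2. \<forall>n\<ge>N2. L2_dist2 (lebesgue_on ?S) (grad (f m)) (grad (f n)) < d"
      using L2_tendsto_imp_Cauchy[OF G] d unfolding L2_Cauchy_def by blast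
    have "L2_dist2 (sphere_measure r) (f m) (f n) < e" if "m \<ge> max N1 N2" "n \<ge> max N1 N2" for m n
    proof -
      have "L2_dist2 (sphere_measure r) (f m) (f n) \<le>
        K * (L2_dist2 (lebesgue_on ?S) (f m) (f n) + L2_dist2 (lebesgue_on ?S) (grad (f m)) (grad (f n)))"
        using tr f L2_tendstoD(1)[OF u] L2_tendstoD(1)[OF G] unfolding smooth_H1_def by blast
      also have "\<dots> \<le> K * (d + d)"
        using N1 N2 that K by (intro mult_left_mono add_mono) (auto intro: less_imp_le)
      also have "\<dots> < (K + 1) * (d + d)" using d by simp
      also have "\<dots> = 2 * ((K + 1) * d)" by simp
      also have "(K + 1) * d = e / 2" using K nonzero_mult_div_cancel_left[of "K + 1" "e / 2"] by (simp only: d_def times_divide_eq_right)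
      also have "2 * (e / 2) = e" by simp
      finally show ?thesis .
    qed
    then show "\<exists>N. \<forall>m\<ge>N. \<forall>n\<ge>N. L2_dist2 (sphere_measure r) (f m) (f n) < e" by blast
  qed
  then obtain g where g: "L2_tendsto (sphere_measure r) f g" by (rule L2_complete)
  have "has_weak_grad ?S u G" by (rule has_weak_grad_L2_limit[OF shell_sets(2) f u G])
  then have "has_trace r u g" unfolding has_trace_def using \<delta> f u G g by blast
  then show thesis using g by (rule that)
qed

text \<open>
  Two approximating sequences may live on different neighbourhoods and converge to
  different weak gradients. On the smaller neighbourhood the gradients agree almost everywhere, hence
  the difference of the two sequences tends to zero there, and the trace inequality transfers this to
  the sphere.
\<close>

lemma has_trace_unique:
  fixes u :: "'a::euclidean_space \<Rightarrow> real"
  assumes r: "r > 0" and "has_trace r u g" "has_trace r u g'"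
  shows "AE x in sphere_measure r. g x = g' x"
proof -
  let ?S = "\<lambda>\<delta>. shell (r - \<delta>) (r + \<delta>) :: 'a set"
  obtain \<delta> G f where 1: "\<delta> > 0" "has_weak_grad (?S \<delta>) u G" "\<And>n. smooth_on (?S \<delta>) (f n)"
     "L2_tendsto (lebesgue_on (?S \<delta>)) f u" "L2_tendsto (lebesgue_on (?S \<delta>)) (\<lambda>n. grad (f n)) G"
     "L2_tendsto (sphere_measure r) f g"
    using assms(2) unfolding has_trace_def by auto
  obtain \<delta>' G' f' where 2: "\<delta>' > 0" "has_weak_grad (?S \<delta>') u G'" "\<And>n. smooth_on (?S \<delta>') (f' n)"
     "L2_tendsto (lebesgue_on (?S \<delta>')) f' u" "L2_tendsto (lebesgue_on (?S \<delta>')) (\<lambda>n. grad (f' n)) G'"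
     "L2_tendsto (sphere_measure r) f' g'"
    using assms(3) unfolding has_trace_def by auto
  define d where "d = min \<delta> \<delta>'"
  have d: "d > 0" using 1(1) 2(1) by (simp add: d_def)
  have sub: "?S d \<subseteq> ?S \<delta>" "?S d \<subseteq> ?S \<delta>'" by (auto simp: d_def shell_def)
  obtain K where K: "K \<ge> 0" and tr: "\<forall>f g :: 'a \<Rightarrow> real. smooth_H1 (?S d) f \<longrightarrow> smooth_H1 (?S d) g \<longrightarrow>
       L2_dist2 (sphere_measure r) f g \<le>
       K * (L2_dist2 (lebesgue_on (?S d)) f g + L2_dist2 (lebesgue_on (?S d)) (grad f) (grad g))"
    using trace_diff_inequality[OF r d, where 'a = 'a] by blast
  have fu: "L2_tendsto (lebesgue_on (?S d)) f u" "L2_tendsto (lebesgue_on (?S d)) f' u"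
    by (rule L2_tendsto_lebesgue_on_subset[OF 1(4)] L2_tendsto_lebesgue_on_subset[OF 2(4)]; use sub in simp)+
  have fG: "L2_tendsto (lebesgue_on (?S d)) (\<lambda>n. grad (f n)) G" "L2_tendsto (lebesgue_on (?S d)) (\<lambda>n. grad (f' n)) G'"
    by (rule L2_tendsto_lebesgue_on_subset[OF 1(5)] L2_tendsto_lebesgue_on_subset[OF 2(5)]; use sub in simp)+
  have "AE x in lebesgue_on (?S d). G x = G' x"
    by (rule has_weak_grad_unique[of _ u]) (use sub in \<open>auto intro: has_weak_grad_mono[OF 1(2)] has_weak_grad_mono[OF 2(2)]\<close>)
  then have GG: "L2_dist2 (lebesgue_on (?S d)) G G' = 0"
    by (intro integral_eq_zero_AE) (auto elim: eventually_mono)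
  have l1: "(\<lambda>n. L2_dist2 (lebesgue_on (?S d)) (f n) (f' n)) \<longlonglongrightarrow> 0"
    using L2_tendsto_norm2[OF L2_tendsto_diff[OF fu]] by simp
  have l2: "(\<lambda>n. L2_dist2 (lebesgue_on (?S d)) (grad (f n)) (grad (f' n))) \<longlonglongrightarrow> 0"
    using L2_tendsto_norm2[OF L2_tendsto_diff[OF fG]] by (simp add: GG)
  note gg = L2_tendsto_diff[OF 1(6) 2(6)]
  have lim: "(\<lambda>n. L2_dist2 (sphere_measure r) (f n) (f' n)) \<longlonglongrightarrow> 0"
  proof (rule Lim_null_comparison)
    show "\<forall>\<^sub>F n in sequentially. norm (L2_dist2 (sphere_measure r) (f n) (f' n)) \<le>
      K * (L2_dist2 (lebesgue_on (?S d)) (f n) (f' n) + L2_dist2 (lebesgue_on (?S d)) (grad (f n)) (grad (f' n)))"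
    proof (intro always_eventually allI)
      fix n
      show "norm (L2_dist2 (sphere_measure r) (f n) (f' n)) \<le>
        K * (L2_dist2 (lebesgue_on (?S d)) (f n) (f' n) + L2_dist2 (lebesgue_on (?S d)) (grad (f n)) (grad (f' n)))"
        using tr smooth_on_subset[OF 1(3) sub(1)] smooth_on_subset[OF 2(3) sub(2)]
            L2_tendstoD(1)[OF fu(1)] L2_tendstoD(1)[OF fu(2)] L2_tendstoD(1)[OF fG(1)] L2_tendstoD(1)[OF fG(2)]
        unfolding smooth_H1_def by simp
    qed
    show "(\<lambda>n. K * (L2_dist2 (lebesgue_on (?S d)) (f n) (f' n) + L2_dist2 (lebesgue_on (?S d)) (grad (f n)) (grad (f' n)))) \<longlonglongrightarrow> 0"
      using tendsto_mult_left[OF tendsto_add[OF l1 l2], of K] by simp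
  qed
  have "L2_dist2 (sphere_measure r) g g' = 0"
    by (rule LIMSEQ_unique[OF L2_tendsto_norm2[OF gg] lim])
  then have "AE x in sphere_measure r. (norm (g x - g' x))^2 = 0"
    by (subst (asm) integral_nonneg_eq_0_iff_AE) (use L2_spaceD(2)[OF L2_tendstoD(2)[OF gg]] in auto)
  then show ?thesis by eventually_elim simp
qed

lemma has_trace_L2: "has_trace r u g \<Longrightarrow> g \<in> L2_space (sphere_measure r)"
  unfolding has_trace_def by (auto dest: L2_tendstoD)

lemma integral_sphere_trace:
  assumes "r > 0" "has_trace r u g"
  shows "(LINT x|sphere_measure r. (sphere_trace r u x)^2) = (LINT x|sphere_measure r. (g x)^2)"
proof -
  have t: "has_trace r u (sphere_trace r u)" unfolding sphere_trace_def by (rule someI[of "has_trace r u" g]) fact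
  show ?thesis
    using has_trace_unique[OF assms(1) t assms(2)] has_trace_L2[OF t, THEN L2_spaceD(1)] has_trace_L2[OF assms(2), THEN L2_spaceD(1)]
    by (intro integral_cong_AE) (auto elim: eventually_mono)
qed

section \<open>The Hardy inequality and the space H\<close>

lemma test_function_integrable:
  fixes f :: "'a::euclidean_space \<Rightarrow> real"
  assumes \<phi>: "\<phi> \<in> test_functions \<Omega>" and f: "continuous_on UNIV f" "\<And>x. \<phi> x = 0 \<Longrightarrow> grad \<phi> x = 0 \<Longrightarrow> f x = 0"
  shows "integrable lborel f"
proof -
  obtain K where K: "compact K" "K \<subseteq> \<Omega>" "\<And>x. x \<notin> K \<Longrightarrow> \<phi> x = 0" "\<And>x. x \<notin> K \<Longrightarrow> grad \<phi> x = 0"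
    using test_functionsE[OF \<phi>] by metis
  show ?thesis by (rule continuous_compact_support_integrable[OF f(1) K(1)]) (use f(2) K(3,4) in auto)
qed

text \<open>
  The integrand is the divergence of \<phi>^2 x / (|x|^2 + d), a differentiable field of compact
  support. The regularisation by d > 0 avoids the singularity of x / |x|^2 at the origin.
\<close>

lemma regularised_divergence:
  fixes \<phi> :: "'a::euclidean_space \<Rightarrow> real"
  assumes \<phi>: "\<phi> \<in> test_functions \<Omega>" and d: "d > 0"
  shows "(LINT x|lborel. 2 * \<phi> x * (grad \<phi> x \<bullet> x) / ((norm x)^2 + d)
      + (\<phi> x)^2 * (DIM('a) / ((norm x)^2 + d) - 2 * (norm x)^2 / ((norm x)^2 + d)^2)) = 0"
proof -
  note c = test_functions_continuous[OF \<phi>, of UNIV]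
  obtain K where K: "compact K" "K \<subseteq> \<Omega>" "\<And>x. x \<notin> K \<Longrightarrow> \<phi> x = 0" "\<And>x. x \<notin> K \<Longrightarrow> grad \<phi> x = 0"
    using test_functionsE[OF \<phi>] by metis
  define q where "q x = inverse (x \<bullet> x + d)" for x :: 'a
  have p: "x \<bullet> x + d > 0" for x :: 'a using d by (simp add: add_nonneg_pos)
  have pn: "x \<bullet> x + d \<noteq> 0" for x :: 'a using p[of x] by simp
  have cq: "continuous_on UNIV q" unfolding q_def by (intro continuous_intros) (use pn in auto)
  define D where "D b x = (2 * \<phi> x * (x \<bullet> b) * q x) *\<^sub>R grad \<phi> x + ((\<phi> x)^2 * q x) *\<^sub>R b
      - (2 * (\<phi> x)^2 * (x \<bullet> b) * (q x)^2) *\<^sub>R x" for b x :: 'a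
  have z: "(LINT x|lborel. D b x \<bullet> b) = 0" for b
  proof (rule integral_partial_derivative_eq_0[where F = "\<lambda>x. (\<phi> x)^2 * ((x \<bullet> b) * q x)", OF _ _ K(1)])
    fix x
    have g: "(\<phi> has_derivative (\<lambda>h. grad \<phi> x \<bullet> h)) (at x)"
      by (rule smooth_on_has_derivative[OF test_functions_smooth[OF \<phi>, of UNIV]]) simp
    have "(q has_derivative (\<lambda>h. - (q x * (2 * (x \<bullet> h)) * q x))) (at x)"
      unfolding q_def[abs_def]
      by (rule has_derivative_eq_rhs, rule Deriv.has_derivative_inverse[of "\<lambda>x. x \<bullet> x + d" x, OF pn])
         (auto intro!: derivative_eq_intros simp: inner_commute)
    then have "((\<lambda>x. (\<phi> x)^2 * ((x \<bullet> b) * q x)) has_derivative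
      (\<lambda>h. (\<phi> x)^2 * ((x \<bullet> b) * (- (q x * (2 * (x \<bullet> h)) * q x)) + (h \<bullet> b) * q x)
         + (2 * (grad \<phi> x \<bullet> h) * \<phi> x) * ((x \<bullet> b) * q x))) (at x)"
      using g by (auto intro!: derivative_eq_intros)
    then show "((\<lambda>x. (\<phi> x)^2 * ((x \<bullet> b) * q x)) has_derivative (\<lambda>h. D b x \<bullet> h)) (at x)"
      by (rule has_derivative_eq_rhs)
         (auto simp: D_def inner_add_left inner_diff_left inner_commute[of b] algebra_simps power2_eq_square)
  next
    show "continuous_on UNIV (D b)" unfolding D_def[abs_def] by (intro continuous_intros c cq)
  qed (use K(3) in auto)
  have i: "integrable lborel (\<lambda>x. D b x \<bullet> b)" for b
    by (rule test_function_integrable[OF \<phi>]) (auto simp: D_def intro!: continuous_intros c cq)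
  have "(LINT x|lborel. (\<Sum>b\<in>Basis. D b x \<bullet> b)) = 0"
    using z i by (simp add: Bochner_Integration.integral_sum)
  moreover have "(\<Sum>b\<in>Basis. D b x \<bullet> b) = 2 * \<phi> x * (grad \<phi> x \<bullet> x) / ((norm x)^2 + d)
      + (\<phi> x)^2 * (DIM('a) / ((norm x)^2 + d) - 2 * (norm x)^2 / ((norm x)^2 + d)^2)" for x
  proof -
    have "(\<Sum>b\<in>Basis. D b x \<bullet> b) = (\<Sum>b\<in>Basis. (2 * \<phi> x * q x) * ((grad \<phi> x \<bullet> b) * (x \<bullet> b)) + (\<phi> x)^2 * q x
        - (2 * (\<phi> x)^2 * (q x)^2) * ((x \<bullet> b) * (x \<bullet> b)))"
      by (intro sum.cong refl) (simp add: D_def inner_add_left inner_diff_left mult_ac)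
    also have "\<dots> = (2 * \<phi> x * q x) * (grad \<phi> x \<bullet> x) + DIM('a) * ((\<phi> x)^2 * q x) - (2 * (\<phi> x)^2 * (q x)^2) * (x \<bullet> x)"
      unfolding sum.distrib sum_subtractf sum_distrib_left[symmetric] euclidean_inner[symmetric] by simp
    finally show ?thesis by (simp add: q_def power2_norm_eq_inner divide_inverse algebra_simps power_inverse)
  qed
  ultimately show ?thesis by simp
qed

text \<open>
  The ground state identity with the regularised field. Since N = 2 \<alpha> + 2, the
  difference of the two sides is \<phi>^2 (\<alpha>^2 + 2 \<alpha>) d / (|x|^2 + d)^2 after the divergence
  has been removed, which is nonnegative.
\<close>

lemma regularised_hardy:
  fixes \<phi> :: "'a::euclidean_space \<Rightarrow> real"
  assumes \<phi>: "\<phi> \<in> test_functions \<Omega>" and d: "d > 0" and \<alpha>: "\<alpha> = (real DIM('a) - 2) / 2" "\<alpha> \<ge> 0"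
  shows "(LINT x|lborel. (norm (grad \<phi> x + (\<alpha> * \<phi> x / ((norm x)^2 + d)) *\<^sub>R x))^2)
     + \<alpha>^2 * (LINT x|lborel. (\<phi> x)^2 / ((norm x)^2 + d)) \<le> (LINT x|lborel. (norm (grad \<phi> x))^2)"
proof -
  note c = test_functions_continuous[OF \<phi>, of UNIV]
  have p: "(norm x)^2 + d > 0" for x :: 'a using d by (simp add: add_nonneg_pos)
  have pn: "(norm x)^2 + d \<noteq> 0" for x :: 'a using p[of x] by simp
  let ?V = "\<lambda>x. 2 * \<phi> x * (grad \<phi> x \<bullet> x) / ((norm x)^2 + d)
      + (\<phi> x)^2 * (DIM('a) / ((norm x)^2 + d) - 2 * (norm x)^2 / ((norm x)^2 + d)^2)"
  let ?L = "\<lambda>x. (norm (grad \<phi> x + (\<alpha> * \<phi> x / ((norm x)^2 + d)) *\<^sub>R x))^2"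
  let ?H = "\<lambda>x. (\<phi> x)^2 / ((norm x)^2 + d)"
  let ?A = "\<lambda>x. (norm (grad \<phi> x))^2"
  have i: "integrable lborel ?V" "integrable lborel ?L" "integrable lborel ?H" "integrable lborel ?A"
    by (rule test_function_integrable[OF \<phi>]; use pn in \<open>auto intro!: continuous_intros c\<close>)+
  have pt: "?L x + \<alpha>^2 * ?H x \<le> ?A x + \<alpha> * ?V x" for x
  proof -
    define s where "s = (norm x)^2 + d"
    define \<rho> where "\<rho> = (norm x)^2"
    have s: "s > 0" "0 \<le> \<rho>" "\<rho> \<le> s" using p[of x] d by (auto simp: s_def \<rho>_def)
    have N: "real DIM('a) = 2 * \<alpha> + 2" using \<alpha> by simp
    have L: "?L x = ?A x + 2 * (\<alpha> * \<phi> x / s) * (grad \<phi> x \<bullet> x) + (\<alpha> * \<phi> x / s)^2 * \<rho>"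
      unfolding s_def \<rho>_def power2_norm_eq_inner
      by (simp add: inner_add_left inner_add_right inner_commute algebra_simps power2_eq_square)
    have V: "?V x = 2 * \<phi> x * (grad \<phi> x \<bullet> x) / s + (\<phi> x)^2 * ((2 * \<alpha> + 2) / s - 2 * \<rho> / s^2)"
      and H: "?H x = (\<phi> x)^2 / s"
      by (simp_all add: s_def \<rho>_def N)
    have "?A x + \<alpha> * ?V x - (?L x + \<alpha>^2 * ?H x)
      = (\<phi> x)^2 * (\<alpha> * (2 * \<alpha> + 2) / s - 2 * \<alpha> * \<rho> / s^2 - \<alpha>^2 * \<rho> / s^2 - \<alpha>^2 / s)"
      unfolding L V H by (simp add: algebra_simps power2_eq_square)
    also have "\<dots> = (\<phi> x)^2 * ((\<alpha>^2 + 2 * \<alpha>) * (s - \<rho>) / s^2)"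
      using s(1) by (simp add: field_simps power2_eq_square)
    also have "\<dots> \<ge> 0" using s \<alpha>(2) by (intro mult_nonneg_nonneg divide_nonneg_nonneg) auto
    finally show ?thesis by simp
  qed
  have "(LINT x|lborel. ?L x) + \<alpha>^2 * (LINT x|lborel. ?H x) = (LINT x|lborel. ?L x + \<alpha>^2 * ?H x)"
    using i by (simp del: times_divide_eq_right)
  also have "\<dots> \<le> (LINT x|lborel. ?A x + \<alpha> * ?V x)"
    by (rule integral_mono[OF _ _ pt]) (use i in \<open>simp_all del: times_divide_eq_right\<close>)
  also have "\<dots> = (LINT x|lborel. ?A x) + \<alpha> * (LINT x|lborel. ?V x)" using i by simp
  also have "(LINT x|lborel. ?V x) = 0" by (rule regularised_divergence[OF \<phi> d])
  finally show ?thesis by simp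
qed

text \<open>
  The square on the left of \<open>regularised_hardy\<close> controls the gradient where the
  field x / (|x|^2 + d) is bounded by 1/e, that is, outside the ball of radius e.
\<close>

lemma regularised_hardy_shell:
  fixes \<phi> :: "'a::euclidean_space \<Rightarrow> real"
  assumes \<phi>: "\<phi> \<in> test_functions \<Omega>" and d: "d > 0" and \<alpha>: "\<alpha> = (real DIM('a) - 2) / 2" "\<alpha> \<ge> 0" and e: "e > 0"
  defines "Q \<equiv> (LINT x|lborel. (norm (grad \<phi> x))^2) - \<alpha>^2 * (LINT x|lborel. (\<phi> x)^2 / ((norm x)^2 + d))"
  shows "0 \<le> Q"
    and "(LINT x|lborel. indicator (shell e 1) x * (norm (grad \<phi> x))^2)
      \<le> 2 * Q + 2 * (\<alpha> / e)^2 * (LINT x|lborel. indicator (shell e 1) x * (\<phi> x)^2)"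
proof -
  note c = test_functions_continuous[OF \<phi>, of UNIV]
  have p: "(norm x)^2 + d > 0" for x :: 'a using d by (simp add: add_nonneg_pos)
  then have pn: "(norm x)^2 + d \<noteq> 0" for x :: 'a by (metis less_irrefl)
  let ?v = "\<lambda>x. (\<alpha> * \<phi> x / ((norm x)^2 + d)) *\<^sub>R x"
  let ?L = "\<lambda>x. (norm (grad \<phi> x + ?v x))^2"
  let ?I = "\<lambda>f x. indicator (shell e 1) x * f x :: real"
  have i: "integrable lborel ?L" "integrable lborel (\<lambda>x. (norm (grad \<phi> x))^2)" "integrable lborel (\<lambda>x. (\<phi> x)^2)"
    by (rule test_function_integrable[OF \<phi>]; use pn in \<open>auto intro!: continuous_intros c\<close>)+
  have ind: "integrable lborel (?I f)" if "integrable lborel f" for f :: "'a \<Rightarrow> real"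
    using integrable_mult_indicator[OF _ that, of "shell e 1"] by simp
  have L: "(LINT x|lborel. ?L x) \<le> Q" using regularised_hardy[OF \<phi> d \<alpha>] by (simp add: Q_def)
  moreover have "0 \<le> (LINT x|lborel. ?L x)" by simp
  ultimately show "0 \<le> Q" by linarith
  have "(LINT x|lborel. ?I (\<lambda>x. (norm (grad \<phi> x))^2) x) \<le> (LINT x|lborel. 2 * ?L x + 2 * (\<alpha> / e)^2 * ?I (\<lambda>x. (\<phi> x)^2) x)"
  proof (rule integral_mono)
    fix x :: 'a
    show "?I (\<lambda>x. (norm (grad \<phi> x))^2) x \<le> 2 * ?L x + 2 * (\<alpha> / e)^2 * ?I (\<lambda>x. (\<phi> x)^2) x"
    proof (cases "x \<in> shell e 1")
      case True
      then have x: "e < norm x" "norm x > 0" using e by (auto simp: shell_def)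
      have "norm x / ((norm x)^2 + d) \<le> norm x / (norm x)^2"
        using x(2) d by (intro divide_left_mono) (auto intro!: mult_pos_pos p)
      also have "\<dots> \<le> 1 / e" using x e by (simp add: power2_eq_square frac_le)
      finally have q: "norm x / ((norm x)^2 + d) \<le> 1 / e" .
      have "norm (?v x) = (\<alpha> * \<bar>\<phi> x\<bar>) * (norm x / ((norm x)^2 + d))"
        using p[of x] \<alpha>(2) by (simp add: abs_mult)
      also have "\<dots> \<le> (\<alpha> * \<bar>\<phi> x\<bar>) * (1 / e)" using q \<alpha>(2) by (intro mult_left_mono) auto
      finally have "(norm (?v x))^2 \<le> ((\<alpha> * \<bar>\<phi> x\<bar>) * (1 / e))^2" by (intro power_mono) auto
      also have "\<dots> = (\<alpha> / e)^2 * (\<phi> x)^2" by (simp add: power_mult_distrib power_divide)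
      finally have "(norm (- ?v x))^2 \<le> (\<alpha> / e)^2 * (\<phi> x)^2" by simp
      then have "(norm (grad \<phi> x))^2 \<le> 2 * ?L x + 2 * ((\<alpha> / e)^2 * (\<phi> x)^2)"
        using norm_add_power2_le[of "grad \<phi> x + ?v x" "- ?v x"] by simp
      then show ?thesis using True by simp
    qed simp
  qed (use ind[OF i(2)] ind[OF i(3)] i(1) in auto)
  also have "\<dots> = 2 * (LINT x|lborel. ?L x) + 2 * (\<alpha> / e)^2 * (LINT x|lborel. ?I (\<lambda>x. (\<phi> x)^2) x)"
    using ind[OF i(3)] i(1) by simp
  finally show "(LINT x|lborel. ?I (\<lambda>x. (norm (grad \<phi> x))^2) x) \<le> 2 * Q + 2 * (\<alpha> / e)^2 * (LINT x|lborel. ?I (\<lambda>x. (\<phi> x)^2) x)"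
    using L by linarith
qed

text \<open>
  The regularised terms increase as d decreases and stay bounded by a multiple of the
  Dirichlet integral, so monotone convergence applies.
\<close>

lemma regularised_hardy_term_tendsto:
  fixes \<phi> :: "'a::euclidean_space \<Rightarrow> real"
  assumes \<phi>: "\<phi> \<in> test_functions \<Omega>" and N: "DIM('a) \<ge> 3"
  shows "(\<lambda>n. LINT x|lborel. (\<phi> x)^2 / ((norm x)^2 + inverse (real (Suc n)))) \<longlonglongrightarrow> (LINT x|lborel. (\<phi> x)^2 / (norm x)^2)"
proof -
  note c = test_functions_continuous[OF \<phi>, of UNIV]
  have [measurable]: "\<phi> \<in> borel_measurable borel" using c by (auto intro: borel_measurable_continuous_onI)
  define \<alpha> where "\<alpha> = (real DIM('a) - 2) / 2"
  have \<alpha>: "\<alpha> > 0" using N by (simp add: \<alpha>_def)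
  define d where "d n = inverse (real (Suc n))" for n
  have d: "d n > 0" for n by (simp add: d_def)
  have p: "(norm x)^2 + d n > 0" for x :: 'a and n using d[of n] by (simp add: add_nonneg_pos)
  then have pn: "(norm x)^2 + d n \<noteq> 0" for x :: 'a and n by (metis less_irrefl)
  let ?A = "LINT x|lborel. (norm (grad \<phi> x))^2"
  define h where "h n x = (\<phi> x)^2 / ((norm x)^2 + d n)" for n x
  have i: "integrable lborel (h n)" for n
    by (rule test_function_integrable[OF \<phi>]; use pn in \<open>auto simp: h_def intro!: continuous_intros c\<close>)
  have hmono: "h m x \<le> h n x" if "m \<le> n" for m n x
    unfolding h_def by (rule divide_left_mono) (use that p in \<open>auto intro!: mult_pos_pos simp: d_def\<close>)
  have hbd: "(LINT x|lborel. h n x) \<le> ?A / \<alpha>^2" for n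
    using regularised_hardy_shell(1)[OF \<phi> d[of n] \<alpha>_def less_imp_le[OF \<alpha>] zero_less_one] \<alpha>
    by (simp add: h_def pos_le_divide_eq mult.commute)
  have inc: "incseq (\<lambda>n. LINT x|lborel. h n x)"
    by (auto simp: incseq_def intro!: integral_mono i hmono)
  obtain L where L: "(\<lambda>n. LINT x|lborel. h n x) \<longlonglongrightarrow> L"
    using incseq_convergent[OF inc, of "?A / \<alpha>^2"] hbd by blast
  have hl: "AE x in lborel. (\<lambda>n. h n x) \<longlonglongrightarrow> (\<phi> x)^2 / (norm x)^2"
    using AE_lborel_singleton[of "0::'a"]
  proof eventually_elim
    case (elim x)
    have "(\<lambda>n. (\<phi> x)^2 / ((norm x)^2 + d n)) \<longlonglongrightarrow> (\<phi> x)^2 / ((norm x)^2 + 0)"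
      unfolding d_def by (intro tendsto_intros LIMSEQ_inverse_real_of_nat) (use elim in simp)
    then show ?case by (simp add: h_def)
  qed
  have "(LINT x|lborel. (\<phi> x)^2 / (norm x)^2) = L"
  proof (rule integral_monotone_convergence_nonneg(2)[OF i _ _ hl L])
    show "AE x in lborel. mono (\<lambda>n. h n x)" by (auto simp: mono_def hmono)
    show "AE x in lborel. 0 \<le> h n x" for n by (intro AE_I2) (simp add: h_def less_imp_le[OF p])
  qed measurable
  with L show ?thesis by (simp add: h_def d_def)
qed

lemma integral_lebesgue_on_eq_lborel:
  fixes f :: "'a::euclidean_space \<Rightarrow> real"
  assumes "S \<in> sets borel" "f \<in> borel_measurable borel" "\<And>x. x \<notin> S \<Longrightarrow> f x = 0"
  shows "(LINT x|lebesgue_on S. f x) = (LINT x|lborel. f x)"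
proof -
  have "(\<lambda>x. if x \<in> S then f x else 0) = f" using assms(3) by auto
  then show ?thesis using lebesgue_on_eq_lborel_extension(2)[OF assms(1), where f = f] assms(2) by simp
qed

text \<open>
  The first part is the Hardy inequality. It shows that the square root in the definition of
  \<open>hardy_norm\<close> is taken of a nonnegative number, so that small norm means small Hardy energy.
\<close>

lemma hardy_norm_shell_bound:
  fixes \<phi> :: "'a::euclidean_space \<Rightarrow> real"
  assumes \<phi>: "\<phi> \<in> test_functions (ball 0 1)" and N: "DIM('a) \<ge> 3" and \<alpha>: "\<alpha> = (real DIM('a) - 2) / 2" and e: "e > 0"
  shows "0 \<le> hardy_norm \<phi>"
    and "(LINT x|lebesgue_on (shell e 1). (norm (grad \<phi> x))^2)
      \<le> 2 * (hardy_norm \<phi>)^2 + 2 * (\<alpha> / e)^2 * (LINT x|lebesgue_on (shell e 1). (\<phi> x)^2)"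
proof -
  note c = test_functions_continuous[OF \<phi>, of UNIV]
  have [measurable]: "\<phi> \<in> borel_measurable borel" "grad \<phi> \<in> borel_measurable borel"
    using c by (auto intro: borel_measurable_continuous_onI)
  obtain K where K: "compact K" "K \<subseteq> ball 0 1" "\<And>x. x \<notin> K \<Longrightarrow> \<phi> x = 0" "\<And>x. x \<notin> K \<Longrightarrow> grad \<phi> x = 0"
    using test_functionsE[OF \<phi>] by metis
  have z: "\<phi> x = 0" "grad \<phi> x = 0" if "x \<notin> ball 0 1" for x using K(2) K(3)[of x] K(4)[of x] that by (meson subsetD)+
  have \<alpha>0: "\<alpha> \<ge> 0" using N by (simp add: \<alpha>)
  define Q where "Q d = (LINT x|lborel. (norm (grad \<phi> x))^2) - \<alpha>^2 * (LINT x|lborel. (\<phi> x)^2 / ((norm x)^2 + d))" for d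
  have hc: "hardy_const TYPE('a) = \<alpha>^2" by (simp add: hardy_const_def \<alpha>)
  have hn: "hardy_norm \<phi> = sqrt (Q 0)"
    unfolding hardy_norm_def hc Q_def by (subst (1 2) integral_lebesgue_on_eq_lborel) (use z in auto)
  have lim: "(\<lambda>n. Q (inverse (real (Suc n)))) \<longlonglongrightarrow> Q 0"
    unfolding Q_def using regularised_hardy_term_tendsto[OF \<phi> N] by (intro tendsto_intros) simp
  note reg = regularised_hardy_shell[OF \<phi> _ \<alpha> \<alpha>0 e, folded Q_def]
  have "0 \<le> Q 0" by (rule LIMSEQ_le_const[OF lim]) (use reg(1) in auto)
  then have hn2: "(hardy_norm \<phi>)^2 = Q 0" and hn0: "0 \<le> hardy_norm \<phi>" using hn by simp_all
  show "0 \<le> hardy_norm \<phi>" by (rule hn0)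
  let ?I = "\<lambda>f. LINT x|lborel. indicator (shell e 1) x * f x"
  have "?I (\<lambda>x. (norm (grad \<phi> x))^2) \<le> 2 * Q 0 + 2 * (\<alpha> / e)^2 * ?I (\<lambda>x. (\<phi> x)^2)"
    by (rule LIMSEQ_le_const[OF tendsto_add[OF tendsto_mult[OF tendsto_const lim] tendsto_const]]) (use reg(2) in auto)
  moreover have "(LINT x|lebesgue_on (shell e 1). f x) = ?I f" if "f \<in> borel_measurable borel" for f :: "'a \<Rightarrow> real"
  proof -
    have "(LINT x|lebesgue_on (shell e 1). f x) = (LINT x|lebesgue_on (shell e 1). indicator (shell e 1) x * f x)"
      by (rule Bochner_Integration.integral_cong) auto
    also have "\<dots> = ?I f" by (rule integral_lebesgue_on_eq_lborel) (use that in auto)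
    finally show ?thesis .
  qed
  ultimately show "(LINT x|lebesgue_on (shell e 1). (norm (grad \<phi> x))^2)
      \<le> 2 * (hardy_norm \<phi>)^2 + 2 * (\<alpha> / e)^2 * (LINT x|lebesgue_on (shell e 1). (\<phi> x)^2)"
    by (simp add: hn2)
qed

lemma test_functions_diff:
  fixes f g :: "'a::euclidean_space \<Rightarrow> real"
  assumes f: "f \<in> test_functions \<Omega>" and g: "g \<in> test_functions \<Omega>"
  shows "(\<lambda>x. f x - g x) \<in> test_functions \<Omega>"
proof -
  let ?F = "closure {x. f x \<noteq> 0}" and ?G = "closure {x. g x \<noteq> 0}"
  have s: "closure {x. f x - g x \<noteq> 0} \<subseteq> ?F \<union> ?G"
    unfolding closure_Un[symmetric] by (rule closure_mono) auto
  have c: "compact (?F \<union> ?G)" using f g by (auto simp: test_functions_def)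
  have "compact (closure {x. f x - g x \<noteq> 0})"
    using compact_Int_closed[OF c closed_closure[of "{x. f x - g x \<noteq> 0}"]] s by (simp add: Int_absorb1)
  then show ?thesis
    using s f g smooth_on_diff[OF open_UNIV, of f g] by (auto simp: test_functions_def)
qed

text \<open>
  The definition of \<open>H_space\<close> only gives convergence of the functions; the bound above
  turns the Cauchy property in the Hardy norm into convergence of the gradients on the annulus.
\<close>

lemma H_space_approximation:
  fixes u :: "'a::euclidean_space \<Rightarrow> real"
  assumes N: "DIM('a) \<ge> 3" and u: "u \<in> H_space" and e: "e > 0"
  shows "\<exists>\<phi> G. (\<forall>n. \<phi> n \<in> test_functions (ball 0 1)) \<and> L2_tendsto (lebesgue_on (shell e 1)) \<phi> u \<and>
    L2_tendsto (lebesgue_on (shell e 1)) (\<lambda>n. grad (\<phi> n)) G"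
proof -
  obtain \<phi> where \<phi>: "\<And>n::nat. \<phi> n \<in> test_functions (ball 0 1)"
    and C: "\<And>e. e > 0 \<Longrightarrow> \<exists>M. \<forall>m\<ge>M. \<forall>n\<ge>M. hardy_norm (\<lambda>x. \<phi> m x - \<phi> n x) < e"
    and u: "L2_tendsto (lebesgue_on (ball 0 1)) \<phi> u"
    using u unfolding H_space_def by blast
  define \<alpha> where "\<alpha> = (real DIM('a) - 2) / 2"
  have u': "L2_tendsto (lebesgue_on (shell e 1)) \<phi> u"
    by (rule L2_tendsto_lebesgue_on_subset[OF u]) (auto simp: shell_def)
  have dg: "grad (\<phi> m) x - grad (\<phi> n) x = grad (\<lambda>x. \<phi> m x - \<phi> n x) x" for m n x
    by (rule grad_diff[symmetric, of UNIV]) (auto intro: test_functions_smooth[OF \<phi>])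
  have "L2_Cauchy (lebesgue_on (shell e 1)) (\<lambda>n. grad (\<phi> n))"
    unfolding L2_Cauchy_def
  proof (intro conjI allI impI)
    show "grad (\<phi> n) \<in> L2_space (lebesgue_on (shell e 1))" for n
    proof (rule L2_spaceI)
      note c = test_functions_continuous[OF \<phi>[of n]]
      show "grad (\<phi> n) \<in> borel_measurable (lebesgue_on (shell e 1))"
        by (rule continuous_imp_measurable_on_sets_lebesgue[OF c(2)]) simp
      have "integrable lborel (\<lambda>x. (norm (grad (\<phi> n) x))^2)"
        by (rule test_function_integrable[OF \<phi>[of n]]) (auto intro!: continuous_intros c)
      then have "integrable lebesgue (\<lambda>x. (norm (grad (\<phi> n) x))^2)" by (subst integrable_completion) auto
      then show "integrable (lebesgue_on (shell e 1)) (\<lambda>x. (norm (grad (\<phi> n) x))^2)"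
        using integrable_mult_indicator[of "shell e 1" lebesgue "\<lambda>x. (norm (grad (\<phi> n) x))^2"]
        by (subst integrable_restrict_space) auto
    qed
    fix t :: real assume t: "t > 0"
    define s where "s = sqrt (t / 4)"
    have s: "s > 0" "s^2 = t / 4" using t by (auto simp: s_def)
    define q where "q = t / 4 / ((\<alpha> / e)^2 + 1)"
    have ce: "(\<alpha> / e)^2 + 1 > 0" by (intro add_nonneg_pos) auto
    have q: "q > 0" using t ce by (simp add: q_def)
    obtain M1 where M1: "\<forall>m\<ge>M1. \<forall>n\<ge>M1. hardy_norm (\<lambda>x. \<phi> m x - \<phi> n x) < s" using C[OF s(1)] by blast
    obtain M2 where M2: "\<forall>m\<ge>M2. \<forall>n\<ge>M2. L2_dist2 (lebesgue_on (shell e 1)) (\<phi> m) (\<phi> n) < q"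
      using L2_tendsto_imp_Cauchy[OF u'] q unfolding L2_Cauchy_def by blast
    have "L2_dist2 (lebesgue_on (shell e 1)) (grad (\<phi> m)) (grad (\<phi> n)) < t"
      if "m \<ge> max M1 M2" "n \<ge> max M1 M2" for m n
    proof -
      note td = test_functions_diff[OF \<phi>[of m] \<phi>[of n]]
      note hb = hardy_norm_shell_bound[OF td N \<alpha>_def e]
      have "(hardy_norm (\<lambda>x. \<phi> m x - \<phi> n x))^2 < s^2"
        using M1 that hb(1) by (intro power_strict_mono) auto
      moreover have "2 * (\<alpha> / e)^2 * (LINT x|lebesgue_on (shell e 1). (\<phi> m x - \<phi> n x)^2) \<le> t / 2"
      proof -
        have "(LINT x|lebesgue_on (shell e 1). (\<phi> m x - \<phi> n x)^2) \<le> q" using M2 that by (simp add: less_imp_le)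
        then have "2 * (\<alpha> / e)^2 * (LINT x|lebesgue_on (shell e 1). (\<phi> m x - \<phi> n x)^2) \<le> 2 * ((\<alpha> / e)^2 + 1) * q"
          using q by (intro mult_mono) auto
        also have "\<dots> = 2 * (((\<alpha> / e)^2 + 1) * q)" by (rule mult.assoc)
        also have "((\<alpha> / e)^2 + 1) * q = t / 4"
          using ce nonzero_mult_div_cancel_left[of "(\<alpha> / e)^2 + 1" "t / 4"] by (simp only: q_def times_divide_eq_right)
        also have "2 * (t / 4) = t / 2" by simp
        finally show ?thesis .
      qed
      ultimately show ?thesis using hb(2) s(2) unfolding dg by linarith
    qed
    then show "\<exists>N. \<forall>m\<ge>N. \<forall>n\<ge>N. L2_dist2 (lebesgue_on (shell e 1)) (grad (\<phi> m)) (grad (\<phi> n)) < t" by blast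
  qed
  then obtain G where "L2_tendsto (lebesgue_on (shell e 1)) (\<lambda>n. grad (\<phi> n)) G" by (rule L2_complete)
  with \<phi> u' show ?thesis by blast
qed

section \<open>The Kelvin transform\<close>

lemma kelvin_eq: "kelvin w = (\<lambda>x::'a::euclidean_space. inverse (norm x) ^ (DIM('a) - 2) * w (inversion x))"
proof
  fix x :: 'a
  show "kelvin w x = inverse (norm x) ^ (DIM('a) - 2) * w (inversion x)"
    by (simp add: kelvin_def Let_def inversion_def[symmetric] norm_inversion)
qed

lemma kelvin_kelvin: "x \<noteq> 0 \<Longrightarrow> kelvin (kelvin w) x = w x"
  by (simp add: kelvin_eq norm_inversion power_mult_distrib[symmetric])

lemma has_derivative_inverse_norm:
  fixes x :: "'a::euclidean_space"
  assumes "x \<noteq> 0"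
  shows "((\<lambda>x. inverse (norm x)) has_derivative (\<lambda>h. - (inverse (norm x) ^ 3 * (x \<bullet> h)))) (at x)"
  by (rule has_derivative_eq_rhs, rule Deriv.has_derivative_inverse[of norm x, OF _ has_derivative_norm[OF assms]])
     (use assms in \<open>auto simp: sgn_div_norm inner_commute power3_eq_cube\<close>)

lemma has_derivative_inversion:
  fixes x :: "'a::euclidean_space"
  assumes "x \<noteq> 0"
  shows "(inversion has_derivative
     (\<lambda>h. (inverse (norm x))^2 *\<^sub>R h - (2 * inverse (norm x) ^ 4 * (x \<bullet> h)) *\<^sub>R x)) (at x)"
proof -
  have e: "inversion = (\<lambda>x::'a. (inverse (norm x))^2 *\<^sub>R x)"
    by (simp add: inversion_def[abs_def] power_inverse)
  show ?thesis unfolding e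
    by (rule has_derivative_eq_rhs,
        rule has_derivative_scaleR[OF has_derivative_power[OF has_derivative_inverse_norm[OF assms], of 2] has_derivative_ident])
       (auto simp: fun_eq_iff algebra_simps eval_nat_numeral)
qed

text \<open>
  The gradient of the Kelvin transform of p expressed by p and its gradient q. It is defined for
  arbitrary p and q so that it applies to the limit u and its weak gradient.
\<close>

definition kelvin_grad :: "('a::euclidean_space \<Rightarrow> real) \<Rightarrow> ('a \<Rightarrow> 'a) \<Rightarrow> 'a \<Rightarrow> 'a" where
  "kelvin_grad p q y = inverse (norm y) ^ DIM('a) *\<^sub>R (q (inversion y)
     - (2 * (inverse (norm y))^2 * (y \<bullet> q (inversion y)) + (real DIM('a) - 2) * p (inversion y)) *\<^sub>R y)"

lemma has_derivative_kelvin: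
  fixes \<phi> :: "'a::euclidean_space \<Rightarrow> real"
  assumes N: "DIM('a) \<ge> 2" and y: "y \<noteq> 0"
    and \<phi>: "(\<phi> has_derivative (\<lambda>h. q (inversion y) \<bullet> h)) (at (inversion y))"
  shows "(kelvin \<phi> has_derivative (\<lambda>h. kelvin_grad \<phi> q y \<bullet> h)) (at y)"
proof -
  obtain m where m: "DIM('a) = m + 2" using N by (metis add.commute le_Suc_ex)
  define g where "g = inverse (norm y)"
  have 1: "((\<lambda>x. inverse (norm x) ^ m) has_derivative (\<lambda>h. - (real m * g ^ (m + 2) * (y \<bullet> h)))) (at y)"
  proof (rule has_derivative_eq_rhs)
    show "((\<lambda>x. inverse (norm x) ^ m) has_derivative (\<lambda>h. of_nat m * (- (g ^ 3 * (y \<bullet> h))) * g ^ (m - 1))) (at y)"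
      unfolding g_def by (rule has_derivative_power[OF has_derivative_inverse_norm[OF y]])
    show "(\<lambda>h. of_nat m * (- (g ^ 3 * (y \<bullet> h))) * g ^ (m - 1)) = (\<lambda>h. - (real m * g ^ (m + 2) * (y \<bullet> h)))"
      by (cases m) (auto simp: fun_eq_iff power_add eval_nat_numeral mult_ac)
  qed
  have 2: "((\<lambda>x. \<phi> (inversion x)) has_derivative (\<lambda>h. q (inversion y) \<bullet> (g^2 *\<^sub>R h - (2 * g ^ 4 * (y \<bullet> h)) *\<^sub>R y))) (at y)"
    unfolding g_def by (rule has_derivative_compose[OF has_derivative_inversion[OF y] \<phi>])
  have "((\<lambda>x. inverse (norm x) ^ m * \<phi> (inversion x)) has_derivative
      (\<lambda>h. g ^ m * (q (inversion y) \<bullet> (g^2 *\<^sub>R h - (2 * g ^ 4 * (y \<bullet> h)) *\<^sub>R y))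
         + (- (real m * g ^ (m + 2) * (y \<bullet> h))) * \<phi> (inversion y))) (at y)"
    using has_derivative_mult[OF 1 2] by (simp add: g_def)
  moreover have "(\<lambda>h. g ^ m * (q (inversion y) \<bullet> (g^2 *\<^sub>R h - (2 * g ^ 4 * (y \<bullet> h)) *\<^sub>R y))
         + (- (real m * g ^ (m + 2) * (y \<bullet> h))) * \<phi> (inversion y)) = (\<lambda>h. kelvin_grad \<phi> q y \<bullet> h)"
    by (auto simp: fun_eq_iff kelvin_grad_def m g_def[symmetric] inner_diff_left inner_diff_right inner_commute[of _ y]
      power_add eval_nat_numeral algebra_simps)
  ultimately show ?thesis by (simp add: kelvin_eq m)
qed

lemma smooth_on_kelvin:
  fixes \<phi> :: "'a::euclidean_space \<Rightarrow> real"
  assumes S: "open S" "0 \<notin> S" and \<phi>: "smooth_on UNIV \<phi>"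
  shows "smooth_on S (kelvin \<phi>)"
  unfolding smooth_on_def kelvin_eq
proof
  fix k
  have i: "Ck_on k S (\<lambda>x. inverse (norm x))"
    by (rule Ck_on_inverse[OF S(1) _ Ck_on_norm[OF S]]) (use S(2) in auto)
  have inv: "Ck_on k S (\<lambda>x. inversion x \<bullet> b)" for b
    using Ck_on_mult[OF S(1) Ck_on_power[OF S(1) i, of 2] Ck_on_inner[OF S(1), of k b]]
    by (simp add: inversion_def power_inverse)
  show "Ck_on k S (\<lambda>x. inverse (norm x) ^ (DIM('a) - 2) * \<phi> (inversion x))"
  proof (rule Ck_on_mult[OF S(1) Ck_on_power[OF S(1) i]])
    show "Ck_on k S (\<lambda>x. \<phi> (inversion x))"
      by (rule Ck_on_compose[OF S(1) open_UNIV _ _ inv]) (use \<phi> in \<open>auto simp: smooth_on_def\<close>)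
  qed
qed

lemma grad_kelvin:
  fixes \<phi> :: "'a::euclidean_space \<Rightarrow> real"
  assumes "DIM('a) \<ge> 2" "y \<noteq> 0" "smooth_on UNIV \<phi>"
  shows "grad (kelvin \<phi>) y = kelvin_grad \<phi> (grad \<phi>) y"
  by (rule grad_eqI, rule has_derivative_kelvin) (use assms smooth_on_has_derivative in auto)

text \<open>
  The vector field whose length on one side of the inversion is, up to the
  Jacobian, the length of \<open>kelvin_grad\<close> on the other side.
\<close>

definition kelvin_flux :: "('a::euclidean_space \<Rightarrow> real) \<Rightarrow> ('a \<Rightarrow> 'a) \<Rightarrow> 'a \<Rightarrow> 'a" where
  "kelvin_flux p q x = q x + ((real DIM('a) - 2) * p x / (norm x)^2) *\<^sub>R x"

text \<open>
  The derivative of the inversion is |y|^(-2) times the reflection Q \<mapsto> Q - 2 (Q \<bullet> y) y / |y|^2.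
  The reflection preserves lengths and changes the sign of the product with y, which accounts for
  the change of sign of the second term.
\<close>

lemma norm_kelvin_grad:
  fixes y :: "'a::euclidean_space"
  assumes y: "y \<noteq> 0"
  shows "(norm (kelvin_grad p q y))^2 = inversion_density y * (norm (kelvin_flux p q (inversion y)))^2"
proof -
  define g where "g = inverse (norm y)"
  have gy: "g^2 * (y \<bullet> y) = 1" using y by (simp add: g_def power2_norm_eq_inner[symmetric] power_inverse)
  define Q where "Q = q (inversion y)"
  define c where "c = (real DIM('a) - 2) * p (inversion y)"
  have inv: "inversion y = g^2 *\<^sub>R y" by (simp add: inversion_def g_def power_inverse)
  have n: "norm (inversion y) = g" by (simp add: norm_inversion g_def)
  have "g \<noteq> 0" using y by (simp add: g_def)
  then have "(c / g^2) *\<^sub>R (g^2 *\<^sub>R y) = c *\<^sub>R y" by simp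
  then have "((real DIM('a) - 2) * p (inversion y) / (norm (inversion y))^2) *\<^sub>R inversion y = c *\<^sub>R y"
    unfolding n c_def[symmetric] unfolding inv .
  then have f: "kelvin_flux p q (inversion y) = Q + c *\<^sub>R y" by (simp add: kelvin_flux_def Q_def)
  have k: "kelvin_grad p q y = g ^ DIM('a) *\<^sub>R (Q - (2 * g^2 * (y \<bullet> Q) + c) *\<^sub>R y)"
    by (simp add: kelvin_grad_def g_def Q_def c_def)
  define t where "t = y \<bullet> Q"
  have "(norm (Q - (2 * g^2 * t + c) *\<^sub>R y))^2
     = Q \<bullet> Q - 2 * (2 * g^2 * t + c) * t + (2 * g^2 * t + c)^2 * (y \<bullet> y)"
    unfolding power2_norm_eq_inner by (simp add: inner_diff_left inner_diff_right inner_commute[of Q y] t_def power2_eq_square algebra_simps)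
  also have "(2 * g^2 * t + c)^2 * (y \<bullet> y) = 4 * g^2 * t^2 * (g^2 * (y \<bullet> y)) + 4 * t * c * (g^2 * (y \<bullet> y)) + c^2 * (y \<bullet> y)"
    by (simp add: power2_eq_square algebra_simps)
  also have "\<dots> = 4 * g^2 * t^2 + 4 * t * c + c^2 * (y \<bullet> y)" unfolding gy by simp
  also have "Q \<bullet> Q - 2 * (2 * g^2 * t + c) * t + \<dots> = Q \<bullet> Q + 2 * c * t + c^2 * (y \<bullet> y)"
    by (simp add: power2_eq_square algebra_simps)
  also have "\<dots> = (norm (Q + c *\<^sub>R y))^2"
    unfolding power2_norm_eq_inner by (simp add: inner_add_left inner_add_right inner_commute[of Q y] t_def power2_eq_square algebra_simps)
  finally have "(norm (Q - (2 * g^2 * t + c) *\<^sub>R y))^2 = (norm (Q + c *\<^sub>R y))^2" .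
  then show ?thesis unfolding k f by (simp add: power_mult_distrib t_def g_def power_mult[symmetric] mult.commute)
qed

lemma kelvin_grad_diff: "kelvin_grad p q y - kelvin_grad p' q' y = kelvin_grad (\<lambda>x. p x - p' x) (\<lambda>x. q x - q' x) y"
  by (simp add: kelvin_grad_def algebra_simps inner_diff_right)

lemma kelvin_flux_diff: "kelvin_flux p q y - kelvin_flux p' q' y = kelvin_flux (\<lambda>x. p x - p' x) (\<lambda>x. q x - q' x) y"
  for p p' :: "'a::euclidean_space \<Rightarrow> real"
proof -
  have "(real DIM('a) - 2) * (p y - p' y) / (norm y)^2
      = (real DIM('a) - 2) * p y / (norm y)^2 - (real DIM('a) - 2) * p' y / (norm y)^2"
    by (simp only: right_diff_distrib diff_divide_distrib)
  then show ?thesis by (simp add: kelvin_flux_def scaleR_diff_left)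
qed

lemma borel_measurable_lebesgue_on:
  "f \<in> borel_measurable borel \<Longrightarrow> f \<in> borel_measurable (lebesgue_on S)"
  by (rule measurable_restrict_space1, rule measurable_completion) simp

lemma kelvin_measurable:
  fixes p :: "'a::euclidean_space \<Rightarrow> real"
  assumes e: "0 < e" "e < 1" and p: "p \<in> borel_measurable (lebesgue_on (shell e 1))"
  shows "kelvin p \<in> borel_measurable (lebesgue_on (shell 1 (1 / e)))"
proof -
  have [measurable]: "(\<lambda>x::'a. inverse (norm x)) \<in> borel_measurable (lebesgue_on (shell 1 (1 / e)))"
    by (rule borel_measurable_lebesgue_on) measurable
  show ?thesis unfolding kelvin_eq using borel_measurable_inversion_shell[OF e p] by measurable
qed

lemma kelvin_grad_measurable:
  fixes p :: "'a::euclidean_space \<Rightarrow> real"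
  assumes e: "0 < e" "e < 1" and p: "p \<in> borel_measurable (lebesgue_on (shell e 1))"
    and q: "q \<in> borel_measurable (lebesgue_on (shell e 1))"
  shows "kelvin_grad p q \<in> borel_measurable (lebesgue_on (shell 1 (1 / e)))"
proof -
  have [measurable]: "(\<lambda>x::'a. inverse (norm x)) \<in> borel_measurable (lebesgue_on (shell 1 (1 / e)))"
    "(\<lambda>x::'a. x) \<in> borel_measurable (lebesgue_on (shell 1 (1 / e)))"
    by (rule borel_measurable_lebesgue_on, measurable)+
  show ?thesis unfolding kelvin_grad_def[abs_def]
    using borel_measurable_inversion_shell[OF e p] borel_measurable_inversion_shell[OF e q] by measurable
qed

text \<open>
  If A is pointwise as long as B at the inverted point, weighted with the square root of the
  Jacobian, then the two have the same L^2 norm. This is used with B a multiple of u, and with B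
  the field \<open>kelvin_flux\<close>.
\<close>

lemma L2_tendsto_inversion_shell:
  fixes A :: "nat \<Rightarrow> 'a::euclidean_space \<Rightarrow> 'b::euclidean_space" and B :: "nat \<Rightarrow> 'a \<Rightarrow> 'c::euclidean_space"
  assumes e: "0 < e" "e < 1" and B: "L2_tendsto (lebesgue_on (shell e 1)) B B0"
    and m: "\<And>n. A n \<in> borel_measurable (lebesgue_on (shell 1 (1 / e)))" "A0 \<in> borel_measurable (lebesgue_on (shell 1 (1 / e)))"
    and n: "\<And>n y. y \<in> shell 1 (1 / e) \<Longrightarrow> (norm (A n y))^2 = inversion_density y * (norm (B n (inversion y)))^2"
      "\<And>y. y \<in> shell 1 (1 / e) \<Longrightarrow> (norm (A0 y))^2 = inversion_density y * (norm (B0 (inversion y)))^2"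
      "\<And>n y. y \<in> shell 1 (1 / e) \<Longrightarrow> (norm (A n y - A0 y))^2 = inversion_density y * (norm (B n (inversion y) - B0 (inversion y)))^2"
  shows "L2_tendsto (lebesgue_on (shell 1 (1 / e))) A A0"
proof (rule L2_tendsto_squeeze[OF _ _ _ L2_tendstoD(3)[OF B]])
  note b = L2_tendstoD[OF B]
  have *: "a \<in> L2_space (lebesgue_on (shell 1 (1 / e)))"
    "(LINT y|lebesgue_on (shell 1 (1 / e)). (norm (a y))^2) = (LINT x|lebesgue_on (shell e 1). (norm (b x))^2)"
    if bb: "b \<in> L2_space (lebesgue_on (shell e 1))" and ma: "a \<in> borel_measurable (lebesgue_on (shell 1 (1 / e)))"
      and ab: "\<And>y. y \<in> shell 1 (1 / e) \<Longrightarrow> (norm (a y))^2 = inversion_density y * (norm (b (inversion y)))^2"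
    for a :: "'a \<Rightarrow> 'b" and b :: "'a \<Rightarrow> 'c"
  proof -
    have mb: "(\<lambda>x. (norm (b x))^2) \<in> borel_measurable (lebesgue_on (shell e 1))" using L2_spaceD(2)[OF bb] by auto
    note inv = integral_inversion_shell[OF e mb]
    have c: "integrable (lebesgue_on (shell 1 (1 / e))) (\<lambda>y. (norm (a y))^2) \<longleftrightarrow>
      integrable (lebesgue_on (shell 1 (1 / e))) (\<lambda>y. inversion_density y * (norm (b (inversion y)))^2)"
      "(LINT y|lebesgue_on (shell 1 (1 / e)). (norm (a y))^2) =
       (LINT y|lebesgue_on (shell 1 (1 / e)). inversion_density y * (norm (b (inversion y)))^2)"
      by (rule Bochner_Integration.integrable_cong Bochner_Integration.integral_cong; use ab in simp)+
    show "a \<in> L2_space (lebesgue_on (shell 1 (1 / e)))"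
      by (rule L2_spaceI[OF ma]) (use c(1) inv(1) L2_spaceD(2)[OF bb] in simp)
    show "(LINT y|lebesgue_on (shell 1 (1 / e)). (norm (a y))^2) = (LINT x|lebesgue_on (shell e 1). (norm (b x))^2)"
      using c(2) inv(2) by simp
  qed
  show "A n \<in> L2_space (lebesgue_on (shell 1 (1 / e)))" for n by (rule *(1)[OF b(1) m(1) n(1)])
  show "A0 \<in> L2_space (lebesgue_on (shell 1 (1 / e)))" by (rule *(1)[OF b(2) m(2) n(2)])
  show "L2_dist2 (lebesgue_on (shell 1 (1 / e))) (A k) A0 \<le> L2_dist2 (lebesgue_on (shell e 1)) (B k) B0" for k
    using *(2)[OF L2_space_diff[OF b(1)[of k] b(2)], of "\<lambda>x. A k x - A0 x"] m n(3)[of _ k] by simp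
qed

lemma L2_tendsto_shell_scale:
  fixes p :: "nat \<Rightarrow> 'a::euclidean_space \<Rightarrow> real"
  assumes e: "0 < e" and p: "L2_tendsto (lebesgue_on (shell e 1)) p p0"
  shows "L2_tendsto (lebesgue_on (shell e 1)) (\<lambda>n x. p n x / (norm x)^2) (\<lambda>x. p0 x / (norm x)^2)"
    and "L2_tendsto (lebesgue_on (shell e 1)) (\<lambda>n x. (p n x / (norm x)^2) *\<^sub>R x) (\<lambda>x. (p0 x / (norm x)^2) *\<^sub>R x)"
proof -
  have [measurable]: "(norm :: 'a \<Rightarrow> real) \<in> borel_measurable (lebesgue_on (shell e 1))"
    "(\<lambda>x::'a. x) \<in> borel_measurable (lebesgue_on (shell e 1))"
    by (rule borel_measurable_lebesgue_on, measurable)+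
  note [measurable] = L2_spaceD(1)[OF L2_tendstoD(1)[OF p]] L2_spaceD(1)[OF L2_tendstoD(2)[OF p]]
  have b: "inverse ((norm x)^2) \<le> inverse (e^2)" "inverse (norm x) \<le> inverse e" if "x \<in> shell e 1" for x :: 'a
    using that e by (auto simp: shell_def intro!: le_imp_inverse_le power_mono)
  have 1: "norm (a / (norm x)^2) \<le> inverse (e^2) * norm a" if "x \<in> shell e 1" for a and x :: 'a
    using mult_right_mono[OF b(1)[OF that], of "\<bar>a\<bar>"] by (simp add: divide_inverse mult.commute abs_mult power_abs)
  have 2: "norm ((a / (norm x)^2) *\<^sub>R x) \<le> inverse e * norm a" if "x \<in> shell e 1" for a and x :: 'a
  proof -
    have "norm x > 0" using that e by (auto simp: shell_def)
    then have "norm ((a / (norm x)^2) *\<^sub>R x) = inverse (norm x) * \<bar>a\<bar>" by (simp add: power2_eq_square field_simps)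
    also have "\<dots> \<le> inverse e * \<bar>a\<bar>" by (rule mult_right_mono[OF b(2)[OF that]]) simp
    finally show ?thesis by simp
  qed
  show "L2_tendsto (lebesgue_on (shell e 1)) (\<lambda>n x. p n x / (norm x)^2) (\<lambda>x. p0 x / (norm x)^2)"
    by (rule L2_tendsto_bounded_map[OF p, where C = "inverse (e^2)"])
       (measurable, auto intro!: AE_I2 1 simp del: real_norm_def simp: diff_divide_distrib[symmetric])
  show "L2_tendsto (lebesgue_on (shell e 1)) (\<lambda>n x. (p n x / (norm x)^2) *\<^sub>R x) (\<lambda>x. (p0 x / (norm x)^2) *\<^sub>R x)"
    by (rule L2_tendsto_bounded_map[OF p, where C = "inverse e"])
       (measurable, auto intro!: AE_I2 2 simp del: real_norm_def norm_scaleR simp: diff_divide_distrib[symmetric] scaleR_diff_left[symmetric])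
qed

lemma L2_tendsto_kelvin_flux:
  fixes p :: "nat \<Rightarrow> 'a::euclidean_space \<Rightarrow> real"
  assumes e: "0 < e" and p: "L2_tendsto (lebesgue_on (shell e 1)) p p0" and q: "L2_tendsto (lebesgue_on (shell e 1)) q q0"
  shows "L2_tendsto (lebesgue_on (shell e 1)) (\<lambda>n. kelvin_flux (p n) (q n)) (kelvin_flux p0 q0)"
proof -
  have "L2_tendsto (lebesgue_on (shell e 1)) (\<lambda>n x. (real DIM('a) - 2) * p n x) (\<lambda>x. (real DIM('a) - 2) * p0 x)"
    by (rule L2_tendsto_bounded_map[OF p, where C = "\<bar>real DIM('a) - 2\<bar>"])
       (use L2_spaceD(1)[OF L2_tendstoD(1)[OF p]] L2_spaceD(1)[OF L2_tendstoD(2)[OF p]] in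
         \<open>auto simp: abs_mult[symmetric] right_diff_distrib\<close>)
  from L2_tendsto_add[OF q L2_tendsto_shell_scale(2)[OF e this]] show ?thesis
    unfolding kelvin_flux_def[abs_def] .
qed

lemma kelvin_power2:
  fixes y :: "'a::euclidean_space"
  assumes N: "DIM('a) \<ge> 2" and y: "y \<noteq> 0"
  shows "(kelvin p y)^2 = inversion_density y * (p (inversion y) / (norm (inversion y))^2)^2"
proof -
  obtain m where m: "DIM('a) = m + 2" using N by (metis add.commute le_Suc_ex)
  have "inverse (norm y) ^ (2 * (m + 2)) = (inverse (norm y) ^ m)^2 * (inverse (norm y) ^ 2)^2"
  proof -
    have "2 * (m + 2) = m * 2 + 2 * 2" by simp
    then show ?thesis by (simp only: power_add power_mult)
  qed
  then show ?thesis using y by (simp add: kelvin_eq m norm_inversion power_mult_distrib power_divide divide_inverse power_inverse)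
qed

lemma L2_tendsto_kelvin:
  fixes p :: "nat \<Rightarrow> 'a::euclidean_space \<Rightarrow> real"
  assumes N: "DIM('a) \<ge> 2" and e: "0 < e" "e < 1" and p: "L2_tendsto (lebesgue_on (shell e 1)) p p0"
  shows "L2_tendsto (lebesgue_on (shell 1 (1 / e))) (\<lambda>n. kelvin (p n)) (kelvin p0)"
proof (rule L2_tendsto_inversion_shell[OF e L2_tendsto_shell_scale(1)[OF e(1) p]])
  show "kelvin (p n) \<in> borel_measurable (lebesgue_on (shell 1 (1 / e)))" for n
    by (rule kelvin_measurable[OF e L2_spaceD(1)[OF L2_tendstoD(1)[OF p]]])
  show "kelvin p0 \<in> borel_measurable (lebesgue_on (shell 1 (1 / e)))"
    by (rule kelvin_measurable[OF e L2_spaceD(1)[OF L2_tendstoD(2)[OF p]]])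
  fix y :: 'a and n assume "y \<in> shell 1 (1 / e)"
  then have y: "y \<noteq> 0" by (auto simp: shell_def)
  show "(norm (kelvin (p n) y))^2 = inversion_density y * (norm (p n (inversion y) / (norm (inversion y))^2))^2"
    unfolding real_norm_def power2_abs by (rule kelvin_power2[OF N y])
  show "(norm (kelvin p0 y))^2 = inversion_density y * (norm (p0 (inversion y) / (norm (inversion y))^2))^2"
    unfolding real_norm_def power2_abs by (rule kelvin_power2[OF N y])
  have d: "kelvin (p n) y - kelvin p0 y = kelvin (\<lambda>x. p n x - p0 x) y" by (simp add: kelvin_eq right_diff_distrib)
  show "(norm (kelvin (p n) y - kelvin p0 y))^2 = inverse (norm y) ^ (2 * DIM('a))
      * (norm (p n (inversion y) / (norm (inversion y))^2 - p0 (inversion y) / (norm (inversion y))^2))^2"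
    unfolding d diff_divide_distrib[symmetric] real_norm_def power2_abs by (rule kelvin_power2[OF N y])
qed

lemma L2_tendsto_kelvin_grad:
  fixes p :: "nat \<Rightarrow> 'a::euclidean_space \<Rightarrow> real"
  assumes e: "0 < e" "e < 1" and p: "L2_tendsto (lebesgue_on (shell e 1)) p p0" and q: "L2_tendsto (lebesgue_on (shell e 1)) q q0"
  shows "L2_tendsto (lebesgue_on (shell 1 (1 / e))) (\<lambda>n. kelvin_grad (p n) (q n)) (kelvin_grad p0 q0)"
proof (rule L2_tendsto_inversion_shell[OF e L2_tendsto_kelvin_flux[OF e(1) p q]])
  show "kelvin_grad (p n) (q n) \<in> borel_measurable (lebesgue_on (shell 1 (1 / e)))" for n
    by (rule kelvin_grad_measurable[OF e L2_spaceD(1)[OF L2_tendstoD(1)[OF p]] L2_spaceD(1)[OF L2_tendstoD(1)[OF q]]])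
  show "kelvin_grad p0 q0 \<in> borel_measurable (lebesgue_on (shell 1 (1 / e)))"
    by (rule kelvin_grad_measurable[OF e L2_spaceD(1)[OF L2_tendstoD(2)[OF p]] L2_spaceD(1)[OF L2_tendstoD(2)[OF q]]])
  fix y :: 'a and n assume "y \<in> shell 1 (1 / e)"
  then have y: "y \<noteq> 0" by (auto simp: shell_def)
  show "(norm (kelvin_grad (p n) (q n) y))^2 = inversion_density y * (norm (kelvin_flux (p n) (q n) (inversion y)))^2"
    "(norm (kelvin_grad p0 q0 y))^2 = inversion_density y * (norm (kelvin_flux p0 q0 (inversion y)))^2"
    "(norm (kelvin_grad (p n) (q n) y - kelvin_grad p0 q0 y))^2 = inversion_density y *
      (norm (kelvin_flux (p n) (q n) (inversion y) - kelvin_flux p0 q0 (inversion y)))^2"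
    unfolding kelvin_grad_diff kelvin_flux_diff by (rule norm_kelvin_grad[OF y])+
qed

section \<open>The flux through the inner sphere\<close>

text \<open>
  The integral of div (u^2 x / |x|^2) over the annulus, where G is the gradient of u. It is
  written with inner products of two L^2 functions, which makes its continuity evident.
\<close>

definition radial_flux :: "real \<Rightarrow> ('a::euclidean_space \<Rightarrow> real) \<Rightarrow> ('a \<Rightarrow> 'a) \<Rightarrow> real" where
  "radial_flux e u G = 2 * (LINT x|lebesgue_on (shell e 1). ((u x / (norm x)^2) *\<^sub>R x) \<bullet> G x)
    + (real DIM('a) - 2) * (LINT x|lebesgue_on (shell e 1). (u x / (norm x)^2) \<bullet> u x)"

text \<open>
  The divergence is the radial derivative of F = |x|^(N-2) \<phi>^2, divided by |x|^(N-1).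
  The support of \<phi> lies in the open unit ball, so F vanishes on the outer sphere.
\<close>

lemma boundary_flux_test_function:
  fixes \<phi> :: "'a::euclidean_space \<Rightarrow> real"
  assumes N: "DIM('a) \<ge> 3" and e: "0 < e" "e < 1" and \<phi>: "\<phi> \<in> test_functions (ball 0 1)"
    and L: "\<phi> \<in> L2_space (lebesgue_on (shell e 1))" "grad \<phi> \<in> L2_space (lebesgue_on (shell e 1))"
  shows "radial_flux e \<phi> (grad \<phi>)
      = - (inverse e * (LINT x|sphere_measure e. (\<phi> x)^2))"
proof -
  obtain m where m: "DIM('a) = Suc m + 2" using N by (metis Suc_eq_plus1 add_2_eq_Suc' numeral_3_eq_3 le_iff_add add.commute add_Suc_right)
  note sm = smooth_on_has_derivative[OF test_functions_smooth[OF \<phi>, of UNIV] UNIV_I]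
  note c = test_functions_continuous[OF \<phi>]
  define F where "F x = norm x ^ Suc m * (\<phi> x)^2" for x
  define D where "D x = (real (Suc m) * norm x ^ m * (\<phi> x)^2) *\<^sub>R sgn x + (2 * norm x ^ Suc m * \<phi> x) *\<^sub>R grad \<phi> x" for x
  have F: "(F has_derivative (\<lambda>h. D x \<bullet> h)) (at x)" if "e \<le> norm x" for x
  proof -
    have x: "x \<noteq> 0" using that e by auto
    have "(F has_derivative (\<lambda>h. norm x ^ Suc m * (of_nat 2 * (grad \<phi> x \<bullet> h) * \<phi> x ^ (2 - 1))
        + (of_nat (Suc m) * (h \<bullet> sgn x) * norm x ^ (Suc m - 1)) * (\<phi> x)^2)) (at x)"
      unfolding F_def[abs_def]
      by (intro has_derivative_mult has_derivative_power has_derivative_norm x sm)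
    then show ?thesis
      by (rule has_derivative_eq_rhs)
         (auto simp: D_def fun_eq_iff inner_add_left inner_commute[of _ "sgn x"] algebra_simps)
  qed
  have cD: "continuous_on {x. e \<le> norm x \<and> norm x \<le> 1} D"
    unfolding D_def sgn_div_norm by (intro continuous_intros c) (use e in auto)
  note div = integral_annulus_radial_derivative[OF e F cD]
  let ?S = "lebesgue_on (shell e 1)"
  note sc = L2_tendsto_shell_scale[OF e(1) L2_tendsto_const[OF L(1)], THEN L2_tendstoD(2)]
  note i1 = L2_inner_integrable[OF sc(2) L(2)] and i2 = L2_inner_integrable[OF sc(1) L(1)]
  have "radial_flux e \<phi> (grad \<phi>)
    = (LINT x|?S. 2 * (((\<phi> x / (norm x)^2) *\<^sub>R x) \<bullet> grad \<phi> x) + (real DIM('a) - 2) * ((\<phi> x / (norm x)^2) \<bullet> \<phi> x))"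
    unfolding radial_flux_def by (subst Bochner_Integration.integral_add)
       (use integrable_mult_right[OF i1, of 2] integrable_mult_right[OF i2, of "real DIM('a) - 2"] in \<open>simp_all only: integral_mult_right_zero\<close>)
  also have "\<dots> = (LINT x|?S. (D x \<bullet> x) / norm x ^ DIM('a))"
  proof (rule LINT_cong)
    fix x :: 'a assume "x \<in> space ?S"
    then have x: "norm x > 0" using e by (auto simp: shell_def)
    have "sgn x \<bullet> x = norm x" using x by (simp add: sgn_div_norm dot_square_norm power2_eq_square)
    then have "(D x \<bullet> x) = norm x ^ Suc m * (real (Suc m) * (\<phi> x)^2 + 2 * \<phi> x * (grad \<phi> x \<bullet> x))"
      by (simp add: D_def inner_add_left algebra_simps)
    moreover have "norm x ^ DIM('a) = norm x ^ Suc m * (norm x)^2" by (simp only: m power_add)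
    ultimately have "(D x \<bullet> x) / norm x ^ DIM('a) = (real (Suc m) * (\<phi> x)^2 + 2 * \<phi> x * (grad \<phi> x \<bullet> x)) / (norm x)^2"
      using x by simp
    then show "2 * (((\<phi> x / (norm x)^2) *\<^sub>R x) \<bullet> grad \<phi> x) + (real DIM('a) - 2) * ((\<phi> x / (norm x)^2) \<bullet> \<phi> x)
      = (D x \<bullet> x) / norm x ^ DIM('a)"
      by (simp add: m inner_commute[of x] add_divide_distrib power2_eq_square[of "\<phi> x"])
  qed
  also have "\<dots> = (LINT \<omega>|sphere_measure 1. F (1 *\<^sub>R \<omega>) - F (e *\<^sub>R \<omega>))" by (rule div(2))
  also have "\<dots> = (LINT \<omega>|sphere_measure 1. - (e ^ Suc m * (\<phi> (e *\<^sub>R \<omega>))^2))"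
  proof (rule LINT_cong)
    fix \<omega> :: 'a assume "\<omega> \<in> space (sphere_measure 1)"
    then have w: "norm \<omega> = 1" by simp
    obtain K where K: "K \<subseteq> ball (0::'a) 1" "\<And>x. x \<notin> K \<Longrightarrow> \<phi> x = 0" using test_functionsE[OF \<phi>] by metis
    have "\<phi> \<omega> = 0" by (rule K(2)) (use w K(1) in auto)
    then show "F (1 *\<^sub>R \<omega>) - F (e *\<^sub>R \<omega>) = - (e ^ Suc m * (\<phi> (e *\<^sub>R \<omega>))^2)" using e w by (simp add: F_def)
  qed
  also have "\<dots> = - (e ^ Suc m * (LINT \<omega>|sphere_measure 1. (\<phi> (e *\<^sub>R \<omega>))^2))" by simp
  also have "e ^ Suc m * (LINT \<omega>|sphere_measure 1. (\<phi> (e *\<^sub>R \<omega>))^2) = inverse e * (LINT x|sphere_measure e. (\<phi> x)^2)"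
  proof -
    have "(\<lambda>x. (\<phi> x)^2) \<in> borel_measurable (sphere_measure e)"
      using L2_spaceD(2)[OF continuous_sphere_L2[OF e(1) c(1)]] by auto
    from sphere_measure_integral(2)[OF e(1) this] show ?thesis using e by (simp add: m)
  qed
  finally show ?thesis .
qed

lemma boundary_flux_limit:
  fixes \<phi> :: "nat \<Rightarrow> 'a::euclidean_space \<Rightarrow> real"
  assumes N: "DIM('a) \<ge> 3" and e: "0 < e" "e < 1" and \<phi>: "\<And>n. \<phi> n \<in> test_functions (ball 0 1)"
    and u: "L2_tendsto (lebesgue_on (shell e 1)) \<phi> u" and G: "L2_tendsto (lebesgue_on (shell e 1)) (\<lambda>n. grad (\<phi> n)) G"
    and g: "L2_tendsto (sphere_measure e) \<phi> g"
  shows "radial_flux e u G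
      = - (inverse e * (LINT x|sphere_measure e. (g x)^2))"
proof (rule LIMSEQ_unique)
  show "(\<lambda>n. radial_flux e (\<phi> n) (grad (\<phi> n))) \<longlonglongrightarrow>
      radial_flux e u G"
    unfolding radial_flux_def by (intro tendsto_add tendsto_mult tendsto_const L2_tendsto_inner L2_tendsto_shell_scale[OF e(1) u] u G)
  have "(\<lambda>n. - (inverse e * (LINT x|sphere_measure e. (\<phi> n x)^2))) \<longlonglongrightarrow> - (inverse e * (LINT x|sphere_measure e. (g x)^2))"
    using L2_tendsto_norm2[OF g] by (intro tendsto_minus tendsto_mult tendsto_const) simp
  then show "(\<lambda>n. radial_flux e (\<phi> n) (grad (\<phi> n)))
      \<longlonglongrightarrow> - (inverse e * (LINT x|sphere_measure e. (g x)^2))"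
    using boundary_flux_test_function[OF N e \<phi> L2_tendstoD(1)[OF u] L2_tendstoD(1)[OF G]] by presburger
qed

text \<open>
  On the sphere |x| = 1/e the Kelvin transform multiplies by e^(N-2), and the
  surface measures of the two spheres scale with e^(1-N) and e^(N-1).
\<close>

lemma sphere_integral_kelvin:
  fixes \<phi> :: "'a::euclidean_space \<Rightarrow> real"
  assumes N: "DIM('a) \<ge> 2" and e: "0 < e" and \<phi>: "continuous_on UNIV \<phi>"
  shows "inverse (1 / e) * (LINT x|sphere_measure (1 / e). (kelvin \<phi> x)^2) = inverse e * (LINT x|sphere_measure e. (\<phi> x)^2)"
proof -
  obtain m where m: "DIM('a) = m + 2" using N by (metis add.commute le_Suc_ex)
  have R: "1 / e > 0" using e by simp
  have "continuous_on (sphere 0 (1 / e)) (kelvin \<phi> :: 'a \<Rightarrow> real)"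
    unfolding kelvin_eq inversion_def
    by (intro continuous_intros continuous_on_compose2[OF \<phi>]) (use e in auto)
  then have k: "(\<lambda>x::'a. (kelvin \<phi> x)^2) \<in> borel_measurable (sphere_measure (1 / e))"
    using L2_spaceD(2)[OF continuous_sphere_L2[OF R]] by auto
  have p: "(\<lambda>x. (\<phi> x)^2) \<in> borel_measurable (sphere_measure e)"
    using L2_spaceD(2)[OF continuous_sphere_L2[OF e continuous_on_subset[OF \<phi>]]] by auto
  let ?I = "LINT x|sphere_measure 1. (\<phi> (e *\<^sub>R x))^2"
  have "(LINT x|sphere_measure 1. (kelvin \<phi> ((1 / e) *\<^sub>R x))^2) = (LINT x|sphere_measure 1. (e ^ m)^2 * (\<phi> (e *\<^sub>R x))^2)"
  proof (rule LINT_cong)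
    fix x :: 'a assume "x \<in> space (sphere_measure 1)"
    then have x: "norm x = 1" by simp
    have "norm ((1 / e) *\<^sub>R x) = 1 / e" using e x by simp
    moreover have "inversion ((1 / e) *\<^sub>R x) = e *\<^sub>R x" using e x by (simp add: inversion_def power2_eq_square)
    ultimately show "(kelvin \<phi> ((1 / e) *\<^sub>R x))^2 = (e ^ m)^2 * (\<phi> (e *\<^sub>R x))^2"
      using e by (simp add: kelvin_eq m power_mult_distrib)
  qed
  then have "(LINT x|sphere_measure (1 / e). (kelvin \<phi> x)^2) = (1 / e) ^ (m + 1) * ((e ^ m)^2 * ?I)"
    unfolding sphere_measure_integral(2)[OF R k] by (simp add: m)
  moreover have "(LINT x|sphere_measure e. (\<phi> x)^2) = e ^ (m + 1) * ?I"
    unfolding sphere_measure_integral(2)[OF e p] by (simp add: m)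
  moreover have "inverse (1 / e) * ((1 / e) ^ (m + 1) * ((e ^ m)^2 * ?I)) = inverse e * (e ^ (m + 1) * ?I)"
    using e by (simp add: field_simps power2_eq_square)
  ultimately show ?thesis by (simp only:)
qed

section \<open>Transformation of the Hardy functional\<close>

text \<open>
  The set difference of the balls contains the inner sphere, which is a null set.
\<close>

lemma integral_annulus_eq_shell:
  fixes f :: "'a::euclidean_space \<Rightarrow> real"
  assumes "0 < a" and f: "f \<in> borel_measurable (lebesgue_on (shell a b))"
  shows "(LINT x|lebesgue_on (ball 0 b - ball 0 a). f x) = (LINT x|lebesgue_on (shell a b). f x)"
proof -
  let ?T = "ball 0 b - ball 0 a :: 'a set"
  let ?f = "\<lambda>S x. if x \<in> S then f x else 0"
  have m: "?f (shell a b) \<in> borel_measurable lebesgue" using f by (subst borel_measurable_if) auto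
  have ae: "AE x in lebesgue. ?f (shell a b) x = ?f ?T x"
    using AE_completion[OF AE_not_norm_eq[of a, where 'a = 'a]] by eventually_elim (auto simp: shell_def)
  have m': "?f ?T \<in> borel_measurable lebesgue" by (rule borel_measurable_AE[OF m ae])
  have "(LINT x|lebesgue. ?f (shell a b) x) = (LINT x|lebesgue. ?f ?T x)" by (rule integral_cong_AE[OF m m' ae])
  then show ?thesis
    using Lebesgue_Measure.integral_restrict_UNIV[of "shell a b" f] Lebesgue_Measure.integral_restrict_UNIV[of ?T f] by simp
qed

lemma hardy_I_eq:
  fixes u :: "'a::euclidean_space \<Rightarrow> real"
  assumes a: "0 < a" and wg: "has_weak_grad (shell a b) u G" and G: "G \<in> borel_measurable (lebesgue_on (shell a b))"
    and u: "u \<in> borel_measurable (lebesgue_on (shell a b))"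
  shows "hardy_I a b u = (LINT x|lebesgue_on (shell a b). (norm (G x))^2)
    - hardy_const TYPE('a) * (LINT x|lebesgue_on (shell a b). (u x)^2 / (norm x)^2)"
proof -
  let ?W = "weak_grad (shell a b) u"
  have ae: "AE x in lebesgue_on (shell a b). G x = ?W x" by (rule weak_grad_AE_eq[OF shell_sets(2) wg])
  have W: "?W \<in> borel_measurable (lebesgue_on (shell a b))"
    by (rule borel_measurable_lebesgue_on_AE[OF _ G ae]) simp
  have [measurable]: "(norm :: 'a \<Rightarrow> real) \<in> borel_measurable (lebesgue_on (shell a b))"
    by (rule borel_measurable_lebesgue_on) measurable
  have "(LINT x|lebesgue_on (shell a b). (norm (?W x))^2) = (LINT x|lebesgue_on (shell a b). (norm (G x))^2)"
    by (rule integral_cong_AE) (use W G ae in \<open>auto elim: eventually_mono\<close>)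
  moreover have "(LINT x|lebesgue_on (ball 0 b - ball 0 a). (norm (?W x))^2) = (LINT x|lebesgue_on (shell a b). (norm (?W x))^2)"
    by (rule integral_annulus_eq_shell[OF a]) (use W in measurable)
  moreover have "(LINT x|lebesgue_on (ball 0 b - ball 0 a). (u x)^2 / (norm x)^2) = (LINT x|lebesgue_on (shell a b). (u x)^2 / (norm x)^2)"
    by (rule integral_annulus_eq_shell[OF a]) (use u in measurable)
  ultimately show ?thesis by (simp add: hardy_I_def)
qed

lemma L2_tendsto_cong:
  assumes "L2_tendsto M f g" "\<And>n x. x \<in> space M \<Longrightarrow> f n x = f' n x" "\<And>x. x \<in> space M \<Longrightarrow> g x = g' x"
  shows "L2_tendsto M f' g'"
  unfolding L2_tendsto_def
proof (intro conjI allI)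
  show "f' n \<in> L2_space M" for n by (rule L2_space_cong[OF assms(2) L2_tendstoD(1)[OF assms(1)]])
  show "g' \<in> L2_space M" by (rule L2_space_cong[OF assms(3) L2_tendstoD(2)[OF assms(1)]])
  have "L2_dist2 M (f n) g = L2_dist2 M (f' n) g'" for n
    by (rule Bochner_Integration.integral_cong) (use assms(2,3) in auto)
  then show "(\<lambda>n. L2_dist2 M (f' n) g') \<longlonglongrightarrow> 0" using L2_tendstoD(3)[OF assms(1)] by simp
qed

text \<open>
  Expanding |G + (N-2) u x / |x|^2|^2 produces the Dirichlet integral and a multiple of
  \<open>radial_flux\<close>. The Hardy terms agree because u^2 / |x|^2 is invariant, up to the Jacobian.
\<close>

lemma hardy_energy_kelvin:
  fixes u :: "'a::euclidean_space \<Rightarrow> real"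
  assumes N: "DIM('a) \<ge> 2" and e: "0 < e" "e < 1"
    and u: "u \<in> L2_space (lebesgue_on (shell e 1))" and G: "G \<in> L2_space (lebesgue_on (shell e 1))"
  shows "(LINT y|lebesgue_on (shell 1 (1 / e)). (norm (kelvin_grad u G y))^2)
      = (LINT x|lebesgue_on (shell e 1). (norm (G x))^2)
        + (real DIM('a) - 2) * radial_flux e u G"
    and "(LINT y|lebesgue_on (shell 1 (1 / e)). (kelvin u y)^2 / (norm y)^2) = (LINT x|lebesgue_on (shell e 1). (u x)^2 / (norm x)^2)"
proof -
  let ?S = "lebesgue_on (shell e 1)" and ?T = "lebesgue_on (shell 1 (1 / e))"
  let ?c = "real DIM('a) - 2"
  note sc = L2_tendsto_shell_scale[OF e(1) L2_tendsto_const[OF u], THEN L2_tendstoD(2)]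
  note i1 = L2_inner_integrable[OF sc(2) G] and i2 = L2_inner_integrable[OF sc(1) u] and i3 = L2_spaceD(2)[OF G]
  have factor: "z + (2 * c * a + c^2 * b) = z + c * (2 * a + c * b)" for z a b c :: real
    by (simp add: power2_eq_square algebra_simps)
  note j = integrable_mult_right[OF i1, of "2 * ?c"] integrable_mult_right[OF i2, of "?c^2"]
  have fl: "kelvin_flux u G \<in> L2_space ?S"
    by (rule L2_tendstoD(2)[OF L2_tendsto_kelvin_flux[OF e(1) L2_tendsto_const[OF u] L2_tendsto_const[OF G]]])
  have fm: "(\<lambda>x. (norm (kelvin_flux u G x))^2) \<in> borel_measurable ?S" using L2_spaceD(2)[OF fl] by auto
  have "(LINT y|?T. (norm (kelvin_grad u G y))^2) = (LINT y|?T. inversion_density y * (norm (kelvin_flux u G (inversion y)))^2)"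
    by (rule LINT_cong, rule norm_kelvin_grad) (auto simp: shell_def)
  also have "\<dots> = (LINT x|?S. (norm (kelvin_flux u G x))^2)" by (rule integral_inversion_shell(2)[symmetric, OF e fm])
  also have "\<dots> = (LINT x|?S. (norm (G x))^2 + (2 * ?c * (((u x / (norm x)^2) *\<^sub>R x) \<bullet> G x) + ?c^2 * ((u x / (norm x)^2) \<bullet> u x)))"
  proof (rule LINT_cong)
    fix x :: 'a assume "x \<in> space ?S"
    then have x: "norm x > 0" using e by (auto simp: shell_def)
    define v where "v = u x / (norm x)^2"
    have uv: "u x = v * (norm x)^2" using x by (simp add: v_def)
    have fx: "kelvin_flux u G x = G x + (?c * v) *\<^sub>R x" by (simp add: kelvin_flux_def v_def)
    have "(norm (kelvin_flux u G x))^2 = (norm (G x))^2 + (2 * ?c * ((v *\<^sub>R x) \<bullet> G x) + ?c^2 * (v * (v * (norm x)^2)))"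
      unfolding fx power2_norm_eq_inner
      by (simp add: inner_add_left inner_add_right inner_commute[of "G x" x] power2_eq_square[of "?c"] algebra_simps)
    then show "(norm (kelvin_flux u G x))^2 = (norm (G x))^2 + (2 * ?c * (((u x / (norm x)^2) *\<^sub>R x) \<bullet> G x) + ?c^2 * ((u x / (norm x)^2) \<bullet> u x))"
      unfolding v_def[symmetric] using uv by (simp only: inner_real_def)
  qed
  also have "\<dots> = (LINT x|?S. (norm (G x))^2) + (2 * ?c * (LINT x|?S. ((u x / (norm x)^2) *\<^sub>R x) \<bullet> G x) + ?c^2 * (LINT x|?S. (u x / (norm x)^2) \<bullet> u x))"
    by (subst Bochner_Integration.integral_add[OF i3 Bochner_Integration.integrable_add[OF j]],
        subst Bochner_Integration.integral_add[OF j], unfold integral_mult_right_zero, rule refl)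
  finally show "(LINT y|?T. (norm (kelvin_grad u G y))^2) = (LINT x|?S. (norm (G x))^2)
        + ?c * radial_flux e u G"
    unfolding factor radial_flux_def .
  have um: "(\<lambda>x. (u x)^2 / (norm x)^2) \<in> borel_measurable ?S"
  proof -
    have [measurable]: "(norm :: 'a \<Rightarrow> real) \<in> borel_measurable ?S"
      by (rule borel_measurable_lebesgue_on) measurable
    note [measurable] = L2_spaceD(1)[OF u]
    show ?thesis by measurable
  qed
  have "(LINT y|?T. (kelvin u y)^2 / (norm y)^2) = (LINT y|?T. inversion_density y * ((u (inversion y))^2 / (norm (inversion y))^2))"
  proof (rule LINT_cong)
    fix y :: 'a assume "y \<in> space ?T"
    then have y: "y \<noteq> 0" by (auto simp: shell_def)
    show "(kelvin u y)^2 / (norm y)^2 = inversion_density y * ((u (inversion y))^2 / (norm (inversion y))^2)"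
      unfolding kelvin_power2[OF N y] using y by (simp add: norm_inversion field_simps power2_eq_square)
  qed
  also have "\<dots> = (LINT x|?S. (u x)^2 / (norm x)^2)" by (rule integral_inversion_shell(2)[symmetric, OF e um])
  finally show "(LINT y|?T. (kelvin u y)^2 / (norm y)^2) = (LINT x|?S. (u x)^2 / (norm x)^2)" .
qed

theorem lemma5p1:
  fixes w u :: "'a::euclidean_space \<Rightarrow> real" and \<epsilon> :: real
  assumes "DIM('a) \<ge> 3"
    and "w \<in> W_space"
    and "u = kelvin w"
    and "0 < \<epsilon>" and "\<epsilon> < 1"
  shows "hardy_I \<epsilon> 1 u = hardy_I 1 (1 / \<epsilon>) w + 2 * hardy_Lambda (1 / \<epsilon>) w \<and>
         hardy_Lambda \<epsilon> u = hardy_Lambda (1 / \<epsilon>) w"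
proof -
  note N = assms(1) and e = assms(4,5)
  have N2: "DIM('a) \<ge> 2" using N by simp
  have uH: "u \<in> H_space" using assms(2,3) by (simp add: W_space_def)
  have wk: "kelvin u y = w y" if "y \<noteq> 0" for y using kelvin_kelvin[OF that] assms(3) by simp
  \<comment> \<open>The trace on the sphere of radius \<epsilon> needs convergence on both of its sides.\<close>
  define \<rho> where "\<rho> = \<epsilon> / 2"
  have \<rho>: "0 < \<rho>" "\<rho> < 1" "\<rho> < \<epsilon>" using e by (auto simp: \<rho>_def)
  obtain \<phi> G where \<phi>: "\<And>n. \<phi> n \<in> test_functions (ball (0::'a) 1)"
    and u: "L2_tendsto (lebesgue_on (shell \<rho> 1)) \<phi> u"
    and G: "L2_tendsto (lebesgue_on (shell \<rho> 1)) (\<lambda>n. grad (\<phi> n)) G"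
    using H_space_approximation[OF N uH \<rho>(1)] by blast
  have sm: "smooth_on S (\<phi> n)" for S n by (rule test_functions_smooth[OF \<phi>])
  define R where "R = 1 / \<epsilon>"
  have R: "R > 1" "1 / \<rho> = 2 * R" using e by (auto simp: R_def \<rho>_def)
  let ?k = "\<lambda>n. kelvin (\<phi> n)" and ?Gw = "kelvin_grad u G"
  have smk: "smooth_on (shell a b) (?k n)" if "a \<ge> 1" for a b n
    by (rule smooth_on_kelvin[OF shell_sets(2) _ sm]) (use that in \<open>auto simp: shell_def\<close>)
  have w: "L2_tendsto (lebesgue_on (shell 1 (1 / \<rho>))) ?k w"
    by (rule L2_tendsto_cong[OF L2_tendsto_kelvin[OF N2 \<rho>(1,2) u]]) (auto intro!: wk simp: shell_def)
  have Gw: "L2_tendsto (lebesgue_on (shell 1 (1 / \<rho>))) (\<lambda>n. grad (?k n)) ?Gw"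
    by (rule L2_tendsto_cong[OF L2_tendsto_kelvin_grad[OF \<rho>(1,2) u G]])
       (auto intro!: grad_kelvin[symmetric, OF N2] sm simp: shell_def)
  define \<delta> where "\<delta> = min (\<epsilon> / 2) (1 - \<epsilon>)"
  have \<delta>: "\<delta> > 0" "shell (\<epsilon> - \<delta>) (\<epsilon> + \<delta>) \<subseteq> (shell \<rho> 1 :: 'a set)" using e by (auto simp: \<delta>_def shell_def \<rho>_def)
  obtain g where g: "has_trace \<epsilon> u g" "L2_tendsto (sphere_measure \<epsilon>) \<phi> g"
    by (rule has_trace_exists[OF e(1) \<delta>(1) sm L2_tendsto_lebesgue_on_subset[OF u \<delta>(2)] L2_tendsto_lebesgue_on_subset[OF G \<delta>(2)]]) auto
  define \<delta>' where "\<delta>' = R - 1"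
  have \<delta>': "\<delta>' > 0" "R - \<delta>' = 1" "shell (R - \<delta>') (R + \<delta>') \<subseteq> (shell 1 (1 / \<rho>) :: 'a set)"
    using R by (auto simp: \<delta>'_def shell_def)
  have R0: "R > 0" using R by simp
  obtain gw where gw: "has_trace R w gw" "L2_tendsto (sphere_measure R) ?k gw"
    by (rule has_trace_exists[OF R0 \<delta>'(1) smk L2_tendsto_lebesgue_on_subset[OF w \<delta>'(3)] L2_tendsto_lebesgue_on_subset[OF Gw \<delta>'(3)]])
       (use \<delta>'(2) in auto)
  let ?c = "real DIM('a) - 2"
  have tr: "inverse R * (LINT x|sphere_measure R. (gw x)^2) = inverse \<epsilon> * (LINT x|sphere_measure \<epsilon>. (g x)^2)"
  proof (rule LIMSEQ_unique)
    show "(\<lambda>n. inverse R * (LINT x|sphere_measure R. (?k n x)^2)) \<longlonglongrightarrow> inverse R * (LINT x|sphere_measure R. (gw x)^2)"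
      using L2_tendsto_norm2[OF gw(2)] by (intro tendsto_mult tendsto_const) simp
    have "(\<lambda>n. inverse \<epsilon> * (LINT x|sphere_measure \<epsilon>. (\<phi> n x)^2)) \<longlonglongrightarrow> inverse \<epsilon> * (LINT x|sphere_measure \<epsilon>. (g x)^2)"
      using L2_tendsto_norm2[OF g(2)] by (intro tendsto_mult tendsto_const) simp
    then show "(\<lambda>n. inverse R * (LINT x|sphere_measure R. (?k n x)^2)) \<longlonglongrightarrow> inverse \<epsilon> * (LINT x|sphere_measure \<epsilon>. (g x)^2)"
      unfolding R_def using sphere_integral_kelvin[OF N2 e(1) test_functions_continuous(1)[OF \<phi>]] by simp
  qed
  have Lu: "hardy_Lambda \<epsilon> u = ?c / 2 * inverse \<epsilon> * (LINT x|sphere_measure \<epsilon>. (g x)^2)"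
    unfolding hardy_Lambda_def integral_sphere_trace[OF e(1) g(1)] by simp
  have Lw: "hardy_Lambda R w = ?c / 2 * inverse R * (LINT x|sphere_measure R. (gw x)^2)"
    unfolding hardy_Lambda_def integral_sphere_trace[OF R0 gw(1)] by simp
  have L: "hardy_Lambda \<epsilon> u = hardy_Lambda R w"
    unfolding Lu Lw mult.assoc tr ..
  have sub: "shell \<epsilon> 1 \<subseteq> (shell \<rho> 1 :: 'a set)" "shell 1 R \<subseteq> (shell 1 (1 / \<rho>) :: 'a set)"
    using \<rho> R by (auto simp: shell_def)
  have u': "L2_tendsto (lebesgue_on (shell \<epsilon> 1)) \<phi> u" and G': "L2_tendsto (lebesgue_on (shell \<epsilon> 1)) (\<lambda>n. grad (\<phi> n)) G"
    by (rule L2_tendsto_lebesgue_on_subset[OF u sub(1)] L2_tendsto_lebesgue_on_subset[OF G sub(1)]; simp)+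
  have w': "L2_tendsto (lebesgue_on (shell 1 R)) ?k w" and Gw': "L2_tendsto (lebesgue_on (shell 1 R)) (\<lambda>n. grad (?k n)) ?Gw"
    by (rule L2_tendsto_lebesgue_on_subset[OF w sub(2)] L2_tendsto_lebesgue_on_subset[OF Gw sub(2)]; simp)+
  have Iu: "hardy_I \<epsilon> 1 u = (LINT x|lebesgue_on (shell \<epsilon> 1). (norm (G x))^2)
    - hardy_const TYPE('a) * (LINT x|lebesgue_on (shell \<epsilon> 1). (u x)^2 / (norm x)^2)"
    by (rule hardy_I_eq[OF e(1) has_weak_grad_L2_limit[OF shell_sets(2) sm u' G']
          L2_spaceD(1)[OF L2_tendstoD(2)[OF G']] L2_spaceD(1)[OF L2_tendstoD(2)[OF u']]])
  have Iw: "hardy_I 1 R w = (LINT y|lebesgue_on (shell 1 R). (norm (?Gw y))^2)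
    - hardy_const TYPE('a) * (LINT y|lebesgue_on (shell 1 R). (w y)^2 / (norm y)^2)"
    by (rule hardy_I_eq[OF zero_less_one has_weak_grad_L2_limit[OF shell_sets(2) smk[OF order_refl] w' Gw']
          L2_spaceD(1)[OF L2_tendstoD(2)[OF Gw']] L2_spaceD(1)[OF L2_tendstoD(2)[OF w']]])
  note E = hardy_energy_kelvin[OF N2 e L2_tendstoD(2)[OF u'] L2_tendstoD(2)[OF G'], folded R_def]
  have ww: "(LINT y|lebesgue_on (shell 1 R). (w y)^2 / (norm y)^2) = (LINT y|lebesgue_on (shell 1 R). (kelvin u y)^2 / (norm y)^2)"
  proof (rule LINT_cong)
    fix y :: 'a assume "y \<in> space (lebesgue_on (shell 1 R))"
    then have "y \<noteq> 0" by (auto simp: shell_def)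
    then show "(w y)^2 / (norm y)^2 = (kelvin u y)^2 / (norm y)^2" by (simp add: wk)
  qed
  \<comment> \<open>The energies differ by a multiple of the flux, which the boundary integral of the trace evaluates.\<close>
  have "hardy_I 1 R w = hardy_I \<epsilon> 1 u - ?c * (inverse \<epsilon> * (LINT x|sphere_measure \<epsilon>. (g x)^2))"
    unfolding Iu Iw ww E boundary_flux_limit[OF N e \<phi> u' G' g(2)] by simp
  then have "hardy_I \<epsilon> 1 u = hardy_I 1 R w + 2 * hardy_Lambda R w"
    unfolding L[symmetric] Lu by simp
  with L show ?thesis by (simp add: R_def)
qed

end
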